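(* Let $G\leq \mathrm{Aut}(X^* )$ be a finitely generated regular branch group that is just infinite, is strongly self-replicating, has well-approximated subgroups, and obeys the Grigorchuk--Nagnibeda alternative. For $L\leq G$ the following are equivalent: (1) $L$ is not in the perfect kernel of $\mathrm{Sub}(G)$; (2) there is a spanning leaf set $Y$ such that $\mathrm{st}_L(Y)$ is an infra-direct product of $G^Y$; (3) $\mathrm{rk_{CB}}(L)<\omega$; (4) $\mathrm{depth}(L)<\infty$ and $L$ is finitely generated.
   Context: Let $X$ be a finite set and $X^*$ the free monoid on $X$, identified with the rooted tree in which the children of $w$ are the words $wx$, $x\in X$. $|x|$ denotes word length, $X^n$ the words of length $n$, $x\sqsubseteq y$ means $x$ is a prefix of $y$. $\mathrm{Aut}(X^* )$ is the group of bijections of $X^*$ preserving the prefix relation. For $g\in\mathrm{Aut}(X^* )$, $u\in X^*$ the section $g_u$ is defined by $g(uw)=g(u)g_u(w)$; $\psi_u(g)=g_u$ and $\psi_u(S)=\{g_u:g\in S\}$. For $G\le\mathrm{Aut}(X^* )$: $\mathrm{st}_G(x)$ is the vertex stabilizer, $\mathrm{st}_G(Y)=\bigcap_{y\in Y}\mathrm{st}_G(y)$, $\mathrm{st}_G(n)=\mathrm{st}_G(X^n)$. A leaf set is a finite $Y\subseteq X^*$ no element of which is a prefix of another; it is spanning if there is $N$ such that every $x$ with $|x|\ge N$ has a prefix in $Y$. $G^Y$ is the group of automorphisms acting as an element of $G$ below each $y\in Y$ and trivially elsewhere ($\cong G^{|Y|}$ via $(\psi_y)_{y\in Y}$). For $H\le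 G$ and spanning leaf set $Y$, $\mathrm{st}_H(Y)$ is an infra-direct product of $G^Y$ if $\psi_y(\mathrm{st}_H(Y))$ is a finite index subgroup of $G$ for every $y\in Y$. $G$ is self-similar if $g_x\in G$ for all $g\in G,x\in X^*$; strongly self-replicating if self-similar and $\psi_x(\mathrm{st}_G(n))=G$ for all $n\ge1$, $x\in X^n$. $G$ is regular branch if self-similar, level-transitive, and has a finite index normal subgroup $K$ with $K^{\{x\}}\le K$ for all $x$ and $K^{X^n}$ of finite index in $G$ for all $n$. Just infinite: infinite with all proper quotients finite. Well-approximated subgroups: $\bigcap_{n\ge0}H\,\mathrm{st}_G(n)=H$ for all finitely generated $H\le G$. Grigorchuk--Nagnibeda alternative: every finitely generated $H\le G$ either has $\psi_y(H)$ finite for some $y\in X^*$, or has a spanning leaf set $Y$ with $\mathrm{st}_H(Y)$ an infra-direct product of $G^Y$. $\mathrm{Sub}(G)$ is the space of subgroups with the topology induced from $\{0,1\}^G$. Cantor--Bendixson derivatives: $Z^0=Z$, $Z^{\alpha+1}=$ non-isolated points of $Z^\alpha$, $Z^\lambda=\bigcap_{\alpha<\lambda}Z^\alpha$; $\mathrm{rk_{CB}}(x)$ is the ordinal $\alpha$ with $x\in Z^\alpha\setminus Z^{\alpha+1}$; the perfect kernel is the stable derivative. The depth $\mathrm{depth}(L)$ of $L\le G$ is the supremum of $n$ such that there is a chain $G=H_0>H_1>\dots>H_n=L$ of subgroups with $|H_i:H_{i+1}|=\infty$ for all $i$. *)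

theory Defs
  imports "HOL-Library.Sublist" "HOL-Algebra.Coset" "HOL-Algebra.Generated_Groups"
          "HOL-Analysis.Function_Topology"
begin

text \<open>The alphabet X is the (finite) universe of the type 'a; words are lists;
  the prefix relation is the library's prefix.\<close>

definition AutX :: "('a::finite list \<Rightarrow> 'a list) monoid" where
  "AutX = \<lparr>carrier = {g. bij g \<and> (\<forall>x y. prefix x y \<longleftrightarrow> prefix (g x) (g y))},
           mult = (\<circ>), one = id\<rparr>"

definition level :: "nat \<Rightarrow> 'a::finite list set" where
  "level n = {w. length w = n}"

text \<open>Section g_u, defined by g(uw) = g(u) g_u(w).\<close>
definition sect :: "('a::finite list \<Rightarrow> 'a list) \<Rightarrow> 'a list \<Rightarrow> ('a list \<Rightarrow> 'a list)" where
  "sect g u = (\<lambda>w. drop (length u) (g (u @ w)))"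

definition psi :: "'a::finite list \<Rightarrow> ('a list \<Rightarrow> 'a list) set \<Rightarrow> ('a list \<Rightarrow> 'a list) set" where
  "psi u S = (\<lambda>g. sect g u) ` S"

definition st :: "('a::finite list \<Rightarrow> 'a list) set \<Rightarrow> 'a list set \<Rightarrow> ('a list \<Rightarrow> 'a list) set" where
  "st H Y = {g \<in> H. \<forall>y\<in>Y. g y = y}"

definition index_finite :: "('a::finite list \<Rightarrow> 'a list) set \<Rightarrow> ('a list \<Rightarrow> 'a list) set \<Rightarrow> bool" where
  "index_finite K H = finite ((\<lambda>k. H #>\<^bsub>AutX\<^esub> k) ` K)"

definition fin_gen :: "('a::finite list \<Rightarrow> 'a list) set \<Rightarrow> bool" where
  "fin_gen H = (\<exists>S. finite S \<and> S \<subseteq> carrier AutX \<and> H = generate AutX S)"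

definition subgrp :: "('a::finite list \<Rightarrow> 'a list) set \<Rightarrow> ('a list \<Rightarrow> 'a list) set \<Rightarrow> bool" where
  "subgrp H G = (subgroup H AutX \<and> H \<subseteq> G)"

definition leaf_set :: "'a::finite list set \<Rightarrow> bool" where
  "leaf_set Y = (finite Y \<and> (\<forall>y\<in>Y. \<forall>y'\<in>Y. prefix y y' \<longrightarrow> y = y'))"

definition spanning_leaf_set :: "'a::finite list set \<Rightarrow> bool" where
  "spanning_leaf_set Y = (leaf_set Y \<and> (\<exists>N. \<forall>x. length x \<ge> N \<longrightarrow> (\<exists>y\<in>Y. prefix y x)))"

definition rigid :: "('a::finite list \<Rightarrow> 'a list) set \<Rightarrow> 'a list set \<Rightarrow> ('a list \<Rightarrow> 'a list) set" where
  "rigid G Y = {g \<in> carrier AutX. (\<forall>w. (\<forall>y\<in>Y. \<not> prefix y w) \<longrightarrow> g w = w)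
                 \<and> (\<forall>y\<in>Y. g y = y \<and> sect g y \<in> G)}"

definition infra_direct :: "('a::finite list \<Rightarrow> 'a list) set \<Rightarrow> ('a list \<Rightarrow> 'a list) set \<Rightarrow> 'a list set \<Rightarrow> bool" where
  "infra_direct G H Y = (\<forall>y\<in>Y. psi y (st H Y) \<subseteq> G \<and> index_finite G (psi y (st H Y)))"

definition self_similar :: "('a::finite list \<Rightarrow> 'a list) set \<Rightarrow> bool" where
  "self_similar G = (\<forall>g\<in>G. \<forall>x. sect g x \<in> G)"

definition level_transitive :: "('a::finite list \<Rightarrow> 'a list) set \<Rightarrow> bool" where
  "level_transitive G = (\<forall>n. \<forall>u\<in>level n. \<forall>v\<in>level n. \<exists>g\<in>G. g u = v)"

definition strongly_self_replicating :: "('a::finite list \<Rightarrow> 'a list) set \<Rightarrow> bool" where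
  "strongly_self_replicating G = (self_similar G \<and>
     (\<forall>n\<ge>1. \<forall>x\<in>level n. psi x (st G (level n)) = G))"

definition regular_branch :: "('a::finite list \<Rightarrow> 'a list) set \<Rightarrow> bool" where
  "regular_branch G = (self_similar G \<and> level_transitive G \<and>
     (\<exists>K. K \<lhd> (AutX\<lparr>carrier := G\<rparr>) \<and> index_finite G K \<and>
          (\<forall>x. rigid K {x} \<subseteq> K) \<and>
          (\<forall>n. rigid K (level n) \<subseteq> G \<and> index_finite G (rigid K (level n)))))"

definition just_infinite :: "('a::finite list \<Rightarrow> 'a list) set \<Rightarrow> bool" where
  "just_infinite G = (infinite G \<and>
     (\<forall>N. N \<lhd> (AutX\<lparr>carrier := G\<rparr>) \<and> N \<noteq> {id} \<longrightarrow> index_finite G N))"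

definition well_approximated :: "('a::finite list \<Rightarrow> 'a list) set \<Rightarrow> bool" where
  "well_approximated G = (\<forall>H. subgrp H G \<and> fin_gen H \<longrightarrow>
     (\<Inter>n. H <#>\<^bsub>AutX\<^esub> st G (level n)) = H)"

definition GN_alternative :: "('a::finite list \<Rightarrow> 'a list) set \<Rightarrow> bool" where
  "GN_alternative G = (\<forall>H. subgrp H G \<and> fin_gen H \<longrightarrow>
     (\<exists>y. finite (psi y H)) \<or> (\<exists>Y. spanning_leaf_set Y \<and> infra_direct G H Y))"

text \<open>A subgroup H of G is identified with its indicator function on G, an element
  of {0,1}^G (here bool^G, with the product of discrete topologies).\<close>
definition sub_emb :: "('a::finite list \<Rightarrow> 'a list) set \<Rightarrow> ('a list \<Rightarrow> 'a list) set
                        \<Rightarrow> (('a list \<Rightarrow> 'a list) \<Rightarrow> bool)" where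
  "sub_emb G H = restrict (\<lambda>g. g \<in> H) G"

definition SubTop :: "('a::finite list \<Rightarrow> 'a list) set \<Rightarrow> (('a list \<Rightarrow> 'a list) \<Rightarrow> bool) topology" where
  "SubTop G = subtopology (product_topology (\<lambda>_. discrete_topology (UNIV::bool set)) G)
                (sub_emb G ` {H. subgrp H G})"

definition cb_deriv :: "'b topology \<Rightarrow> 'b set \<Rightarrow> 'b set" where
  "cb_deriv T A = A \<inter> (T derived_set_of A)"

text \<open>The transfinite derivatives Z^alpha (all ordinals alpha) form the least family
  containing Z, closed under one derivative step and under intersections of nonempty
  subfamilies (limit stages).\<close>
inductive_set cb_iter :: "'b topology \<Rightarrow> 'b set set" for T where
  base: "topspace T \<in> cb_iter T"
| step: "A \<in> cb_iter T \<Longrightarrow> cb_deriv T A \<in> cb_iter T"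
| lim:  "S \<noteq> {} \<Longrightarrow> \<forall>A\<in>S. A \<in> cb_iter T \<Longrightarrow> \<Inter>S \<in> cb_iter T"

text \<open>The perfect kernel: the stable (= smallest) derivative.\<close>
definition perfect_kernel :: "'b topology \<Rightarrow> 'b set" where
  "perfect_kernel T = \<Inter>(cb_iter T)"

definition cb_fin :: "'b topology \<Rightarrow> nat \<Rightarrow> 'b set" where
  "cb_fin T n = (cb_deriv T ^^ n) (topspace T)"

definition cb_rank_finite :: "'b topology \<Rightarrow> 'b \<Rightarrow> bool" where
  "cb_rank_finite T x = (\<exists>n. x \<in> cb_fin T n \<and> x \<notin> cb_fin T (Suc n))"

definition depth_finite :: "('a::finite list \<Rightarrow> 'a list) set \<Rightarrow> ('a list \<Rightarrow> 'a list) set \<Rightarrow> bool" where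
  "depth_finite G L = (\<exists>N::nat. \<forall>n H. H 0 = G \<and> H n = L \<and>
      (\<forall>i<n. subgrp (H (Suc i)) (H i) \<and> \<not> index_finite (H i) (H (Suc i))) \<longrightarrow> n \<le> N)"

end

theory Submission
  imports Defs
begin

text \<open>
  Let \<open>F\<close> have finite index in \<open>G\<close> and let \<open>N \<le> G\<close> be normalized by \<open>F\<close>. Since \<open>G\<close> is level transitive,
  \<open>F\<close> has at most \<open>|G : F|\<close> orbits on each level; on a level where the number of orbits of vertices moved
  by \<open>N\<close> is maximal, every vertex is either moved or has nothing moving below it. The double commutator
  trick and just infiniteness then show that \<open>N\<close> has finite index in the group of all elements of \<open>G\<close>
  acting trivially below each vertex below which \<open>N\<close> acts trivially. So up to finite index \<open>N\<close> is determined
  by a number between \<open>0\<close> and \<open>|G : F|\<close>, monotone in \<open>N\<close>.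

  Given \<open>L\<close> with \<open>st L Y\<close> infra-direct, enumerate \<open>Y\<close> as \<open>y\<^sub>0, y\<^sub>1, \<dots>\<close> and apply this to the sections at \<open>y\<^sub>i\<close> of those
  elements of \<open>st H Y\<close> that are trivial below \<open>y\<^sub>0, \<dots>, y\<^sub>i\<^sub>-\<^sub>1\<close>, for \<open>H \<ge> L\<close>. The sum of these numbers is a bounded rank
  of \<open>H\<close> that increases strictly along infinite index inclusions, so the depth is finite. By the same
  analysis the commensurator of \<open>H\<close> in \<open>G\<close> contains \<open>H\<close> with finite index, hence \<open>H\<close> has only finitely
  many overgroups of finite index; together with the rank this yields that \<open>L\<close> is finitely generated
  and that its Cantor--Bendixson rank is finite.

  Conversely, a subgroup \<open>L\<close> with a finite section can be enlarged with infinite index, inside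
  \<open>L st G (level n)\<close>, by adjoining copies of the branching subgroup along an \<open>L\<close>-orbit of deep vertices, so
  that some section stays finite. Iterating this gives infinite depth, and with well-approximation it
  shows that the subgroups that are not infra-direct accumulate at each other.
\<close>

section \<open>Automorphisms of the word tree\<close>

abbreviation Aut :: "('a::finite list \<Rightarrow> 'a list) set" where
  "Aut \<equiv> carrier AutX"

abbreviation finv :: "('b \<Rightarrow> 'b) \<Rightarrow> 'b \<Rightarrow> 'b" where
  "finv f \<equiv> inv_into UNIV f"

lemma Aut_iff: "g \<in> Aut \<longleftrightarrow> bij g \<and> (\<forall>x y. prefix x y \<longleftrightarrow> prefix (g x) (g y))"
  by (simp add: AutX_def)

lemma AutX_mult [simp]: "f \<otimes>\<^bsub>AutX\<^esub> g = f \<circ> g"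
  and AutX_one [simp]: "\<one>\<^bsub>AutX\<^esub> = id"
  by (simp_all add: AutX_def)

lemma Aut_bij: "g \<in> Aut \<Longrightarrow> bij g"
  by (simp add: Aut_iff)

lemma Aut_prefix: "g \<in> Aut \<Longrightarrow> prefix (g x) (g y) \<longleftrightarrow> prefix x y"
  by (simp add: Aut_iff)

lemma Aut_id [simp]: "id \<in> Aut"
  by (simp add: Aut_iff)

lemma Aut_comp [simp]: "g \<in> Aut \<Longrightarrow> h \<in> Aut \<Longrightarrow> g \<circ> h \<in> Aut"
  by (auto simp: Aut_iff bij_comp)

lemma Aut_finv_left [simp]: "g \<in> Aut \<Longrightarrow> finv g (g x) = x"
  by (simp add: Aut_bij bij_is_inj)

lemma Aut_finv_right [simp]: "g \<in> Aut \<Longrightarrow> g (finv g x) = x"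
  by (simp add: Aut_bij bij_is_surj surj_f_inv_f)

lemma Aut_finv_comp [simp]: "g \<in> Aut \<Longrightarrow> finv g \<circ> g = id" "g \<in> Aut \<Longrightarrow> g \<circ> finv g = id"
  by (auto simp: fun_eq_iff)

lemma Aut_finv [simp]: "g \<in> Aut \<Longrightarrow> finv g \<in> Aut"
  unfolding Aut_iff
  by (metis bij_imp_bij_inv bij_inv_eq_iff)

lemma Aut_eq_iff: "g \<in> Aut \<Longrightarrow> g x = g y \<longleftrightarrow> x = y"
  by (metis Aut_finv_left)

lemma finv_comp_distrib: "g \<in> Aut \<Longrightarrow> h \<in> Aut \<Longrightarrow> finv (g \<circ> h) = finv h \<circ> finv g"
  by (simp add: Aut_bij o_inv_distrib)

lemma finv_finv [simp]: "g \<in> Aut \<Longrightarrow> finv (finv g) = g"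
  by (simp add: Aut_bij inv_inv_eq)

lemma finv_unique: "g \<in> Aut \<Longrightarrow> g \<circ> h = id \<Longrightarrow> finv g = h"
  by (metis Aut_finv_comp(1) comp_assoc comp_id id_comp)

lemma group_AutX: "group AutX"
proof (rule groupI)
  fix x :: "'a list \<Rightarrow> 'a list" assume "x \<in> Aut"
  then show "\<exists>y\<in>Aut. y \<otimes>\<^bsub>AutX\<^esub> x = \<one>\<^bsub>AutX\<^esub>"
    by (intro bexI[of _ "finv x"]) auto
qed (auto simp: comp_assoc)

lemma AutX_m_inv: "g \<in> Aut \<Longrightarrow> m_inv AutX g = finv g"
  using group.inv_equality[OF group_AutX, of "finv g" g] by simp

text \<open>A word of length \<open>n\<close> has exactly \<open>n + 1\<close> prefixes, and
  \<open>g\<close> carries the prefixes of \<open>x\<close> bijectively onto those of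
  \<open>g x\<close>; so the prefix order alone determines the length.\<close>

lemma Aut_length [simp]:
  assumes "g \<in> Aut" shows "length (g x) = length x"
proof -
  have card: "card {y. prefix y z} = Suc (length z)" for z :: "'a list"
    using distinct_card[OF distinct_prefixes, of z]
    by (simp add: set_prefixes_eq)
  have "g ` {y. prefix y x} = {y. prefix y (g x)}"
    using assms by (auto simp: Aut_prefix image_iff) (metis Aut_finv_right Aut_prefix)
  moreover have "inj_on g {y. prefix y x}"
    using assms by (simp add: Aut_eq_iff inj_on_def)
  ultimately show ?thesis
    using card[of x] card[of "g x"] by (metis card_image nat.inject)
qed

lemma Aut_append:
  assumes "g \<in> Aut" shows "g (u @ w) = g u @ sect g u w"
proof -
  have "prefix (g u) (g (u @ w))" using assms by (simp add: Aut_prefix)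
  then show ?thesis using assms by (auto simp: sect_def prefix_def)
qed

lemma sect_Aut [simp]:
  assumes "g \<in> Aut" shows "sect g u \<in> Aut"
proof -
  have eq: "g (u @ w) = g u @ sect g u w" for w using Aut_append[OF assms] .
  have "inj (sect g u)"
  proof (rule injI)
    fix x y assume "sect g u x = sect g u y"
    then have "g (u @ x) = g (u @ y)" by (simp add: eq)
    then show "x = y" using assms by (simp add: Aut_eq_iff)
  qed
  moreover have "surj (sect g u)"
  unfolding surj_def
  proof
    fix z
    have "prefix u (finv g (g u @ z))"
      using assms Aut_prefix[OF assms, of u "finv g (g u @ z)"] by simp
    then obtain x where "finv g (g u @ z) = u @ x" by (auto simp: prefix_def)
    then have "g u @ z = g (u @ x)" using assms by (metis Aut_finv_right)
    then show "\<exists>x. z = sect g u x" by (auto simp: eq)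
  qed
  moreover have "prefix (sect g u x) (sect g u y) \<longleftrightarrow> prefix x y" for x y
    using Aut_prefix[OF assms, of "u @ x" "u @ y"] by (simp add: eq)
  ultimately show ?thesis by (auto simp: Aut_iff bij_def)
qed

lemma sect_comp:
  assumes "g \<in> Aut" "h \<in> Aut" shows "sect (g \<circ> h) u = sect g (h u) \<circ> sect h u"
proof
  fix w
  have "(g \<circ> h) (u @ w) = g (h u) @ sect g (h u) (sect h u w)"
    using assms by (simp add: Aut_append)
  then show "sect (g \<circ> h) u w = (sect g (h u) \<circ> sect h u) w"
    using Aut_append[of "g \<circ> h" u w] assms by simp
qed

lemma sect_append: "sect g (u @ w) = sect (sect g u) w"
  by (simp add: sect_def add.commute)

lemma sect_id [simp]: "sect id u = id"
  by (simp add: sect_def fun_eq_iff)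

lemma sect_finv:
  assumes "g \<in> Aut" shows "sect (finv g) u = finv (sect g (finv g u))"
  using finv_unique[of "sect g (finv g u)" "sect (finv g) u"] assms
  by (simp add: sect_comp[symmetric])

lemma sect_finv_fixed: "g \<in> Aut \<Longrightarrow> g u = u \<Longrightarrow> sect (finv g) u = finv (sect g u)"
  by (metis Aut_finv_left sect_finv)

lemma sect_comp_finv:
  assumes "g \<in> Aut" "h \<in> Aut" "finv g u = finv h u"
  shows "sect (g \<circ> finv h) u = sect g (finv h u) \<circ> finv (sect h (finv h u))"
  using assms by (simp add: sect_comp sect_finv)

lemma sect_id_iff: "g \<in> Aut \<Longrightarrow> g u = u \<Longrightarrow> sect g u = id \<longleftrightarrow> (\<forall>w. g (u @ w) = u @ w)"
  by (auto simp: fun_eq_iff Aut_append)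

lemma spanning_level: "spanning_leaf_set (level n)"
  unfolding spanning_leaf_set_def leaf_set_def
proof (intro conjI exI[of _ n] allI impI ballI)
  show "finite (level n :: 'a list set)"
    unfolding level_def using finite_lists_length_eq[of "UNIV :: 'a set" n] by simp
  fix x :: "'a list" assume "n \<le> length x"
  then show "\<exists>y\<in>level n. prefix y x"
    by (intro bexI[of _ "take n x"]) (auto simp: level_def take_is_prefix)
qed (auto simp: level_def prefix_def)

lemma finite_level [simp]: "finite (level n)"
  using spanning_level by (auto simp: spanning_leaf_set_def leaf_set_def)

text \<open>A short word may have no prefix in \<open>Y\<close>, but padding it with
  \<open>N\<close> arbitrary letters makes it long enough to have one.\<close>

lemma spanning_extend:
  assumes "spanning_leaf_set Y" obtains z y where "y \<in> Y" "prefix y (x @ z)"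
proof -
  obtain N where "\<forall>x. length x \<ge> N \<longrightarrow> (\<exists>y\<in>Y. prefix y x)"
    using assms by (auto simp: spanning_leaf_set_def)
  then have "\<exists>y\<in>Y. prefix y (x @ replicate N undefined)" by simp
  then show ?thesis using that by blast
qed

text \<open>Both maps agree on an extension of \<open>x\<close> that passes through
  \<open>Y\<close>, and the value at \<open>x\<close> is the prefix of length
  \<open>length x\<close> of that common value.\<close>

lemma Aut_eqI_spanning:
  assumes Y: "spanning_leaf_set Y" and gh: "g \<in> Aut" "h \<in> Aut"
    and eq: "\<And>y. y \<in> Y \<Longrightarrow> g y = h y" "\<And>y. y \<in> Y \<Longrightarrow> sect g y = sect h y"
  shows "g = h"
proof
  fix x
  obtain z y where y: "y \<in> Y" "prefix y (x @ z)" using spanning_extend[OF Y] .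
  then obtain w where w: "x @ z = y @ w" by (auto simp: prefix_def)
  have "g (x @ z) = h (x @ z)" unfolding w using eq[OF y(1)] gh by (simp add: Aut_append)
  then show "g x = h x" using gh by (auto simp: Aut_append)
qed

section \<open>Subgroups and finite index\<close>

abbreviation sg :: "('a::finite list \<Rightarrow> 'a list) set \<Rightarrow> bool" where
  "sg H \<equiv> subgroup H AutX"

lemma sgD:
  assumes "sg H"
  shows "id \<in> H" "H \<subseteq> Aut" "a \<in> H \<Longrightarrow> a \<in> Aut" "a \<in> H \<Longrightarrow> b \<in> H \<Longrightarrow> a \<circ> b \<in> H" "a \<in> H \<Longrightarrow> finv a \<in> H"
proof -
  show "id \<in> H" using subgroup.one_closed[OF assms] by simp
  show sub: "H \<subseteq> Aut" by (rule subgroup.subset[OF assms])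
  show Aut: "a \<in> H \<Longrightarrow> a \<in> Aut" using sub by (rule subsetD)
  show "a \<in> H \<Longrightarrow> b \<in> H \<Longrightarrow> a \<circ> b \<in> H" using subgroup.m_closed[OF assms, of a b] by simp
  show "a \<in> H \<Longrightarrow> finv a \<in> H"
    using subgroup.m_inv_closed[OF assms, of a] by (simp add: AutX_m_inv[OF Aut])
qed

lemma sgI:
  assumes "H \<subseteq> Aut" "id \<in> H" "\<And>a b. a \<in> H \<Longrightarrow> b \<in> H \<Longrightarrow> a \<circ> b \<in> H"
    "\<And>a. a \<in> H \<Longrightarrow> finv a \<in> H"
  shows "sg H"
proof
  show "m_inv AutX x \<in> H" if "x \<in> H" for x
    using assms(4)[OF that] AutX_m_inv[OF subsetD[OF assms(1) that]] by simp
qed (use assms in simp_all)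

lemma comp_finv_cancel:
  "a \<in> Aut \<Longrightarrow> b \<in> Aut \<Longrightarrow> x \<in> Aut \<Longrightarrow> (a \<circ> finv x) \<circ> finv (b \<circ> finv x) = a \<circ> finv b"
  by (simp add: finv_comp_distrib fun_eq_iff)

lemma sg_Int:
  assumes "sg A" "sg B" shows "sg (A \<inter> B)"
  by (rule sgI) (use sgD[OF assms(1)] sgD[OF assms(2)] in auto)

lemma sg_st:
  assumes "sg H" shows "sg (st H Y)"
proof (rule sgI)
  fix a assume a: "a \<in> st H Y"
  then have "finv a y = y" if "y \<in> Y" for y
    using that sgD(3)[OF assms, of a] Aut_finv_left[of a y] by (simp add: st_def)
  then show "finv a \<in> st H Y" using a sgD(5)[OF assms] by (simp add: st_def)
qed (use sgD[OF assms] in \<open>auto simp: st_def\<close>)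

text \<open>Translates normality in the group with restricted carrier into closure under conjugation
  inside \<open>Aut\<close>, the form in which it is used later.\<close>

lemma normal_in_subgroup_iff:
  assumes G: "sg G"
  shows "N \<lhd> (AutX\<lparr>carrier := G\<rparr>) \<longleftrightarrow>
    sg N \<and> N \<subseteq> G \<and> (\<forall>g\<in>G. \<forall>n\<in>N. g \<circ> n \<circ> finv g \<in> N)"
proof -
  interpret A: group AutX by (rule group_AutX)
  have inv: "m_inv (AutX\<lparr>carrier := G\<rparr>) g = finv g" if "g \<in> G" for g
    using A.m_inv_consistent[OF G that] that sgD(3)[OF G that] by (simp add: AutX_m_inv)
  have sub: "subgroup N (AutX\<lparr>carrier := G\<rparr>) \<longleftrightarrow> sg N \<and> N \<subseteq> G"
    using A.incl_subgroup[OF G, of N] A.subgroup_incl[OF _ G, of N] subgroup.subset[of N "AutX\<lparr>carrier := G\<rparr>"]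
    by auto
  show ?thesis
    using group.normal_inv_iff[OF A.subgroup_imp_group[OF G], of N] inv sub
    by (auto simp: AutX_def)
qed

text \<open>Finite index is handled throughout by separating functions with finite range.\<close>

lemma index_finiteI:
  assumes H: "sg H" and K: "K \<subseteq> Aut" and f: "finite (f ` K)"
    and sep: "\<And>a b. a \<in> K \<Longrightarrow> b \<in> K \<Longrightarrow> f a = f b \<Longrightarrow> a \<circ> finv b \<in> H"
  shows "index_finite K H"
proof -
  \<comment> \<open>One element is chosen in each fibre of \<open>f\<close>; every coset is the
    coset of a chosen element, so there are at most as many cosets as values of
    \<open>f\<close>.\<close>
  define r where "r v = (SOME k. k \<in> K \<and> f k = v)" for v
  have r: "r (f k) \<in> K \<and> f (r (f k)) = f k" if "k \<in> K" for k
    unfolding r_def by (rule someI[of _ k]) (use that in simp)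
  have "H #>\<^bsub>AutX\<^esub> k = H #>\<^bsub>AutX\<^esub> r (f k)" if k: "k \<in> K" for k
  proof -
    let ?r = "r (f k)"
    have A: "k \<in> Aut" "?r \<in> Aut" using k r[OF k] K by auto
    have "k \<circ> finv ?r \<in> H" using sep k r[OF k] by metis
    moreover have "k = (k \<circ> finv ?r) \<circ> ?r" using A by (simp add: comp_assoc)
    ultimately have "k \<in> H #>\<^bsub>AutX\<^esub> ?r" unfolding r_coset_def by auto
    then show ?thesis using group.repr_independence[OF group_AutX] H A by metis
  qed
  then have "(\<lambda>k. H #>\<^bsub>AutX\<^esub> k) ` K \<subseteq> (\<lambda>v. H #>\<^bsub>AutX\<^esub> r v) ` (f ` K)" by auto
  then show ?thesis unfolding index_finite_def using f finite_subset by blast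
qed

lemma index_finiteE:
  assumes "index_finite K H" and H: "sg H" and K: "K \<subseteq> Aut"
  obtains f :: "('a::finite list \<Rightarrow> 'a list) \<Rightarrow> ('a list \<Rightarrow> 'a list) set"
  where "finite (f ` K)" "\<And>a b. a \<in> K \<Longrightarrow> b \<in> K \<Longrightarrow> f a = f b \<Longrightarrow> a \<circ> finv b \<in> H"
proof (rule that)
  show "finite ((\<lambda>k. H #>\<^bsub>AutX\<^esub> k) ` K)" using assms(1) by (simp add: index_finite_def)
  fix a b assume ab: "a \<in> K" "b \<in> K" and eq: "H #>\<^bsub>AutX\<^esub> a = H #>\<^bsub>AutX\<^esub> b"
  have "a \<in> H #>\<^bsub>AutX\<^esub> a" using sgD(1)[OF H] unfolding r_coset_def by (auto intro!: bexI[of _ id])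
  then obtain h where "h \<in> H" "a = h \<circ> b" using eq by (auto simp: r_coset_def)
  then show "a \<circ> finv b \<in> H" using ab K by (auto simp: comp_assoc)
qed

lemma index_finite_reps:
  assumes "index_finite K H" "sg H" "K \<subseteq> Aut"
  obtains R where "finite R" "R \<subseteq> K" "\<And>k. k \<in> K \<Longrightarrow> \<exists>r\<in>R. k \<circ> finv r \<in> H"
proof -
  obtain f :: "_ \<Rightarrow> ('a::finite list \<Rightarrow> 'a list) set" where
    f: "finite (f ` K)" "\<And>a b. a \<in> K \<Longrightarrow> b \<in> K \<Longrightarrow> f a = f b \<Longrightarrow> a \<circ> finv b \<in> H"
    by (rule index_finiteE[OF assms]) blast
  obtain R where "R \<subseteq> K" "finite R" "f ` K = f ` R"
    using finite_subset_image[OF f(1), of f K] by auto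
  moreover have "\<exists>r\<in>R. k \<circ> finv r \<in> H" if k: "k \<in> K" for k
  proof -
    obtain r where "r \<in> R" "f k = f r" using \<open>f ` K = f ` R\<close> k by (metis imageE imageI)
    then show ?thesis using f(2) k \<open>R \<subseteq> K\<close> by blast
  qed
  ultimately show ?thesis using that by blast
qed

lemma index_finite_refl:
  assumes "sg H" shows "index_finite H H"
  by (rule index_finiteI[where f = "\<lambda>_. ()"]) (use assms sgD[OF assms] in auto)

lemma index_finite_mono_left: "index_finite K H \<Longrightarrow> K' \<subseteq> K \<Longrightarrow> index_finite K' H"
  unfolding index_finite_def by (meson finite_subset image_mono)

lemma index_finite_mono_right:
  assumes "index_finite K H" "sg H" "sg H'" "H \<subseteq> H'" "K \<subseteq> Aut"
  shows "index_finite K H'"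
proof -
  obtain f :: "_ \<Rightarrow> ('a list \<Rightarrow> 'a list) set" where
    "finite (f ` K)" "\<And>a b. a \<in> K \<Longrightarrow> b \<in> K \<Longrightarrow> f a = f b \<Longrightarrow> a \<circ> finv b \<in> H"
    by (rule index_finiteE[OF assms(1,2,5)]) blast
  then show ?thesis using assms by (intro index_finiteI[of _ _ f]) auto
qed

lemma index_finite_Int:
  assumes "index_finite K H" "sg H" "sg K" "sg C"
  shows "index_finite (K \<inter> C) (H \<inter> C)"
proof -
  obtain f :: "_ \<Rightarrow> ('a list \<Rightarrow> 'a list) set" where
    f: "finite (f ` K)" "\<And>a b. a \<in> K \<Longrightarrow> b \<in> K \<Longrightarrow> f a = f b \<Longrightarrow> a \<circ> finv b \<in> H"
    by (rule index_finiteE[OF assms(1,2) sgD(2)[OF assms(3)]]) blast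
  show ?thesis
  proof (rule index_finiteI[of _ _ f])
    show "finite (f ` (K \<inter> C))" using f(1) by (meson finite_subset image_mono inf_le1)
    fix a b assume "a \<in> K \<inter> C" "b \<in> K \<inter> C" "f a = f b"
    then show "a \<circ> finv b \<in> H \<inter> C" using f(2) sgD(4,5)[OF assms(4)] by blast
  qed (use sgD(2)[OF assms(3)] sg_Int[OF assms(2,4)] in auto)
qed

text \<open>The index of \<open>B\<close> in \<open>A\<close> is at most the product of the indices
  in the image and in the kernel of \<open>h\<close>. Since \<open>h\<close> need only be
  multiplicative on \<open>A\<close>, it can be the section at a vertex fixed by
  \<open>A\<close>.\<close>

lemma index_finite_extension:
  assumes A: "sg A" and B: "sg B" "B \<subseteq> A" and hB: "sg (h ` B)" and hA: "h ` A \<subseteq> Aut"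
    and hom: "\<And>a b. a \<in> A \<Longrightarrow> b \<in> A \<Longrightarrow> h (a \<circ> b) = h a \<circ> h b"
    and im: "index_finite (h ` A) (h ` B)"
    and ker: "index_finite {a \<in> A. h a = id} {b \<in> B. h b = id}"
  shows "index_finite A B"
proof -
  have h1: "h id = id"
    using hom[of id id] sgD(1)[OF A] hA
    by (metis Aut_finv_comp(2) comp_assoc comp_id id_comp image_subset_iff)
  have hinv: "h (finv a) = finv (h a)" if "a \<in> A" for a
    using finv_unique[of "h a" "h (finv a)"] hom[of a "finv a"] that hA h1 sgD[OF A] by auto
  have kA: "sg {a \<in> A. h a = id}" and kB: "sg {a \<in> B. h a = id}"
    using h1 hom hinv B(2) sgD[OF A] sgD[OF B(1)] by (auto intro!: sgI simp: subset_iff)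
  obtain R where R: "finite R" "R \<subseteq> A" "\<And>k. k \<in> A \<Longrightarrow> \<exists>r\<in>R. h k \<circ> finv (h r) \<in> h ` B"
  proof -
    obtain R where R: "finite R" "R \<subseteq> h ` A" "\<And>k. k \<in> h ` A \<Longrightarrow> \<exists>r\<in>R. k \<circ> finv r \<in> h ` B"
      by (rule index_finite_reps[OF im hB hA]) blast
    obtain R' where "R' \<subseteq> A" "finite R'" "R = h ` R'"
      using finite_subset_image[OF R(1,2)] by auto
    then show ?thesis using R that by auto
  qed
  obtain T where T: "finite T" "T \<subseteq> {a \<in> A. h a = id}"
    "\<And>k. k \<in> {a \<in> A. h a = id} \<Longrightarrow> \<exists>r\<in>T. k \<circ> finv r \<in> {b \<in> B. h b = id}"
    by (rule index_finite_reps[OF ker kB sgD(2)[OF kA]]) blast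
  have rep: "\<exists>r\<in>R. \<exists>t\<in>T. a \<circ> finv (t \<circ> r) \<in> B" if a: "a \<in> A" for a
  proof -
    obtain r b where r: "r \<in> R" "b \<in> B" "h a \<circ> finv (h r) = h b" using R(3)[OF a] by auto
    \<comment> \<open>Dividing \<open>a\<close> by the representative \<open>r\<close> of its image
      and by a preimage \<open>b\<close> in \<open>B\<close> leaves an element of the kernel, which
      a representative from \<open>T\<close> then reduces into \<open>B\<close>.\<close>
    let ?k = "finv b \<circ> (a \<circ> finv r)"
    have mem: "r \<in> A" "b \<in> A" using r R(2) B by auto
    then have mem: "r \<in> A" "b \<in> A" "finv b \<in> A" "finv r \<in> A" "a \<circ> finv r \<in> A" "?k \<in> A"
      using a by (auto intro!: sgD[OF A])
    have "h ?k = id" using mem a r hom hinv hA by (auto simp: image_subset_iff)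
    then obtain t where t: "t \<in> T" "?k \<circ> finv t \<in> B" using T(3) mem by blast
    have tA: "t \<in> A" using t T by auto
    have "b \<circ> (?k \<circ> finv t) \<in> B" using r t sgD[OF B(1)] by blast
    moreover have "b \<circ> (?k \<circ> finv t) = a \<circ> finv (t \<circ> r)"
      using mem tA a sgD(3)[OF A] by (simp add: finv_comp_distrib fun_eq_iff)
    ultimately show ?thesis using r t by auto
  qed
  have "\<forall>a\<in>A. \<exists>p. p \<in> R \<times> T \<and> a \<circ> finv (snd p \<circ> fst p) \<in> B" using rep by force
  from bchoice[OF this] obtain c where
    c: "\<And>a. a \<in> A \<Longrightarrow> c a \<in> R \<times> T \<and> a \<circ> finv (snd (c a) \<circ> fst (c a)) \<in> B" by blast
  show ?thesis
  proof (rule index_finiteI[of _ _ c])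
    show "finite (c ` A)" using c R(1) T(1) by (meson finite_SigmaI finite_subset image_subsetI)
    fix a b assume ab: "a \<in> A" "b \<in> A" "c a = c b"
    let ?x = "snd (c a) \<circ> fst (c a)"
    have x: "?x \<in> Aut" using c[OF ab(1)] R(2) T(2) sgD(2)[OF A] by (auto simp: mem_Times_iff subset_iff)
    have "(a \<circ> finv ?x) \<circ> finv (b \<circ> finv ?x) \<in> B" using c ab sgD[OF B(1)] by metis
    moreover have "(a \<circ> finv ?x) \<circ> finv (b \<circ> finv ?x) = a \<circ> finv b"
      using comp_finv_cancel x sgD(3)[OF A] ab by metis
    ultimately show "a \<circ> finv b \<in> B" by simp
  qed (use B(1) sgD(2)[OF A] in auto)
qed

lemma index_finite_trans:
  assumes "index_finite A B" "index_finite B C" "sg A" "sg B" "sg C" "C \<subseteq> B" "B \<subseteq> A"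
  shows "index_finite A C"
proof -
  obtain R where R: "finite R" "R \<subseteq> A" "\<And>k. k \<in> A \<Longrightarrow> \<exists>r\<in>R. k \<circ> finv r \<in> B"
    by (rule index_finite_reps[OF assms(1) assms(4) sgD(2)[OF assms(3)]]) blast
  obtain f :: "_ \<Rightarrow> ('a list \<Rightarrow> 'a list) set" where
    f: "finite (f ` B)" "\<And>a b. a \<in> B \<Longrightarrow> b \<in> B \<Longrightarrow> f a = f b \<Longrightarrow> a \<circ> finv b \<in> C"
    by (rule index_finiteE[OF assms(2,5) sgD(2)[OF assms(4)]]) blast
  have "\<forall>a\<in>A. \<exists>r. r \<in> R \<and> a \<circ> finv r \<in> B" using R(3) by blast
  from bchoice[OF this] obtain c where
    c: "\<And>a. a \<in> A \<Longrightarrow> c a \<in> R \<and> a \<circ> finv (c a) \<in> B" by blast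
  show ?thesis
  proof (rule index_finiteI[of _ _ "\<lambda>a. (c a, f (a \<circ> finv (c a)))"])
    have "(\<lambda>a. (c a, f (a \<circ> finv (c a)))) ` A \<subseteq> R \<times> f ` B" using c by auto
    then show "finite ((\<lambda>a. (c a, f (a \<circ> finv (c a)))) ` A)"
      using R(1) f(1) by (meson finite_SigmaI finite_subset)
    fix a b assume ab: "a \<in> A" "b \<in> A" "(c a, f (a \<circ> finv (c a))) = (c b, f (b \<circ> finv (c b)))"
    then have "(a \<circ> finv (c a)) \<circ> finv (b \<circ> finv (c a)) \<in> C" using f(2) c by (metis prod.inject)
    moreover have "(a \<circ> finv (c a)) \<circ> finv (b \<circ> finv (c a)) = a \<circ> finv b"
      using c[OF ab(1)] R(2) ab(1,2) by (intro comp_finv_cancel sgD(3)[OF assms(3)]) auto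
    ultimately show "a \<circ> finv b \<in> C" by simp
  qed (use assms(5) sgD(2)[OF assms(3)] in auto)
qed

lemma index_finite_image:
  assumes "index_finite A B" "sg A" "sg B" "sg (h ` B)" "B \<subseteq> A" and hA: "h ` A \<subseteq> Aut"
    and hom: "\<And>a b. a \<in> A \<Longrightarrow> b \<in> A \<Longrightarrow> h (a \<circ> b) = h a \<circ> h b"
  shows "index_finite (h ` A) (h ` B)"
proof -
  obtain f :: "_ \<Rightarrow> ('a list \<Rightarrow> 'a list) set" where
    f: "finite (f ` A)" "\<And>a b. a \<in> A \<Longrightarrow> b \<in> A \<Longrightarrow> f a = f b \<Longrightarrow> a \<circ> finv b \<in> B"
    by (rule index_finiteE[OF assms(1,3) sgD(2)[OF assms(2)]]) blast
  have "\<forall>x\<in>h ` A. \<exists>a. a \<in> A \<and> h a = x" by blast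
  from bchoice[OF this] obtain p where p: "\<And>x. x \<in> h ` A \<Longrightarrow> p x \<in> A \<and> h (p x) = x" by blast
  show ?thesis
  proof (rule index_finiteI[of _ _ "\<lambda>x. f (p x)"])
    show "finite ((\<lambda>x. f (p x)) ` (h ` A))" using p f(1) by (metis (no_types, lifting) finite_subset image_subset_iff image_eqI)
    fix x y assume xy: "x \<in> h ` A" "y \<in> h ` A" "f (p x) = f (p y)"
    let ?q = "p x \<circ> finv (p y)"
    have q: "?q \<in> B" using f(2) p xy by metis
    have "?q \<circ> p y = p x" using p xy sgD(3)[OF assms(2)] by (simp add: comp_assoc)
    then have "x = h ?q \<circ> y" using hom[of ?q "p y"] q assms(5) p xy by auto
    moreover have "y \<in> Aut" using xy hA by blast
    ultimately have "x \<circ> finv y = h ?q" by (metis Aut_finv_comp(2) comp_assoc comp_id)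
    then show "x \<circ> finv y \<in> h ` B" using q by simp
  qed (use assms in auto)
qed

lemma index_finite_infinite:
  assumes "index_finite A B" "sg A" "sg B" "infinite A" shows "infinite B"
proof
  assume B: "finite B"
  obtain R where R: "finite R" "R \<subseteq> A" "\<And>k. k \<in> A \<Longrightarrow> \<exists>r\<in>R. k \<circ> finv r \<in> B"
    by (rule index_finite_reps[OF assms(1,3) sgD(2)[OF assms(2)]]) blast
  have "A \<subseteq> (\<lambda>(b, r). b \<circ> r) ` (B \<times> R)"
  proof
    fix a assume a: "a \<in> A"
    then obtain r where r: "r \<in> R" "a \<circ> finv r \<in> B" using R(3) by blast
    moreover have "a = (a \<circ> finv r) \<circ> r" using r R(2) sgD(3)[OF assms(2)] by (auto simp: comp_assoc)
    ultimately show "a \<in> (\<lambda>(b, r). b \<circ> r) ` (B \<times> R)" by (metis (mono_tags, lifting) SigmaI case_prod_conv image_eqI)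
  qed
  then show False using B R(1) assms(4) by (meson finite_SigmaI finite_imageI finite_subset)
qed

text \<open>The cosets are right cosets, and \<open>a b^-1\<close> fixes \<open>y\<close> as soon as
  \<open>a^-1\<close> and \<open>b^-1\<close> agree at \<open>y\<close>. Hence inverses restricted
  to \<open>Y\<close> separate the cosets, and their values stay in finitely many finite
  levels.\<close>

lemma index_finite_st:
  assumes H: "sg H" and Y: "finite Y" shows "index_finite H (st H Y)"
proof (rule index_finiteI[of _ _ "\<lambda>g. restrict (finv g) Y"])
  have "(\<lambda>g. restrict (finv g) Y) ` H \<subseteq> PiE Y (\<lambda>y. level (length y))"
    using sgD(3)[OF H] by (auto simp: level_def)
  then show "finite ((\<lambda>g. restrict (finv g) Y) ` H)"
    using Y by (meson finite_PiE finite_level finite_subset)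
  fix a b assume ab: "a \<in> H" "b \<in> H" and eq: "restrict (finv a) Y = restrict (finv b) Y"
  have "a (finv b y) = y" if "y \<in> Y" for y
  proof -
    have "finv a y = finv b y" using eq that by (metis restrict_apply')
    then show ?thesis using sgD(3)[OF H ab(1)] by (metis Aut_finv_right)
  qed
  then show "a \<circ> finv b \<in> st H Y" using ab sgD[OF H] by (auto simp: st_def)
qed (use sg_st[OF H] sgD(2)[OF H] in auto)

section \<open>Grafted and rigidly supported automorphisms\<close>

lemma sg_psi:
  assumes H: "sg H" and fix_y: "\<And>g. g \<in> H \<Longrightarrow> g y = y"
  shows "sg (psi y H)"
proof (rule sgI)
  show "psi y H \<subseteq> Aut" using sgD(3)[OF H] by (auto simp: psi_def)
  show "id \<in> psi y H" unfolding psi_def using sgD(1)[OF H] by (intro image_eqI[of _ _ id]) auto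
next
  fix a b assume "a \<in> psi y H" "b \<in> psi y H"
  then obtain g h where gh: "g \<in> H" "h \<in> H" "a = sect g y" "b = sect h y" by (auto simp: psi_def)
  then have "a \<circ> b = sect (g \<circ> h) y" using sgD(3)[OF H] fix_y[of h] by (simp add: sect_comp)
  then show "a \<circ> b \<in> psi y H" unfolding psi_def using sgD(4)[OF H] gh by auto
next
  fix a assume "a \<in> psi y H"
  then obtain g where g: "g \<in> H" "a = sect g y" by (auto simp: psi_def)
  then have "finv a = sect (finv g) y" using sgD(3)[OF H] fix_y[of g] by (simp add: sect_finv_fixed)
  then show "finv a \<in> psi y H" unfolding psi_def using sgD(5)[OF H] g by auto
qed

lemma sect_hom_fixed:
  assumes "sg H" "\<And>g. g \<in> H \<Longrightarrow> g y = y" "a \<in> H" "b \<in> H"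
  shows "sect (a \<circ> b) y = sect a y \<circ> sect b y"
  using assms(2)[OF assms(4)] sgD(3)[OF assms(1)] assms(3,4) by (simp add: sect_comp)

lemma index_finite_psi:
  assumes "index_finite A B" "sg A" "sg B" "B \<subseteq> A" and fix_y: "\<And>g. g \<in> A \<Longrightarrow> g y = y"
  shows "index_finite (psi y A) (psi y B)"
  unfolding psi_def
proof (rule index_finite_image[OF assms(1-3) _ assms(4)])
  show "sg ((\<lambda>g. sect g y) ` B)" using sg_psi[OF assms(3)] assms(4) fix_y by (auto simp: psi_def)
  show "(\<lambda>g. sect g y) ` A \<subseteq> Aut" using sgD(3)[OF assms(2)] by auto
  show "sect (a \<circ> b) y = sect a y \<circ> sect b y" if "a \<in> A" "b \<in> A" for a b
    by (rule sect_hom_fixed[of A]) (use assms(2) fix_y that in auto)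
qed

section \<open>Copies of an automorphism below one vertex, and elements supported there\<close>

definition graft :: "'a::finite list \<Rightarrow> ('a list \<Rightarrow> 'a list) \<Rightarrow> 'a list \<Rightarrow> 'a list" where
  "graft u c w = (if prefix u w then u @ c (drop (length u) w) else w)"

text \<open>Membership in the rigid stabilizer of \<open>u\<close>; that an automorphism with this
  property fixes \<open>u\<close> is \<open>supported_fixes\<close>.\<close>

definition supported :: "('a::finite list \<Rightarrow> 'a list) \<Rightarrow> 'a list \<Rightarrow> bool" where
  "supported a u \<longleftrightarrow> (\<forall>w. \<not> prefix u w \<longrightarrow> a w = w)"

lemma graft_append [simp]: "graft u c (u @ w) = u @ c w"
  by (simp add: graft_def)

lemma supported_graft: "supported (graft u c) u"
  by (simp add: supported_def graft_def)

lemma graft_comp: "graft u (c \<circ> d) = graft u c \<circ> graft u d"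
  by (auto simp: graft_def fun_eq_iff)

lemma graft_id [simp]: "graft u id = id"
  by (auto simp: graft_def fun_eq_iff prefix_def)

lemma graft_Aut [simp]:
  fixes c :: "'a::finite list \<Rightarrow> 'a list"
  assumes "c \<in> Aut" shows "graft u c \<in> Aut"
proof -
  have inv: "graft u c (graft u (finv c) w) = w" "graft u (finv c) (graft u c w) = w"
    for w using assms graft_comp[of u c "finv c"] graft_comp[of u "finv c" c] by (simp_all add: fun_eq_iff)
  have mono: "prefix (graft u d x) (graft u d y)"
    if d: "d \<in> Aut" and xy: "prefix x y" for d x y
  proof (cases "prefix u x")
    case True
    then obtain a b where "x = u @ a" "y = u @ a @ b" using xy by (auto simp: prefix_def)
    then show ?thesis using d Aut_prefix[OF d, of a "a @ b"] by simp
  next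
    case F: False
    show ?thesis
    proof (cases "prefix u y")
      case True
      then have "prefix x u" using F xy prefix_same_cases by blast
      then have "prefix x (u @ z)" for z by (rule prefix_prefix)
      then show ?thesis using F True by (simp add: graft_def)
    qed (use F xy in \<open>simp add: graft_def\<close>)
  qed
  have "bij (graft u c)" by (rule o_bij[of "graft u (finv c)"]) (auto simp: fun_eq_iff inv)
  moreover have "prefix x y \<longleftrightarrow> prefix (graft u c x) (graft u c y)" for x y
    using mono[OF assms, of x y] mono[OF Aut_finv[OF assms], of "graft u c x" "graft u c y"] by (auto simp: inv)
  ultimately show ?thesis by (simp add: Aut_iff)
qed

lemma graft_finv: "c \<in> Aut \<Longrightarrow> finv (graft u c) = graft u (finv c)"
  by (rule finv_unique) (auto simp: graft_comp[symmetric])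

lemma sect_graft [simp]: "sect (graft u c) u = c"
  by (simp add: sect_def fun_eq_iff)

lemma graft_inj: "graft u c = graft u d \<Longrightarrow> c = d"
  by (metis sect_graft)

lemma prefix_same_length: "prefix u w \<Longrightarrow> prefix v w \<Longrightarrow> length u = length v \<Longrightarrow> u = v"
  by (metis prefix_length_prefix prefix_order.antisym order_refl)

text \<open>If \<open>a u\<close> differed from \<open>u\<close>, it would be another vertex of the
  same level, hence outside the subtree at \<open>u\<close> and fixed by \<open>a\<close>, against
  injectivity.\<close>

lemma supported_fixes:
  assumes "a \<in> Aut" "supported a u" shows "a u = u"
proof (rule ccontr)
  assume "a u \<noteq> u"
  moreover have "length (a u) = length u" using assms by simp
  ultimately have "\<not> prefix u (a u)" using prefix_same_length[of u "a u" "a u"] by auto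
  then have "a (a u) = a u" using assms(2) by (simp add: supported_def)
  then show False using \<open>a u \<noteq> u\<close> Aut_eq_iff[OF assms(1)] by simp
qed

lemma supported_comp: "supported a u \<Longrightarrow> supported b u \<Longrightarrow> supported (a \<circ> b) u"
  by (simp add: supported_def)

lemma supported_finv:
  assumes "a \<in> Aut" "supported a u" shows "supported (finv a) u"
  using assms unfolding supported_def by (metis Aut_finv_left)

lemma supported_conj:
  assumes "g \<in> Aut" "supported a u" shows "supported (g \<circ> a \<circ> finv g) (g u)"
  unfolding supported_def
proof (intro allI impI)
  fix w assume "\<not> prefix (g u) w"
  then have "\<not> prefix u (finv g w)" using Aut_prefix[OF assms(1), of u "finv g w"] assms(1) by simp
  then show "(g \<circ> a \<circ> finv g) w = w" using assms by (simp add: supported_def)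
qed

text \<open>The subtrees at two distinct vertices of one level are disjoint, and each of the two
  elements preserves both of them.\<close>

lemma supported_commute:
  assumes a: "a \<in> Aut" "supported a u" and b: "b \<in> Aut" "supported b v"
    and uv: "length u = length v" "u \<noteq> v"
  shows "a \<circ> b = b \<circ> a"
proof
  have keep: "prefix u (a w) \<longleftrightarrow> prefix u w" "prefix v (b w) \<longleftrightarrow> prefix v w" for w
    using supported_fixes[OF a] supported_fixes[OF b] Aut_prefix[OF a(1), of u w] Aut_prefix[OF b(1), of v w]
    by auto
  fix w
  show "(a \<circ> b) w = (b \<circ> a) w"
  proof (cases "prefix u w")
    case True
    then have "\<not> prefix v w" "\<not> prefix v (a w)" using uv keep prefix_same_length by metis+
    then show ?thesis using b by (simp add: supported_def)
  next
    case False
    then have "a w = w" "a (b w) = b w"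
      using a b keep uv prefix_same_length unfolding supported_def by metis+
    then show ?thesis by simp
  qed
qed

lemma supported_eq_id:
  assumes "a \<in> Aut" "supported a u" "sect a u = id" shows "a = id"
proof
  fix w show "a w = id w"
    using assms supported_fixes[OF assms(1,2)] Aut_append[OF assms(1), of u]
    by (cases "prefix u w") (auto simp: supported_def prefix_def)
qed

lemma supported_off:
  assumes "a \<in> Aut" "supported a u" "length v = length u" "v \<noteq> u"
  shows "a (v @ w) = v @ w"
  using assms prefix_same_length[of u "v @ w" v] by (auto simp: supported_def)

lemma supported_off_sect:
  assumes "a \<in> Aut" "supported a u" "length v = length u" "v \<noteq> u"
  shows "a v = v" "sect a v = id"
  using supported_off[OF assms] supported_off[OF assms, of "[]"] by (auto simp: sect_def)

text \<open>For \<open>n\<close> in \<open>N\<close> moving \<open>u\<close>, the conjugate \<open>n a n\<inverse>\<close> lives below \<open>n u\<close> and so commutes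
  with \<open>a\<close> and \<open>b\<close>; hence the double commutator \<open>[[n, a\<inverse>], b]\<close>, which lies in \<open>N\<close>, equals \<open>[a, b]\<close>.\<close>

lemma commutator_in_normalized:
  assumes N: "sg N" and n: "n \<in> N" "n u \<noteq> u"
    and a: "a \<in> Aut" "supported a u" and b: "b \<in> Aut" "supported b u"
    and na: "\<And>m. m \<in> N \<Longrightarrow> finv a \<circ> m \<circ> a \<in> N" and nb: "\<And>m. m \<in> N \<Longrightarrow> b \<circ> m \<circ> finv b \<in> N"
  shows "a \<circ> b \<circ> finv a \<circ> finv b \<in> N"
proof -
  have nA: "n \<in> Aut" using sgD(3)[OF N n(1)] .
  define x where "x = n \<circ> finv a \<circ> finv n"
  have x: "x \<in> Aut" "supported x (n u)"
    unfolding x_def using nA a supported_conj[OF nA supported_finv[OF a]] by auto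
  define c where "c = a \<circ> b \<circ> finv a"
  have c: "c \<in> Aut" "supported c u"
    unfolding c_def using a b by (auto intro!: supported_comp supported_finv)
  have xc: "x \<circ> c = c \<circ> x" by (rule supported_commute[OF x c]) (use nA n in auto)
  define y where "y = x \<circ> a"
  have yA: "y \<in> Aut" using x a by (simp add: y_def)
  have "y = n \<circ> (finv a \<circ> finv n \<circ> a)" by (simp add: y_def x_def comp_assoc)
  then have y: "y \<in> N" using n na[OF sgD(5)[OF N n(1)]] sgD(4)[OF N] by auto
  then have "y \<circ> (b \<circ> finv y \<circ> finv b) \<in> N" using nb[OF sgD(5)[OF N y]] sgD(4)[OF N] by auto
  moreover have "y \<circ> (b \<circ> finv y \<circ> finv b) = (x \<circ> c \<circ> finv x) \<circ> finv b"
    using x a by (simp add: y_def c_def finv_comp_distrib comp_assoc)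
  moreover have "x \<circ> c \<circ> finv x = c" using xc x by (simp add: comp_assoc)
  ultimately show ?thesis by (simp add: c_def)
qed

section \<open>Finitely generated subgroups\<close>

lemma sg_generate: "S \<subseteq> Aut \<Longrightarrow> sg (generate AutX S)"
  by (rule group.generate_is_subgroup[OF group_AutX])

lemma generate_least: "sg H \<Longrightarrow> S \<subseteq> H \<Longrightarrow> generate AutX S \<subseteq> H"
  by (rule group.generate_subgroup_incl[OF group_AutX])

lemma generate_superset: "S \<subseteq> generate AutX S"
  by (auto intro: generate.incl)

lemma fin_gen_sg: "fin_gen H \<Longrightarrow> sg H"
  by (auto simp: fin_gen_def sg_generate)

lemma fin_gen_overgroup:
  assumes M: "fin_gen M" and L: "sg L" "M \<subseteq> L" and idx: "index_finite L M"
  shows "fin_gen L"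
proof -
  obtain S where S: "finite S" "S \<subseteq> Aut" "M = generate AutX S" using M by (auto simp: fin_gen_def)
  obtain R where R: "finite R" "R \<subseteq> L" "\<And>k. k \<in> L \<Longrightarrow> \<exists>r\<in>R. k \<circ> finv r \<in> M"
    by (rule index_finite_reps[OF idx fin_gen_sg[OF M] sgD(2)[OF L(1)]]) blast
  let ?S = "S \<union> R"
  have SR: "?S \<subseteq> L" using S R L generate_superset[of S] by auto
  then have SA: "?S \<subseteq> Aut" using sgD(2)[OF L(1)] by blast
  note gen = sg_generate[OF SA]
  have "L \<subseteq> generate AutX ?S"
  proof
    fix k assume k: "k \<in> L"
    then obtain r where r: "r \<in> R" "k \<circ> finv r \<in> M" using R(3) by blast
    have "M \<subseteq> generate AutX ?S" unfolding S(3)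
      by (rule generate_least[OF gen]) (use generate_superset[of ?S] in auto)
    then have "(k \<circ> finv r) \<circ> r \<in> generate AutX ?S"
      using r sgD(4)[OF gen] generate_superset[of ?S] by blast
    moreover have "(k \<circ> finv r) \<circ> r = k" using r SA by (auto simp: comp_assoc)
    ultimately show "k \<in> generate AutX ?S" by simp
  qed
  then have "L = generate AutX ?S" using generate_least[OF L(1) SR] by auto
  then show ?thesis using S(1) R(1) SA by (auto simp: fin_gen_def)
qed

text \<open>Schreier's lemma: \<open>H\<close> is generated by its finitely many elements
  \<open>r s r'^-1\<close>, where \<open>r\<close> and \<open>r'\<close> are coset representatives
  and \<open>s\<close> is a generator of \<open>G\<close>, an inverse of one, or the
  identity.\<close>

lemma fin_gen_finite_index:
  assumes G: "fin_gen G" and H: "sg H" "H \<subseteq> G" and idx: "index_finite G H"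
  shows "fin_gen H"
proof -
  note sG = fin_gen_sg[OF G]
  obtain S where S: "finite S" "S \<subseteq> Aut" "G = generate AutX S" using G by (auto simp: fin_gen_def)
  obtain R0 where R0: "finite R0" "R0 \<subseteq> G" "\<And>k. k \<in> G \<Longrightarrow> \<exists>r\<in>R0. k \<circ> finv r \<in> H"
    by (rule index_finite_reps[OF idx H(1) sgD(2)[OF sG]]) blast
  define R where "R = insert id R0"
  have R: "finite R" "R \<subseteq> G" "id \<in> R" using R0 sgD(1)[OF sG] by (auto simp: R_def)
  \<comment> \<open>The identity among the middle factors, together with \<open>id\<close> in
    \<open>R\<close>, puts into \<open>T\<close> those representatives that themselves lie in
    \<open>H\<close>.\<close>
  define T where "T = H \<inter> (\<lambda>(r, s, r'). r \<circ> s \<circ> finv r') ` (R \<times> (S \<union> finv ` S \<union> {id}) \<times> R)"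
  have "finite T" using R S by (auto simp: T_def)
  have TA: "T \<subseteq> Aut" using sgD(2)[OF H(1)] by (auto simp: T_def)
  define W where "W = generate AutX T"
  have W: "sg W" "W \<subseteq> H" "T \<subseteq> W"
    using sg_generate[OF TA] generate_least[OF H(1)] generate_superset[of T] by (auto simp: W_def T_def)
  \<comment> \<open>The product set \<open>Q = W R\<close> contains the identity and is stable under
    right multiplication by generators and their inverses, so it exhausts \<open>G\<close>.\<close>
  define Q where "Q = {w \<circ> r |w r. w \<in> W \<and> r \<in> R}"
  have step: "q \<circ> s \<in> Q" if q: "q \<in> Q" and s: "s \<in> S \<union> finv ` S" and sG': "s \<in> G" for q s
  proof -
    obtain w r where wr: "w \<in> W" "r \<in> R" "q = w \<circ> r" using q by (auto simp: Q_def)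
    have rs: "r \<circ> s \<in> G" using wr R sG' sgD(4)[OF sG] by auto
    then obtain r' where r': "r' \<in> R" "r \<circ> s \<circ> finv r' \<in> H" using R0(3) by (auto simp: R_def)
    have "r \<circ> s \<circ> finv r' \<in> T" unfolding T_def using r' wr s by force
    then have "w \<circ> (r \<circ> s \<circ> finv r') \<in> W" using W wr sgD(4)[OF W(1)] by auto
    moreover have "q \<circ> s = (w \<circ> (r \<circ> s \<circ> finv r')) \<circ> r'"
      using wr r' R sgD(3)[OF sG] by (auto simp: comp_assoc)
    ultimately show ?thesis using r' unfolding Q_def by blast
  qed
  have closed: "\<forall>q\<in>Q. q \<circ> g \<in> Q" if "g \<in> generate AutX S" for g
    using that
  proof induction
    case (incl s)
    then have "s \<in> G" using S(3) generate.incl[of s S AutX] by simp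
    then show ?case using step incl by (metis UnI1)
  next
    case (inv s)
    then have "finv s \<in> G" "m_inv AutX s = finv s"
      using S generate.incl[of s S AutX] sgD(5)[OF sG] AutX_m_inv[of s] by auto
    then show ?case using step[of _ "finv s"] inv by (metis UnI2 imageI)
  next
    case (eng h1 h2)
    then show ?case by (metis AutX_mult comp_assoc)
  qed (metis AutX_one comp_id)
  have "H \<subseteq> W"
  proof
    fix h assume h: "h \<in> H"
    have "id \<circ> id \<in> Q" unfolding Q_def using sgD(1)[OF W(1)] R(3) by blast
    moreover have "h \<in> generate AutX S" using h H S(3) by blast
    ultimately have "(id \<circ> id) \<circ> h \<in> Q" using closed by blast
    then have "h \<in> Q" by simp
    then obtain w r where wr: "w \<in> W" "r \<in> R" "h = w \<circ> r" by (auto simp: Q_def)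
    have "r = finv w \<circ> h" using wr sgD(3)[OF W(1)] by (auto simp: comp_assoc[symmetric])
    moreover have "finv w \<in> H" using wr(1) W(2) sgD(5)[OF H(1)] by blast
    ultimately have "r \<in> H" using sgD(4)[OF H(1) _ h] by metis
    then have "r \<in> T" unfolding T_def using wr R by (auto intro!: image_eqI[of _ _ "(r, id, id)"])
    then show "h \<in> W" using wr W sgD(4)[OF W(1)] by auto
  qed
  then have "H = generate AutX T" using W by (auto simp: W_def)
  then show ?thesis using \<open>finite T\<close> TA by (auto simp: fin_gen_def)
qed

lemma psi_mono: "A \<subseteq> B \<Longrightarrow> psi y A \<subseteq> psi y B"
  by (auto simp: psi_def)

text \<open>Generators of the finitely many projections are lifted simultaneously. Equal projections
  do not yet make \<open>M0\<close> of finite index in \<open>M\<close>, as a diagonal subgroup of a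
  product shows.\<close>

lemma fin_gen_lift:
  assumes M: "sg M" and fix_Y: "\<And>g y. g \<in> M \<Longrightarrow> y \<in> Y \<Longrightarrow> g y = y" and Y: "finite Y"
    and fg: "\<And>y. y \<in> Y \<Longrightarrow> fin_gen (psi y M)"
  obtains M0 where "fin_gen M0" "M0 \<subseteq> M" "\<And>y. y \<in> Y \<Longrightarrow> psi y M0 = psi y M"
proof -
  have "\<exists>S. finite S \<and> S \<subseteq> M \<and> psi y M = generate AutX (psi y S)" if y: "y \<in> Y" for y
  proof -
    obtain T where T: "finite T" "psi y M = generate AutX T" using fg[OF y] by (auto simp: fin_gen_def)
    have "T \<subseteq> (\<lambda>g. sect g y) ` M" using T generate_superset[of T] by (auto simp: psi_def)
    then obtain S where "S \<subseteq> M" "finite S" "T = (\<lambda>g. sect g y) ` S"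
      using finite_subset_image[OF T(1)] by blast
    then show ?thesis using T by (auto simp: psi_def)
  qed
  then obtain S where S: "\<And>y. y \<in> Y \<Longrightarrow> finite (S y) \<and> S y \<subseteq> M \<and> psi y M = generate AutX (psi y (S y))"
    by metis
  let ?S = "\<Union>y\<in>Y. S y"
  have SM: "?S \<subseteq> M" using S by auto
  then have SA: "?S \<subseteq> Aut" using sgD(2)[OF M] by blast
  let ?M0 = "generate AutX ?S"
  have M0: "sg ?M0" "?M0 \<subseteq> M" using sg_generate[OF SA] generate_least[OF M SM] by auto
  show ?thesis
  proof (rule that)
    show "fin_gen ?M0" unfolding fin_gen_def using S Y SA by blast
    fix y assume y: "y \<in> Y"
    have "psi y M \<subseteq> psi y ?M0"
    proof -
      have "sg (psi y ?M0)" using sg_psi[OF M0(1)] M0(2) fix_Y y by blast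
      moreover have "psi y (S y) \<subseteq> psi y ?M0" using generate_superset[of ?S] y by (intro psi_mono) auto
      ultimately show ?thesis using S[OF y] generate_least by metis
    qed
    then show "psi y ?M0 = psi y M" using psi_mono[OF M0(2)] by blast
  qed (rule M0(2))
qed

section \<open>Subgroups normalized by a finite index subgroup\<close>

definition normalized :: "('a::finite list \<Rightarrow> 'a list) set \<Rightarrow> ('a list \<Rightarrow> 'a list) set \<Rightarrow> bool" where
  "normalized F N \<longleftrightarrow> (\<forall>f\<in>F. \<forall>n\<in>N. f \<circ> n \<circ> finv f \<in> N)"

definition moved :: "('a::finite list \<Rightarrow> 'a list) set \<Rightarrow> nat \<Rightarrow> 'a list set" where
  "moved N m = {u \<in> level m. \<exists>n\<in>N. n u \<noteq> u}"

definition triv :: "('a::finite list \<Rightarrow> 'a list) set \<Rightarrow> 'a list \<Rightarrow> bool" where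
  "triv N v \<longleftrightarrow> (\<forall>n\<in>N. \<forall>w. n (v @ w) = v @ w)"

definition orb :: "('a::finite list \<Rightarrow> 'a list) set \<Rightarrow> 'a list \<Rightarrow> 'a list set" where
  "orb F u = (\<lambda>f. f u) ` F"

definition moved_orbits :: "('a::finite list \<Rightarrow> 'a list) set \<Rightarrow> ('a list \<Rightarrow> 'a list) set \<Rightarrow> nat \<Rightarrow> nat" where
  "moved_orbits F N m = card (orb F ` moved N m)"

text \<open>The maximum runs over infinitely many levels and is meaningful once the counts are
  bounded, which \<open>orbits_bounded\<close> provides for \<open>F\<close> of finite index in
  \<open>G\<close>.\<close>

definition max_moved_orbits :: "('a::finite list \<Rightarrow> 'a list) set \<Rightarrow> ('a list \<Rightarrow> 'a list) set \<Rightarrow> nat" where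
  "max_moved_orbits F N = Max (range (moved_orbits F N))"

lemma finite_moved [simp]: "finite (moved N m)"
  by (rule finite_subset[OF _ finite_level[of m]]) (auto simp: moved_def)

lemma moved_invariant:
  assumes F: "sg F" and N: "normalized F N" and u: "u \<in> moved N m" and f: "f \<in> F"
  shows "f u \<in> moved N m"
proof -
  obtain n where n: "n \<in> N" "n u \<noteq> u" "length u = m" using u by (auto simp: moved_def level_def)
  have fA: "f \<in> Aut" using sgD(3)[OF F f] .
  have "f \<circ> n \<circ> finv f \<in> N" using N n f by (auto simp: normalized_def)
  moreover have "(f \<circ> n \<circ> finv f) (f u) \<noteq> f u" using fA n by (simp add: Aut_eq_iff)
  ultimately have "\<exists>k\<in>N. k (f u) \<noteq> f u" by metis
  then show ?thesis using n fA by (simp add: moved_def level_def)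
qed

lemma Aut_take: "f \<in> Aut \<Longrightarrow> take m (f x) = f (take m x)"
  using Aut_append[of f "take m x" "drop m x"] by (cases "m \<le> length x") simp_all

lemma Aut_fixes_prefix:
  assumes "g \<in> Aut" "g (x @ z) = x @ z" shows "g x = x"
proof -
  have "g x @ sect g x z = x @ z" using assms by (simp add: Aut_append)
  then show ?thesis using assms(1) by (simp add: append_eq_append_conv)
qed

lemma moved_append:
  assumes "sg N" "u \<in> moved N m" shows "u @ w \<in> moved N (m + length w)"
proof -
  obtain n where n: "n \<in> N" "n u \<noteq> u" "length u = m" using assms by (auto simp: moved_def level_def)
  have nA: "n \<in> Aut" using sgD(3)[OF assms(1) n(1)] .
  have "n (u @ w) \<noteq> u @ w" using n Aut_fixes_prefix[OF nA] by blast
  then show ?thesis using n by (auto simp: moved_def level_def)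
qed

text \<open>A level with the maximal number of \<open>F\<close>-orbits of moved vertices consists of moved vertices and
  of vertices below which nothing moves: otherwise a deeper level would have one more orbit.\<close>

lemma maximal_level_split:
  assumes F: "sg F" and N: "sg N" "normalized F N"
    and max: "\<And>m'. moved_orbits F N m' \<le> moved_orbits F N m" and u: "u \<in> level m"
  shows "u \<in> moved N m \<or> triv N u"
proof (rule ccontr)
  assume neg: "\<not> (u \<in> moved N m \<or> triv N u)"
  then obtain n w where nw: "n \<in> N" "n (u @ w) \<noteq> u @ w" by (auto simp: triv_def)
  have len: "length u = m" using u by (simp add: level_def)
  define m' where "m' = m + length w"
  have uw: "u @ w \<in> moved N m'" using nw len by (auto simp: moved_def level_def m'_def)
  have take_orb: "take m ` orb F x = orb F (take m x)" for x
    unfolding orb_def image_image using Aut_take[OF sgD(3)[OF F]] by (rule image_cong[OF refl])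
  \<comment> \<open>Truncating to level \<open>m\<close> the orbits moved at level \<open>m'\<close>
    yields every orbit moved at level \<open>m\<close> and in addition the orbit of
    \<open>u\<close>, so the deeper level has strictly more of them.\<close>
  let ?S = "(\<lambda>O'. take m ` O') ` (orb F ` moved N m')"
  have "orb F v \<in> ?S" if "v \<in> moved N m" for v
  proof -
    have "v @ w \<in> moved N m'" using moved_append[OF N(1) that] by (simp add: m'_def)
    moreover have "take m (v @ w) = v" using that by (auto simp: moved_def level_def)
    ultimately show ?thesis using take_orb[of "v @ w"] by (metis imageI)
  qed
  moreover have "orb F u \<in> ?S" using uw take_orb[of "u @ w"] len by (metis append_eq_conv_conj imageI)
  ultimately have sub: "insert (orb F u) (orb F ` moved N m) \<subseteq> ?S" by blast
  have "orb F u \<notin> orb F ` moved N m"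
  proof
    assume "orb F u \<in> orb F ` moved N m"
    then obtain v where v: "v \<in> moved N m" "orb F u = orb F v" by auto
    have "id u \<in> orb F u" unfolding orb_def using sgD(1)[OF F] by (rule imageI)
    then have "\<exists>f\<in>F. u = f v" unfolding v(2) by (auto simp: orb_def)
    then show False using moved_invariant[OF F N(2) v(1)] neg by auto
  qed
  then have "Suc (moved_orbits F N m) = card (insert (orb F u) (orb F ` moved N m))"
    by (simp add: moved_orbits_def)
  also have "\<dots> \<le> card ?S" using sub by (intro card_mono) auto
  also have "\<dots> \<le> moved_orbits F N m'" unfolding moved_orbits_def by (intro card_image_le) auto
  finally show False using max[of m'] by simp
qed

lemma graft_commutator:
  "a \<in> Aut \<Longrightarrow> b \<in> Aut \<Longrightarrow>
    graft u a \<circ> graft u b \<circ> finv (graft u a) \<circ> finv (graft u b) = graft u (a \<circ> b \<circ> finv a \<circ> finv b)"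
  by (simp add: graft_comp graft_finv)

text \<open>An element fixing level \<open>m\<close> is the product of the grafts of its sections.
  The induction on \<open>U\<close> cancels one graft at a time until all sections are
  trivial.\<close>

lemma graft_glue:
  assumes N: "sg N" and U: "finite U" "U \<subseteq> level m" and D: "sg D"
    and graft: "\<And>u d. u \<in> U \<Longrightarrow> d \<in> D \<Longrightarrow> graft u d \<in> N"
    and c: "c \<in> Aut" "\<And>u. u \<in> level m \<Longrightarrow> c u = u"
      "\<And>u. u \<in> U \<Longrightarrow> sect c u \<in> D" "\<And>u. u \<in> level m - U \<Longrightarrow> sect c u = id"
  shows "c \<in> N"
  using U graft c
proof (induction U arbitrary: c rule: finite_induct)
  case empty
  have "c = id" by (rule Aut_eqI_spanning[OF spanning_level[of m]]) (use empty in auto)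
  then show ?case using sgD(1)[OF N] by metis
next
  case (insert u U)
  let ?s = "sect c u"
  let ?g = "graft u (finv ?s)"
  have s: "?s \<in> D" "?s \<in> Aut" using insert.prems(5) sgD(3)[OF D] by auto
  have lu: "length u = m" "u \<in> level m" using insert.prems(1) by (auto simp: level_def)
  have gA: "?g \<in> Aut" "supported ?g u" using s supported_graft by auto
  have g_off: "?g v = v" "sect ?g v = id" if "v \<in> level m" "v \<noteq> u" for v
    using supported_off_sect[OF gA, of v] that lu by (auto simp: level_def)
  have g_on: "?g u = u" using supported_fixes[OF gA] .
  have "c \<circ> ?g \<in> N"
  proof (rule insert.IH)
    show "c \<circ> ?g \<in> Aut" using insert.prems(3) gA by simp
    fix v
    show "(c \<circ> ?g) v = v" if "v \<in> level m"
      using that g_off(1)[of v] g_on insert.prems(4)[of v] by (cases "v = u") auto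
    have sec: "sect (c \<circ> ?g) v = sect c (?g v) \<circ> sect ?g v"
      by (rule sect_comp) (use insert.prems(3) gA in auto)
    show "sect (c \<circ> ?g) v \<in> D" if "v \<in> U"
    proof -
      have "v \<in> level m" "v \<noteq> u" using that insert.hyps insert.prems(1) by auto
      then show ?thesis using that sec g_off[of v] insert.prems(5)[of v] by simp
    qed
    show "sect (c \<circ> ?g) v = id" if "v \<in> level m - U"
      using that sec g_off[of v] g_on s insert.prems(6) by (cases "v = u") auto
  qed (use insert.prems in auto)
  then have "(c \<circ> ?g) \<circ> graft u ?s \<in> N" using insert.prems(2)[of u ?s] s sgD(4)[OF N] by auto
  moreover have "?g \<circ> graft u ?s = id" using s by (simp add: graft_comp[symmetric])
  ultimately show ?case by (metis comp_assoc comp_id)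
qed

text \<open>\<open>K\<close> is the branching subgroup. Its closure under rigid copies is phrased
  with grafts, and just infiniteness with subgroups normalized by \<open>G\<close>, to match the
  commutator computations below.\<close>

locale branch_group =
  fixes G K :: "('a::finite list \<Rightarrow> 'a list) set"
  assumes sgG: "sg G"
    and G_sect: "g \<in> G \<Longrightarrow> sect g u \<in> G"
    and G_trans: "level_transitive G"
    and G_infinite: "infinite G"
    and just_inf: "sg N \<Longrightarrow> N \<subseteq> G \<Longrightarrow> normalized G N \<Longrightarrow> N \<noteq> {id} \<Longrightarrow> index_finite G N"
    and sgK: "sg K" and K_sub: "K \<subseteq> G" and K_normal: "normalized G K"
    and K_index: "index_finite G K"
    and K_graft: "k \<in> K \<Longrightarrow> graft u k \<in> K"
    and K_rigid: "rigid K (level n) \<subseteq> G"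
begin

lemmas G_Aut = sgD(2)[OF sgG]

lemma K_infinite: "infinite K"
  using index_finite_infinite[OF K_index sgG sgK G_infinite] .

text \<open>The grafts at \<open>u\<close> of the infinite group \<open>K\<close> meet only finitely
  many cosets of \<open>F\<close>; two distinct ones in the same coset have a nontrivial quotient in
  \<open>F\<close>.\<close>

lemma finite_index_supported:
  assumes F: "sg F" "index_finite G F"
  obtains a where "a \<in> F" "a \<noteq> id" "supported a u"
proof -
  obtain f :: "_ \<Rightarrow> ('a list \<Rightarrow> 'a list) set" where
    f: "finite (f ` G)" "\<And>a b. a \<in> G \<Longrightarrow> b \<in> G \<Longrightarrow> f a = f b \<Longrightarrow> a \<circ> finv b \<in> F"
    by (rule index_finiteE[OF F(2,1) G_Aut]) blast
  have gr: "graft u k \<in> G" if "k \<in> K" for k using K_graft[OF that] K_sub by auto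
  have "finite ((\<lambda>k. f (graft u k)) ` K)"
    by (rule finite_subset[OF _ f(1)]) (use gr in auto)
  then have "\<not> inj_on (\<lambda>k. f (graft u k)) K" using K_infinite finite_imageD by blast
  then obtain k l where kl: "k \<in> K" "l \<in> K" "k \<noteq> l" "f (graft u k) = f (graft u l)"
    by (auto simp: inj_on_def)
  have A: "k \<in> Aut" "l \<in> Aut" using kl sgD(3)[OF sgK] by auto
  have eq: "graft u k \<circ> finv (graft u l) = graft u (k \<circ> finv l)" using A by (simp add: graft_comp graft_finv)
  have "graft u (k \<circ> finv l) \<in> F" using f(2)[OF gr gr kl(4)] kl eq by simp
  moreover have "graft u (k \<circ> finv l) \<noteq> id"
  proof
    assume "graft u (k \<circ> finv l) = id"
    then have "graft u (k \<circ> finv l) = graft u id" by simp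
    then have "k \<circ> finv l = id" by (rule graft_inj)
    then have "(k \<circ> finv l) \<circ> l = l" by simp
    then show False using kl A by (simp add: comp_assoc)
  qed
  ultimately show ?thesis using that supported_graft by blast
qed

text \<open>The largest subgroup of \<open>G\<close> whose support does not exceed that of
  \<open>N\<close>.\<close>

definition Rist :: "('a list \<Rightarrow> 'a list) set \<Rightarrow> ('a list \<Rightarrow> 'a list) set" where
  "Rist N = {g \<in> G. \<forall>v w. triv N v \<longrightarrow> g (v @ w) = v @ w}"

text \<open>Suppose \<open>c\<close> moves some \<open>x\<close> in a subtree on which
  \<open>N\<close> is trivial, and take a nontrivial \<open>a\<close> in \<open>F\<close> supported
  below \<open>x\<close>. The conjugate of \<open>a\<close> by \<open>c\<close> lives below
  \<open>c x\<close>, so the commutator of \<open>c\<close> and \<open>a\<close> acts below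
  \<open>x\<close> as the inverse of \<open>a\<close>. It lies in \<open>N\<close>, so it is trivial
  there, a contradiction.\<close>

lemma commuting_mod_in_Rist:
  assumes F: "sg F" "index_finite G F" and c: "c \<in> G"
    and comm: "\<And>f. f \<in> F \<Longrightarrow> c \<circ> f \<circ> finv c \<circ> finv f \<in> N"
  shows "c \<in> Rist N"
proof (rule ccontr)
  assume "c \<notin> Rist N"
  then obtain v w where vw: "triv N v" "c (v @ w) \<noteq> v @ w" using c by (auto simp: Rist_def)
  define x where "x = v @ w"
  have cA: "c \<in> Aut" using c G_Aut by auto
  obtain a where a: "a \<in> F" "a \<noteq> id" "supported a x" using finite_index_supported[OF F] by blast
  have aA: "a \<in> Aut" using sgD(3)[OF F(1) a(1)] .
  have ca: "supported (c \<circ> a \<circ> finv c) (c x)" using supported_conj[OF cA a(3)] .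
  have "a (x @ z) = x @ z" for z
  proof -
    have "(c \<circ> a \<circ> finv c \<circ> finv a) (x @ z) = x @ z"
      using comm[OF a(1)] vw(1) by (auto simp: triv_def x_def)
    moreover have "finv a (x @ z) = x @ sect (finv a) x z"
      using Aut_append[of "finv a" x z] supported_fixes[of "finv a" x] aA supported_finv[OF aA a(3)] by simp
    moreover have "(c \<circ> a \<circ> finv c) (x @ t) = x @ t" for t
      by (rule supported_off[OF _ ca]) (use cA aA vw in \<open>auto simp: x_def\<close>)
    ultimately have "finv a (x @ z) = x @ z" by simp
    then show ?thesis using aA by (metis Aut_finv_right)
  qed
  then have "sect a x = id" by (simp add: sect_def fun_eq_iff)
  then show False using supported_eq_id[OF aA a(3)] a(2) by simp
qed

text \<open>\<open>C0\<close> is the normal core, the part of \<open>G\<close> that all conjugations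
  by \<open>G\<close> send into \<open>C\<close>.\<close>

lemma finite_index_core:
  assumes C: "sg C" "C \<subseteq> G" "index_finite G C"
  obtains C0 where "sg C0" "C0 \<subseteq> C" "index_finite G C0" "normalized G C0"
proof -
  define C0 where "C0 = {x \<in> G. \<forall>g\<in>G. g \<circ> x \<circ> finv g \<in> C}"
  have conj: "g \<circ> (x \<circ> y) \<circ> finv g = (g \<circ> x \<circ> finv g) \<circ> (g \<circ> y \<circ> finv g)" if "g \<in> G" for g x y
    using that G_Aut by (auto simp: fun_eq_iff)
  have conj_inv: "g \<circ> finv x \<circ> finv g = finv (g \<circ> x \<circ> finv g)" if "g \<in> G" "x \<in> G" for g x
    using that G_Aut by (auto simp: finv_comp_distrib comp_assoc subset_iff)
  have sC0: "sg C0"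
  proof (rule sgI)
    show "id \<in> C0" using sgD(1)[OF sgG] sgD(1)[OF C(1)] G_Aut by (auto simp: C0_def subset_iff)
    show "a \<circ> b \<in> C0" if "a \<in> C0" "b \<in> C0" for a b
      using that sgD(4)[OF sgG] sgD(4)[OF C(1)] by (auto simp: C0_def conj)
    show "finv a \<in> C0" if "a \<in> C0" for a
      using that sgD(5)[OF sgG] sgD(5)[OF C(1)] by (auto simp: C0_def conj_inv)
  qed (use G_Aut in \<open>auto simp: C0_def\<close>)
  have C0C: "C0 \<subseteq> C"
  proof
    fix x assume "x \<in> C0"
    then have "id \<circ> x \<circ> finv id \<in> C" using sgD(1)[OF sgG] unfolding C0_def by blast
    then show "x \<in> C" by simp
  qed
  have norm: "normalized G C0" unfolding normalized_def
  proof (intro ballI)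
    fix g x assume gx: "g \<in> G" "x \<in> C0"
    have "h \<circ> (g \<circ> x \<circ> finv g) \<circ> finv h \<in> C" if h: "h \<in> G" for h
    proof -
      have "h \<circ> g \<in> G" using gx h sgD(4)[OF sgG] by auto
      then have "(h \<circ> g) \<circ> x \<circ> finv (h \<circ> g) \<in> C" using gx unfolding C0_def by blast
      then show ?thesis using h gx G_Aut by (simp add: finv_comp_distrib comp_assoc subset_iff)
    qed
    moreover have "g \<circ> x \<circ> finv g \<in> G" using gx sgD(4,5)[OF sgG] by (auto simp: C0_def)
    ultimately show "g \<circ> x \<circ> finv g \<in> C0" by (auto simp: C0_def)
  qed
  obtain R where R: "finite R" "R \<subseteq> G" "\<And>k. k \<in> G \<Longrightarrow> \<exists>r\<in>R. k \<circ> finv r \<in> C"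
    by (rule index_finite_reps[OF C(3,1) G_Aut]) blast
  obtain f :: "_ \<Rightarrow> ('a list \<Rightarrow> 'a list) set" where
    f: "finite (f ` G)" "\<And>a b. a \<in> G \<Longrightarrow> b \<in> G \<Longrightarrow> f a = f b \<Longrightarrow> a \<circ> finv b \<in> C"
    by (rule index_finiteE[OF C(3,1) G_Aut]) blast
  \<comment> \<open>Conjugations by \<open>g\<close> and by its representative \<open>r\<close>
    differ by a conjugation inside \<open>C\<close>, so only the finitely many \<open>r\<close> in
    \<open>R\<close> have to be tested.\<close>
  have "index_finite G C0"
  proof (rule index_finiteI[OF sC0 G_Aut, of "\<lambda>x. restrict (\<lambda>r. f (r \<circ> x)) R"])
    have "(\<lambda>x. restrict (\<lambda>r. f (r \<circ> x)) R) ` G \<subseteq> PiE R (\<lambda>_. f ` G)"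
      using R(2) sgD(4)[OF sgG] by auto
    then show "finite ((\<lambda>x. restrict (\<lambda>r. f (r \<circ> x)) R) ` G)"
      using R(1) f(1) by (meson finite_PiE finite_subset)
    fix x y assume xy: "x \<in> G" "y \<in> G" "restrict (\<lambda>r. f (r \<circ> x)) R = restrict (\<lambda>r. f (r \<circ> y)) R"
    have z: "x \<circ> finv y \<in> G" using xy sgD(4,5)[OF sgG] by auto
    have "g \<circ> (x \<circ> finv y) \<circ> finv g \<in> C" if g: "g \<in> G" for g
    proof -
      obtain r where r: "r \<in> R" "g \<circ> finv r \<in> C" using R(3)[OF g] by blast
      have rG: "r \<in> G" using r R by auto
      have "f (r \<circ> x) = f (r \<circ> y)" using fun_cong[OF xy(3), of r] r(1) by simp
      then have "(r \<circ> x) \<circ> finv (r \<circ> y) \<in> C"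
        by (rule f(2)[OF sgD(4)[OF sgG rG xy(1)] sgD(4)[OF sgG rG xy(2)]])
      then have "(g \<circ> finv r) \<circ> ((r \<circ> x) \<circ> finv (r \<circ> y)) \<circ> finv (g \<circ> finv r) \<in> C"
        using r sgD(4,5)[OF C(1)] by blast
      moreover have "(g \<circ> finv r) \<circ> ((r \<circ> x) \<circ> finv (r \<circ> y)) \<circ> finv (g \<circ> finv r) = g \<circ> (x \<circ> finv y) \<circ> finv g"
        using g rG xy G_Aut by (simp add: finv_comp_distrib fun_eq_iff subset_iff)
      ultimately show ?thesis by simp
    qed
    then show "x \<circ> finv y \<in> C0" using z by (auto simp: C0_def)
  qed
  then show ?thesis using that sC0 C0C norm by blast
qed

text \<open>If \<open>x\<close> moves \<open>v\<close> and \<open>a\<close> is nontrivial and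
  supported below \<open>v\<close>, then the conjugate of \<open>a\<close> by \<open>x\<close> is
  supported below \<open>x v\<close> and so differs from \<open>a\<close>.\<close>

lemma finite_index_noncommuting:
  assumes C: "sg C" "C \<subseteq> G" "index_finite G C"
  obtains a x where "a \<in> C" "x \<in> C" "a \<circ> x \<circ> finv a \<circ> finv x \<noteq> id"
proof -
  have "infinite C" using index_finite_infinite[OF C(3) sgG C(1) G_infinite] .
  then obtain x where x: "x \<in> C" "x \<noteq> id" by (metis finite.emptyI finite_insert finite_subset insertI1 subsetI)
  then obtain v where v: "x v \<noteq> v" by (auto simp: fun_eq_iff)
  obtain a where a: "a \<in> C" "a \<noteq> id" "supported a v" using finite_index_supported[OF C(1,3)] by blast
  have A: "a \<in> Aut" "x \<in> Aut" using a x sgD(3)[OF C(1)] by auto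
  have "a \<circ> x \<circ> finv a \<circ> finv x \<noteq> id"
  proof
    assume id: "a \<circ> x \<circ> finv a \<circ> finv x = id"
    have "a \<circ> x \<circ> finv a \<circ> finv x \<circ> x \<circ> a = a \<circ> x" using A by (simp add: fun_eq_iff)
    then have "x \<circ> a = a \<circ> x" unfolding id by simp
    then have "x \<circ> a \<circ> finv x = a" using A by (simp add: comp_assoc)
    then have "supported a (x v)" using supported_conj[OF A(2) a(3)] by simp
    then have "sect a v = id" using supported_off_sect(2)[OF A(1), of "x v" v] v A by simp
    then show False using supported_eq_id[OF A(1) a(3)] a(2) by simp
  qed
  then show ?thesis using that a x by blast
qed

text \<open>\<open>N\<close> contains copies of a finite index subgroup below every vertex that it moves: the elements all
  of whose conjugates graft into \<open>N\<close> form a normal subgroup, nontrivial because of the commutators.\<close>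

lemma grafts_of_finite_index:
  assumes F: "sg F" "F \<subseteq> G" "index_finite G F" and N: "sg N" "normalized F N"
    and U: "finite U" "\<And>u. u \<in> U \<Longrightarrow> \<exists>n\<in>N. n u \<noteq> u"
  obtains D where "sg D" "D \<subseteq> G" "index_finite G D" "\<And>u d. u \<in> U \<Longrightarrow> d \<in> D \<Longrightarrow> graft u d \<in> N"
proof -
  \<comment> \<open>Only grafts lying in \<open>F\<close> are known to normalize \<open>N\<close>.
    Grafting at \<open>u\<close> is a homomorphism from \<open>K\<close> into \<open>G\<close>, so
    demanding membership in \<open>F\<close> at the finitely many \<open>u\<close> costs only finite
    index.\<close>
  define C where "C = {c \<in> K. \<forall>u\<in>U. graft u c \<in> F}"
  have CK: "C \<subseteq> K" by (auto simp: C_def)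
  have sC: "sg C"
  proof (rule sgI)
    show "C \<subseteq> Aut" using CK sgD(2)[OF sgK] by blast
    show "id \<in> C" using sgD(1)[OF sgK] sgD(1)[OF F(1)] by (simp add: C_def)
    show "a \<circ> b \<in> C" if "a \<in> C" "b \<in> C" for a b
      using that sgD(4)[OF sgK] sgD(4)[OF F(1)] by (simp add: C_def graft_comp)
    show "finv a \<in> C" if "a \<in> C" for a
      using that sgD(3,5)[OF sgK] sgD(5)[OF F(1)] by (simp add: C_def graft_finv[symmetric])
  qed
  obtain f :: "_ \<Rightarrow> ('a list \<Rightarrow> 'a list) set" where
    f: "finite (f ` G)" "\<And>a b. a \<in> G \<Longrightarrow> b \<in> G \<Longrightarrow> f a = f b \<Longrightarrow> a \<circ> finv b \<in> F"
    by (rule index_finiteE[OF F(3,1) G_Aut]) blast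
  have gr: "graft u k \<in> G" if "k \<in> K" for k u using K_graft[OF that] K_sub by auto
  have "index_finite K C"
  proof (rule index_finiteI[OF sC sgD(2)[OF sgK], of "\<lambda>c. restrict (\<lambda>u. f (graft u c)) U"])
    have "(\<lambda>c. restrict (\<lambda>u. f (graft u c)) U) ` K \<subseteq> PiE U (\<lambda>_. f ` G)" using gr by auto
    then show "finite ((\<lambda>c. restrict (\<lambda>u. f (graft u c)) U) ` K)"
      using U(1) f(1) by (meson finite_PiE finite_subset)
    fix a b assume ab: "a \<in> K" "b \<in> K" "restrict (\<lambda>u. f (graft u a)) U = restrict (\<lambda>u. f (graft u b)) U"
    have "graft u (a \<circ> finv b) \<in> F" if u: "u \<in> U" for u
    proof -
      have "f (graft u a) = f (graft u b)" using fun_cong[OF ab(3), of u] u by simp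
      then have "graft u a \<circ> finv (graft u b) \<in> F" using f(2) gr ab by blast
      then show ?thesis using sgD(3)[OF sgK] ab by (simp add: graft_comp graft_finv)
    qed
    then show "a \<circ> finv b \<in> C" using ab sgD(4,5)[OF sgK] by (simp add: C_def)
  qed
  then have iC: "index_finite G C" using index_finite_trans[OF K_index _ sgG sgK sC CK K_sub] by blast
  obtain C0 where C0: "sg C0" "C0 \<subseteq> C" "index_finite G C0" "normalized G C0"
    using finite_index_core[OF sC _ iC] CK K_sub by blast
  define D where "D = {d \<in> G. \<forall>g\<in>G. \<forall>u\<in>U. graft u (g \<circ> d \<circ> finv g) \<in> N}"
  have conj: "g \<circ> (x \<circ> y) \<circ> finv g = (g \<circ> x \<circ> finv g) \<circ> (g \<circ> y \<circ> finv g)" if "g \<in> G" for g x y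
    using that G_Aut by (auto simp: fun_eq_iff)
  have conj_inv: "g \<circ> finv x \<circ> finv g = finv (g \<circ> x \<circ> finv g)" if "g \<in> G" "x \<in> G" for g x
    using that G_Aut by (auto simp: finv_comp_distrib comp_assoc subset_iff)
  have conjA: "g \<circ> x \<circ> finv g \<in> Aut" if "g \<in> G" "x \<in> G" for g x
    using that G_Aut by (auto simp: subset_iff)
  have sD: "sg D"
  proof (rule sgI)
    show "id \<in> D" using sgD(1)[OF sgG] sgD(1)[OF N(1)] G_Aut by (auto simp: D_def subset_iff)
    show "a \<circ> b \<in> D" if ab: "a \<in> D" "b \<in> D" for a b
      unfolding D_def
    proof (intro CollectI conjI ballI)
      fix g u assume gu: "g \<in> G" "u \<in> U"
      then have "graft u (g \<circ> a \<circ> finv g) \<in> N" "graft u (g \<circ> b \<circ> finv g) \<in> N" using ab by (auto simp: D_def)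
      then show "graft u (g \<circ> (a \<circ> b) \<circ> finv g) \<in> N"
        unfolding conj[OF gu(1)] graft_comp[of u "g \<circ> a \<circ> finv g"] by (rule sgD(4)[OF N(1)])
    qed (use ab sgD(4)[OF sgG] in \<open>auto simp: D_def\<close>)
    show "finv a \<in> D" if a: "a \<in> D" for a
      unfolding D_def
    proof (intro CollectI conjI ballI)
      have aG: "a \<in> G" using a by (simp add: D_def)
      fix g u assume gu: "g \<in> G" "u \<in> U"
      then have "graft u (g \<circ> a \<circ> finv g) \<in> N" using a by (auto simp: D_def)
      then show "graft u (g \<circ> finv a \<circ> finv g) \<in> N"
        unfolding conj_inv[OF gu(1) aG] graft_finv[OF conjA[OF gu(1) aG], symmetric]
        by (rule sgD(5)[OF N(1)])
    qed (use a sgD(5)[OF sgG] in \<open>auto simp: D_def\<close>)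
  qed (use G_Aut in \<open>auto simp: D_def\<close>)
  have nD: "normalized G D" unfolding normalized_def
  proof (intro ballI)
    fix g x assume gx: "g \<in> G" "x \<in> D"
    have "graft u (h \<circ> (g \<circ> x \<circ> finv g) \<circ> finv h) \<in> N" if h: "h \<in> G" "u \<in> U" for h u
    proof -
      have "h \<circ> g \<in> G" using gx h sgD(4)[OF sgG] by auto
      then have "graft u ((h \<circ> g) \<circ> x \<circ> finv (h \<circ> g)) \<in> N" using gx h unfolding D_def by blast
      then show ?thesis using h gx G_Aut by (simp add: finv_comp_distrib comp_assoc subset_iff)
    qed
    moreover have "g \<circ> x \<circ> finv g \<in> G" using gx sgD(4,5)[OF sgG] by (auto simp: D_def)
    ultimately show "g \<circ> x \<circ> finv g \<in> D" by (auto simp: D_def)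
  qed
  have C0G: "C0 \<subseteq> G" using C0(2) CK K_sub by auto
  \<comment> \<open>The commutator of two noncommuting elements of the core is the witness that
    \<open>D\<close> is nontrivial: every conjugate of it is again a commutator of core elements,
    and the double commutator trick puts its graft into \<open>N\<close>.\<close>
  obtain a x where ax: "a \<in> C0" "x \<in> C0" "a \<circ> x \<circ> finv a \<circ> finv x \<noteq> id"
    using finite_index_noncommuting[OF C0(1) C0G C0(3)] by blast
  have aG: "a \<in> G" "x \<in> G" using ax C0G by auto
  have "a \<circ> x \<circ> finv a \<circ> finv x \<in> D"
    unfolding D_def
  proof (intro CollectI conjI ballI)
    show "a \<circ> x \<circ> finv a \<circ> finv x \<in> G" using aG sgD(4,5)[OF sgG] by blast
    fix g u assume gu: "g \<in> G" "u \<in> U"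
    let ?a = "g \<circ> a \<circ> finv g" and ?x = "g \<circ> x \<circ> finv g"
    have "?a \<in> C0" "?x \<in> C0" using C0(4) gu ax by (auto simp: normalized_def)
    then have F': "graft u ?a \<in> F" "graft u ?x \<in> F" using C0(2) gu by (auto simp: C_def)
    have A: "?a \<in> Aut" "?x \<in> Aut" using conjA gu aG by auto
    obtain n where n: "n \<in> N" "n u \<noteq> u" using U(2)[OF gu(2)] by blast
    have "graft u ?a \<circ> graft u ?x \<circ> finv (graft u ?a) \<circ> finv (graft u ?x) \<in> N"
    proof (rule commutator_in_normalized[OF N(1) n])
      show "finv (graft u ?a) \<circ> m \<circ> graft u ?a \<in> N" if "m \<in> N" for m
      proof -
        have "finv (graft u ?a) \<circ> m \<circ> finv (finv (graft u ?a)) \<in> N"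
          using N(2) sgD(5)[OF F(1) F'(1)] that unfolding normalized_def by blast
        then show ?thesis using A by simp
      qed
      show "graft u ?x \<circ> m \<circ> finv (graft u ?x) \<in> N" if "m \<in> N" for m
        using N(2) F'(2) that unfolding normalized_def by blast
    qed (use A supported_graft in auto)
    also have "graft u ?a \<circ> graft u ?x \<circ> finv (graft u ?a) \<circ> finv (graft u ?x)
        = graft u (?a \<circ> ?x \<circ> finv ?a \<circ> finv ?x)"
      by (rule graft_commutator[OF A])
    also have "?a \<circ> ?x \<circ> finv ?a \<circ> finv ?x = g \<circ> (a \<circ> x \<circ> finv a \<circ> finv x) \<circ> finv g"
      using gu aG G_Aut by (simp add: finv_comp_distrib fun_eq_iff subset_iff)
    finally show "graft u (g \<circ> (a \<circ> x \<circ> finv a \<circ> finv x) \<circ> finv g) \<in> N" .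
  qed
  then have "D \<noteq> {id}" using ax(3) by auto
  moreover have DG: "D \<subseteq> G" by (auto simp: D_def)
  ultimately have "index_finite G D" using just_inf[OF sD DG nD] by blast
  moreover have "graft u d \<in> N" if "u \<in> U" "d \<in> D" for u d
  proof -
    have "graft u (id \<circ> d \<circ> finv id) \<in> N" using that sgD(1)[OF sgG] unfolding D_def by blast
    then show ?thesis by simp
  qed
  ultimately show ?thesis using that sD DG by blast
qed

text \<open>By level transitivity every vertex of level \<open>m\<close> is \<open>g u0\<close> for
  one fixed word \<open>u0\<close>, and its \<open>F\<close>-orbit is the image of the coset
  \<open>F g\<close> under evaluation at \<open>u0\<close>. So each level has at most
  \<open>|G : F|\<close> orbits.\<close>

lemma orbits_bounded:
  assumes F: "sg F" "F \<subseteq> G" "index_finite G F"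
  shows "\<exists>B. \<forall>N m. moved_orbits F N m \<le> B"
proof (intro exI allI)
  fix N m
  let ?Q = "(\<lambda>k. F #>\<^bsub>AutX\<^esub> k) ` G"
  define u0 where "u0 = replicate m (undefined :: 'a)"
  have sub: "orb F ` moved N m \<subseteq> (\<lambda>C. (\<lambda>c. c u0) ` C) ` ?Q"
  proof
    fix O' assume "O' \<in> orb F ` moved N m"
    then obtain u where u: "u \<in> level m" "O' = orb F u" by (auto simp: moved_def)
    moreover have "u0 \<in> level m" by (simp add: u0_def level_def)
    ultimately obtain g where g: "g \<in> G" "g u0 = u" using G_trans unfolding level_transitive_def by metis
    have "F #>\<^bsub>AutX\<^esub> g = (\<lambda>f. f \<circ> g) ` F" by (auto simp: r_coset_def)
    then have "(\<lambda>c. c u0) ` (F #>\<^bsub>AutX\<^esub> g) = orb F u" using g by (simp add: orb_def image_image)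
    then show "O' \<in> (\<lambda>C. (\<lambda>c. c u0) ` C) ` ?Q" using g u by blast
  qed
  have fin: "finite ?Q" using F(3) by (simp add: index_finite_def)
  have "moved_orbits F N m \<le> card ((\<lambda>C. (\<lambda>c. c u0) ` C) ` ?Q)"
    unfolding moved_orbits_def by (rule card_mono[OF _ sub]) (use fin in simp)
  also have "\<dots> \<le> card ?Q" by (rule card_image_le[OF fin])
  finally show "moved_orbits F N m \<le> card ?Q" .
qed

lemma max_moved_orbits:
  assumes F: "sg F" "F \<subseteq> G" "index_finite G F"
  shows "moved_orbits F N m \<le> max_moved_orbits F N" "\<exists>m. moved_orbits F N m = max_moved_orbits F N"
proof -
  obtain B where B: "\<forall>N m. moved_orbits F N m \<le> B" using orbits_bounded[OF F] by blast
  have "range (moved_orbits F N) \<subseteq> {..B}" by (rule image_subsetI) (simp add: B)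
  then have fin: "finite (range (moved_orbits F N))" by (rule finite_subset) simp
  show "moved_orbits F N m \<le> max_moved_orbits F N"
    unfolding max_moved_orbits_def by (rule Max_ge[OF fin]) auto
  have "max_moved_orbits F N \<in> range (moved_orbits F N)"
    unfolding max_moved_orbits_def by (rule Max_in[OF fin]) auto
  then show "\<exists>m. moved_orbits F N m = max_moved_orbits F N" by auto
qed

lemma max_moved_orbits_bounded:
  assumes F: "sg F" "F \<subseteq> G" "index_finite G F"
  shows "\<exists>B. \<forall>N. max_moved_orbits F N \<le> B"
proof -
  obtain B where B: "\<forall>N m. moved_orbits F N m \<le> B" using orbits_bounded[OF F] by blast
  have "max_moved_orbits F N \<le> B" for N
  proof -
    obtain m where "moved_orbits F N m = max_moved_orbits F N" using max_moved_orbits(2)[OF F] by blast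
    then show ?thesis using B by metis
  qed
  then show ?thesis by blast
qed

text \<open>On a level with the maximal number of moved orbits, \<open>N\<close> contains the grafts
  of one finite index subgroup \<open>D\<close> below each moved vertex, while below all other
  vertices \<open>N\<close>, and hence \<open>Rist N\<close>, is trivial. So the permutation of the
  level and the sections modulo \<open>D\<close> separate the cosets of \<open>N\<close>.\<close>

lemma index_finite_Rist:
  assumes F: "sg F" "F \<subseteq> G" "index_finite G F" and N: "sg N" "N \<subseteq> G" "normalized F N"
  shows "index_finite (Rist N) N"
proof -
  obtain m where m: "moved_orbits F N m = max_moved_orbits F N" using max_moved_orbits(2)[OF F] by blast
  have split: "u \<in> moved N m \<or> triv N u" if "u \<in> level m" for u
    by (rule maximal_level_split[OF F(1) N(1,3) _ that]) (use m max_moved_orbits(1)[OF F] in simp)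
  obtain D where D: "sg D" "D \<subseteq> G" "index_finite G D"
    "\<And>u d. u \<in> moved N m \<Longrightarrow> d \<in> D \<Longrightarrow> graft u d \<in> N"
    by (rule grafts_of_finite_index[OF F N(1,3), of "moved N m"]) (auto simp: moved_def)
  obtain f :: "_ \<Rightarrow> ('a list \<Rightarrow> 'a list) set" where
    f: "finite (f ` G)" "\<And>a b. a \<in> G \<Longrightarrow> b \<in> G \<Longrightarrow> f a = f b \<Longrightarrow> a \<circ> finv b \<in> D"
    by (rule index_finiteE[OF D(3,1) G_Aut]) blast
  have RG: "Rist N \<subseteq> G" by (auto simp: Rist_def)
  \<comment> \<open>Sections are taken at preimages, because the section of \<open>a b^-1\<close> at
    \<open>u\<close> is the quotient of the sections of \<open>a\<close> and \<open>b\<close> at the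
    common preimage of \<open>u\<close>.\<close>
  define ph where "ph g = restrict (\<lambda>u. (finv g u, f (sect g (finv g u)))) (level m)" for g
  show ?thesis
  proof (rule index_finiteI[OF N(1), of _ ph])
    show "Rist N \<subseteq> Aut" using RG G_Aut by blast
    have "ph ` Rist N \<subseteq> PiE (level m) (\<lambda>_. level m \<times> f ` G)"
    proof (rule image_subsetI)
      fix g assume "g \<in> Rist N"
      then have g: "g \<in> G" "g \<in> Aut" using RG G_Aut by auto
      then show "ph g \<in> PiE (level m) (\<lambda>_. level m \<times> f ` G)"
        unfolding ph_def restrict_PiE_iff using G_sect[OF g(1)] by (simp add: level_def)
    qed
    then show "finite (ph ` Rist N)"
      using f(1) by (meson finite_PiE finite_SigmaI finite_level finite_subset)
    fix a b assume ab: "a \<in> Rist N" "b \<in> Rist N" and eq: "ph a = ph b"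
    have abG: "a \<in> G" "b \<in> G" using ab RG by auto
    have A: "a \<in> Aut" "b \<in> Aut" using abG G_Aut by auto
    let ?c = "a \<circ> finv b"
    have eqs: "finv a u = finv b u" "f (sect a (finv a u)) = f (sect b (finv b u))" if "u \<in> level m" for u
    proof -
      have "ph g u = (finv g u, f (sect g (finv g u)))" for g using that by (simp add: ph_def)
      then have "(finv a u, f (sect a (finv a u))) = (finv b u, f (sect b (finv b u)))" by (metis eq)
      then show "finv a u = finv b u" "f (sect a (finv a u)) = f (sect b (finv b u))"
        by (blast dest: Pair_inject)+
    qed
    have sec: "sect ?c u = sect a (finv b u) \<circ> finv (sect b (finv b u))" if "u \<in> level m" for u
      by (rule sect_comp_finv[OF A eqs(1)[OF that]])
    have fix_u: "?c u = u" if "u \<in> level m" for u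
      using eqs(1)[OF that] Aut_finv_right[OF A(1), of u] by simp
    show "?c \<in> N"
    proof (rule graft_glue[OF N(1) finite_moved _ D(1) D(4)])
      show "moved N m \<subseteq> level m" by (auto simp: moved_def)
      fix u
      show "?c u = u" if "u \<in> level m" by (rule fix_u[OF that])
      show "sect ?c u \<in> D" if "u \<in> moved N m"
      proof -
        have u: "u \<in> level m" using that by (simp add: moved_def)
        have "f (sect a (finv b u)) = f (sect b (finv b u))" using eqs[OF u] by simp
        then show ?thesis unfolding sec[OF u] by (rule f(2)[OF G_sect[OF abG(1)] G_sect[OF abG(2)]])
      qed
      show "sect ?c u = id" if "u \<in> level m - moved N m"
      proof -
        have "triv N u" using split that by blast
        then have "a (u @ w) = u @ w" "b (u @ w) = u @ w" for w using ab by (auto simp: Rist_def)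
        then have "?c (u @ w) = u @ w" for w using Aut_finv_left[OF A(2), of "u @ w"] by simp
        then show ?thesis by (simp add: sect_def fun_eq_iff)
      qed
    qed (use A in auto)
  qed
qed

lemma max_moved_orbits_mono:
  assumes F: "sg F" "F \<subseteq> G" "index_finite G F" and "N \<subseteq> N'"
  shows "max_moved_orbits F N \<le> max_moved_orbits F N'"
proof -
  obtain m where m: "moved_orbits F N m = max_moved_orbits F N" using max_moved_orbits(2)[OF F] by blast
  have "orb F ` moved N m \<subseteq> orb F ` moved N' m" using assms(4) by (auto simp: moved_def)
  then have "moved_orbits F N m \<le> moved_orbits F N' m"
    unfolding moved_orbits_def by (intro card_mono) auto
  also have "\<dots> \<le> max_moved_orbits F N'" by (rule max_moved_orbits(1)[OF F])
  finally show ?thesis using m by simp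
qed

text \<open>Where the count for \<open>N\<close> is maximal, the count for \<open>N'\<close> is the
  same and also maximal, so both groups move the same vertices there. Elsewhere on that level
  \<open>N'\<close> is trivial below, which forces \<open>N'\<close> into \<open>Rist N\<close>,
  where \<open>N\<close> has finite index.\<close>

lemma index_finite_of_max_moved_orbits:
  assumes F: "sg F" "F \<subseteq> G" "index_finite G F" and N: "sg N" "normalized F N"
    and N': "sg N'" "N' \<subseteq> G" "normalized F N'" "N \<subseteq> N'"
    and le: "max_moved_orbits F N' \<le> max_moved_orbits F N"
  shows "index_finite N' N"
proof -
  obtain m where m: "moved_orbits F N m = max_moved_orbits F N" using max_moved_orbits(2)[OF F] by blast
  have sub: "moved N m \<subseteq> moved N' m" using N'(4) by (auto simp: moved_def)
  have "moved_orbits F N m \<le> moved_orbits F N' m"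
    unfolding moved_orbits_def using sub by (intro card_mono) auto
  then have m': "moved_orbits F N' m = max_moved_orbits F N'" "moved_orbits F N' m = moved_orbits F N m"
    using m le max_moved_orbits(1)[OF F, of N' m] by auto
  then have orbs: "orb F ` moved N m = orb F ` moved N' m"
    unfolding moved_orbits_def using sub by (intro card_subset_eq) auto
  have "moved N' m \<subseteq> moved N m"
  proof
    fix u assume "u \<in> moved N' m"
    then obtain v where v: "v \<in> moved N m" "orb F u = orb F v" using orbs by (metis imageE imageI)
    have "id u \<in> orb F u" unfolding orb_def using sgD(1)[OF F(1)] by (rule imageI)
    then have "\<exists>f\<in>F. u = f v" unfolding v(2) by (auto simp: orb_def)
    then show "u \<in> moved N m" using moved_invariant[OF F(1) N(2) v(1)] by auto
  qed
  then have mov: "moved N' m = moved N m" using sub by auto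
  have split: "u \<in> moved N' m \<or> triv N' u" if "u \<in> level m" for u
    by (rule maximal_level_split[OF F(1) N'(1,3) _ that]) (use m' max_moved_orbits(1)[OF F] in simp)
  have "N' \<subseteq> Rist N"
  proof
    fix g assume g: "g \<in> N'"
    have gA: "g \<in> Aut" using sgD(3)[OF N'(1) g] .
    have "g (v @ w) = v @ w" if v: "triv N v" for v w
    proof -
      \<comment> \<open>The padding by \<open>m\<close> letters ensures that the word has a prefix
        in level \<open>m\<close>; that prefix cannot be moved by \<open>N\<close>, since
        \<open>N\<close> fixes everything below \<open>v\<close>.\<close>
      define x where "x = v @ w @ replicate m undefined"
      define u where "u = take m x"
      have len: "m \<le> length x" by (simp add: x_def)
      then have u: "u \<in> level m" by (simp add: u_def level_def)
      have "u \<notin> moved N m"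
      proof
        assume "u \<in> moved N m"
        then have "x \<in> moved N (length x)"
          using moved_append[OF N(1), of u m "drop m x"] len by (simp add: u_def)
        then show False using v by (auto simp: moved_def triv_def x_def)
      qed
      then have "triv N' u" using split[OF u] mov by auto
      then have "g (u @ drop m x) = u @ drop m x" using g by (simp add: triv_def)
      then have "g x = x" by (simp add: u_def)
      then have "g ((v @ w) @ replicate m undefined) = (v @ w) @ replicate m undefined" by (simp add: x_def)
      then show ?thesis by (rule Aut_fixes_prefix[OF gA])
    qed
    then show "g \<in> Rist N" using g N'(2) by (auto simp: Rist_def)
  qed
  moreover have "index_finite (Rist N) N"
    using index_finite_Rist[OF F N(1) _ N(2)] N'(2,4) by blast
  ultimately show ?thesis using index_finite_mono_left by blast
qed

end

section \<open>Infra-direct products, coordinate by coordinate\<close>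

definition head_triv :: "('a::finite list \<Rightarrow> 'a list) set \<Rightarrow> 'a list list \<Rightarrow> nat \<Rightarrow> ('a list \<Rightarrow> 'a list) set" where
  "head_triv M ys i = {g \<in> M. \<forall>j<i. sect g (ys ! j) = id}"

text \<open>When \<open>M\<close> fixes the entries of \<open>ys\<close>, this is the quotient of
  \<open>head_triv M ys i\<close> by \<open>head_triv M ys (Suc i)\<close>, so the coordinates are
  the factors of a descending series of \<open>M\<close>.\<close>

definition coord :: "('a::finite list \<Rightarrow> 'a list) set \<Rightarrow> 'a list list \<Rightarrow> nat \<Rightarrow> ('a list \<Rightarrow> 'a list) set" where
  "coord M ys i = psi (ys ! i) (head_triv M ys i)"

definition fixes_pointwise :: "('a::finite list \<Rightarrow> 'a list) set \<Rightarrow> 'a list set \<Rightarrow> bool" where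
  "fixes_pointwise M Y \<longleftrightarrow> (\<forall>g\<in>M. \<forall>y\<in>Y. g y = y)"

lemma fixes_pointwise_nth: "fixes_pointwise M (set ys) \<Longrightarrow> g \<in> M \<Longrightarrow> i < length ys \<Longrightarrow> g (ys ! i) = ys ! i"
  by (simp add: fixes_pointwise_def)

lemma fixes_pointwise_mono: "fixes_pointwise M Y \<Longrightarrow> M' \<subseteq> M \<Longrightarrow> fixes_pointwise M' Y"
  by (auto simp: fixes_pointwise_def)

lemma fixes_pointwise_st: "fixes_pointwise (st H Y) Y"
  by (simp add: fixes_pointwise_def st_def)

lemma head_triv_sub: "head_triv M ys i \<subseteq> M"
  by (auto simp: head_triv_def)

lemma head_triv_mono: "M \<subseteq> M' \<Longrightarrow> head_triv M ys i \<subseteq> head_triv M' ys i"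
  by (auto simp: head_triv_def)

lemma head_triv_Suc: "head_triv M ys (Suc i) = {g \<in> head_triv M ys i. sect g (ys ! i) = id}"
  by (auto simp: head_triv_def less_Suc_eq)

lemma sg_head_triv:
  assumes M: "sg M" "fixes_pointwise M (set ys)" and i: "i \<le> length ys"
  shows "sg (head_triv M ys i)"
proof (rule sgI)
  have fx: "g (ys ! j) = ys ! j" if "g \<in> M" "j < i" for g j
    using fixes_pointwise_nth[OF M(2)] that i by simp
  show "head_triv M ys i \<subseteq> Aut" using head_triv_sub sgD(2)[OF M(1)] by blast
  show "id \<in> head_triv M ys i" using sgD(1)[OF M(1)] by (simp add: head_triv_def)
  show "a \<circ> b \<in> head_triv M ys i" if "a \<in> head_triv M ys i" "b \<in> head_triv M ys i" for a b
    using that sgD(3,4)[OF M(1)] fx[of b] by (simp add: head_triv_def sect_comp)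
  show "finv a \<in> head_triv M ys i" if a: "a \<in> head_triv M ys i" for a
  proof -
    have aM: "a \<in> M" "a \<in> Aut" using a sgD(3)[OF M(1)] by (auto simp: head_triv_def)
    have "sect (finv a) (ys ! j) = id" if "j < i" for j
      using sect_finv_fixed[OF aM(2) fx[OF aM(1) that]] a that by (simp add: head_triv_def finv_unique)
    then show ?thesis using sgD(5)[OF M(1) aM(1)] by (simp add: head_triv_def)
  qed
qed

lemma sg_coord:
  assumes M: "sg M" "fixes_pointwise M (set ys)" and i: "i < length ys"
  shows "sg (coord M ys i)"
  unfolding coord_def
proof (rule sg_psi)
  show "sg (head_triv M ys i)" using sg_head_triv[OF M] i by simp
  show "g (ys ! i) = ys ! i" if "g \<in> head_triv M ys i" for g
    by (rule fixes_pointwise_nth[OF M(2) _ i]) (use that in \<open>simp add: head_triv_def\<close>)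
qed

lemma coord_mono: "M \<subseteq> M' \<Longrightarrow> coord M ys i \<subseteq> coord M' ys i"
  unfolding coord_def by (intro psi_mono head_triv_mono)

lemma sect_conj_fixed:
  assumes "q \<in> Aut" "g \<in> Aut" "q y = y" "g y = y"
  shows "sect (q \<circ> g \<circ> finv q) y = sect q y \<circ> sect g y \<circ> finv (sect q y)"
  using assms Aut_finv_left[of q y] by (simp add: sect_comp sect_finv_fixed)

text \<open>\<open>head_triv M ys i\<close> is normal in \<open>M\<close>, and at a fixed vertex
  sections turn conjugation in \<open>M\<close> into conjugation by the full projection. That
  projection later serves as the finite index subgroup normalizing the coordinate.\<close>

lemma normalized_coord:
  assumes M: "sg M" "fixes_pointwise M (set ys)" and i: "i < length ys"
  shows "normalized (psi (ys ! i) M) (coord M ys i)"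
  unfolding normalized_def
proof (intro ballI)
  fix f n assume "f \<in> psi (ys ! i) M" "n \<in> coord M ys i"
  then obtain q g where q: "q \<in> M" "f = sect q (ys ! i)"
    and g: "g \<in> head_triv M ys i" "n = sect g (ys ! i)" by (auto simp: psi_def coord_def)
  have gM: "g \<in> M" using g by (simp add: head_triv_def)
  have A: "q \<in> Aut" "g \<in> Aut" using sgD(3)[OF M(1)] q gM by auto
  have sec: "sect (q \<circ> g \<circ> finv q) (ys ! j) = sect q (ys ! j) \<circ> sect g (ys ! j) \<circ> finv (sect q (ys ! j))"
    if "j \<le> i" for j
    by (rule sect_conj_fixed[OF A]) (use fixes_pointwise_nth[OF M(2)] q gM that i in auto)
  have "q \<circ> g \<circ> finv q \<in> head_triv M ys i"
    using sec g gM q A sgD(4,5)[OF M(1)] by (simp add: head_triv_def)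
  then show "f \<circ> n \<circ> finv f \<in> coord M ys i"
    unfolding coord_def psi_def using sec[of i] q g by (intro image_eqI[of _ _ "q \<circ> g \<circ> finv q"]) auto
qed

text \<open>Descending induction along the series: its last term is trivial because
  \<open>ys\<close> spans, and each step is an extension with image a coordinate and kernel the next
  term.\<close>

lemma index_finite_of_coords:
  assumes M: "sg M" "M \<subseteq> M'" and M': "sg M'" "fixes_pointwise M' (set ys)"
    and span: "spanning_leaf_set (set ys)"
    and idx: "\<And>i. i < length ys \<Longrightarrow> index_finite (coord M' ys i) (coord M ys i)"
  shows "index_finite M' M"
proof -
  have fM: "fixes_pointwise M (set ys)" using fixes_pointwise_mono[OF M'(2) M(2)] .
  have "index_finite (head_triv M' ys i) (head_triv M ys i)" if "i \<le> length ys" for i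
    using that
  proof (induction i rule: inc_induct)
    case base
    have "a = id" if a: "a \<in> head_triv M' ys (length ys)" for a
    proof (rule Aut_eqI_spanning[OF span])
      have aM: "a \<in> M'" using a by (simp add: head_triv_def)
      then show "a \<in> Aut" by (rule sgD(3)[OF M'(1)])
      show "a y = id y" "sect a y = sect id y" if "y \<in> set ys" for y
        using that a aM M'(2) by (auto simp: fixes_pointwise_def head_triv_def in_set_conv_nth)
    qed simp
    then have "head_triv M' ys (length ys) \<subseteq> head_triv M ys (length ys)"
      using sgD(1)[OF sg_head_triv[OF M(1) fM]] by auto
    moreover have "index_finite (head_triv M ys (length ys)) (head_triv M ys (length ys))"
      by (rule index_finite_refl[OF sg_head_triv[OF M(1) fM]]) simp
    ultimately show ?case using index_finite_mono_left by blast
  next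
    case (step i)
    have i: "i < length ys" using step by simp
    have fx: "g (ys ! i) = ys ! i" if "g \<in> M'" for g using fixes_pointwise_nth[OF M'(2) that i] .
    show ?case
    proof (rule index_finite_extension[where h = "\<lambda>g. sect g (ys ! i)"])
      show sM': "sg (head_triv M' ys i)" and "sg (head_triv M ys i)"
        using sg_head_triv[OF M'] sg_head_triv[OF M(1) fM] i by auto
      show "head_triv M ys i \<subseteq> head_triv M' ys i" by (rule head_triv_mono[OF M(2)])
      show "sg ((\<lambda>g. sect g (ys ! i)) ` head_triv M ys i)"
        using sg_coord[OF M(1) fM i] by (simp add: coord_def psi_def)
      show "(\<lambda>g. sect g (ys ! i)) ` head_triv M' ys i \<subseteq> Aut"
        using sgD(2)[OF sg_coord[OF M' i]] by (simp add: coord_def psi_def)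
      show "sect (a \<circ> b) (ys ! i) = sect a (ys ! i) \<circ> sect b (ys ! i)"
        if "a \<in> head_triv M' ys i" "b \<in> head_triv M' ys i" for a b
        by (rule sect_hom_fixed[OF sM']) (use fx that in \<open>auto simp: head_triv_def\<close>)
      show "index_finite ((\<lambda>g. sect g (ys ! i)) ` head_triv M' ys i) ((\<lambda>g. sect g (ys ! i)) ` head_triv M ys i)"
        using idx[OF i] by (simp add: coord_def psi_def)
      show "index_finite {a \<in> head_triv M' ys i. sect a (ys ! i) = id} {b \<in> head_triv M ys i. sect b (ys ! i) = id}"
        using step.IH by (simp add: head_triv_Suc)
    qed
  qed
  from this[of 0] show ?thesis by (simp add: head_triv_def)
qed

section \<open>Commensurators and overgroups of finite index\<close>

definition conj_in :: "('a::finite list \<Rightarrow> 'a list) set \<Rightarrow> ('a list \<Rightarrow> 'a list) \<Rightarrow> ('a list \<Rightarrow> 'a list) set" where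
  "conj_in H g = {h \<in> H. g \<circ> h \<circ> finv g \<in> H}"

text \<open>\<open>conj_in H g\<close> is the intersection of \<open>H\<close> with
  \<open>g^-1 H g\<close>. The condition for \<open>finv g\<close> says, after conjugation, that
  this intersection also has finite index in \<open>g^-1 H g\<close>.\<close>

definition commensurator :: "('a::finite list \<Rightarrow> 'a list) set \<Rightarrow> ('a list \<Rightarrow> 'a list) set \<Rightarrow> ('a list \<Rightarrow> 'a list) set" where
  "commensurator G H = {g \<in> G. index_finite H (conj_in H g) \<and> index_finite H (conj_in H (finv g))}"

lemma conj_comp: "g \<in> Aut \<Longrightarrow> g \<circ> (x \<circ> y) \<circ> finv g = (g \<circ> x \<circ> finv g) \<circ> (g \<circ> y \<circ> finv g)"
  by (simp add: fun_eq_iff)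

lemma conj_finv: "g \<in> Aut \<Longrightarrow> x \<in> Aut \<Longrightarrow> g \<circ> finv x \<circ> finv g = finv (g \<circ> x \<circ> finv g)"
  by (simp add: finv_comp_distrib comp_assoc)

lemma sg_conj_in:
  assumes "sg H" "g \<in> Aut" shows "sg (conj_in H g)"
proof (rule sgI)
  show "conj_in H g \<subseteq> Aut" using sgD(2)[OF assms(1)] by (auto simp: conj_in_def)
  show "id \<in> conj_in H g" using sgD(1)[OF assms(1)] assms(2) by (simp add: conj_in_def)
  show "a \<circ> b \<in> conj_in H g" if "a \<in> conj_in H g" "b \<in> conj_in H g" for a b
    using that sgD(4)[OF assms(1)] conj_comp[OF assms(2), of a b] by (simp add: conj_in_def)
  show "finv a \<in> conj_in H g" if "a \<in> conj_in H g" for a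
    using that sgD(3,5)[OF assms(1)] conj_finv[OF assms(2), of a] by (simp add: conj_in_def)
qed

text \<open>Conjugation by \<open>g'\<close> maps \<open>conj_in H g'\<close> into \<open>H\<close>,
  so the preimage \<open>Q\<close> of \<open>conj_in H g\<close> has finite index, and conjugation
  by the product keeps \<open>Q\<close> inside \<open>H\<close>.\<close>

lemma conj_in_comp:
  assumes H: "sg H" and g: "g \<in> Aut" "g' \<in> Aut"
    and idx: "index_finite H (conj_in H g)" "index_finite H (conj_in H g')"
  shows "index_finite H (conj_in H (g \<circ> g'))"
proof -
  define Q where "Q = {h \<in> conj_in H g'. g' \<circ> h \<circ> finv g' \<in> conj_in H g}"
  note s = sg_conj_in[OF H g(1)] and s' = sg_conj_in[OF H g(2)]
  have sQ: "sg Q"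
  proof (rule sgI)
    show "Q \<subseteq> Aut" using sgD(2)[OF s'] by (auto simp: Q_def)
    show "id \<in> Q" using sgD(1)[OF s] sgD(1)[OF s'] g by (simp add: Q_def)
    show "a \<circ> b \<in> Q" if "a \<in> Q" "b \<in> Q" for a b
      using that sgD(4)[OF s'] sgD(4)[OF s] conj_comp[OF g(2), of a b] by (simp add: Q_def)
    show "finv a \<in> Q" if "a \<in> Q" for a
      using that sgD(3,5)[OF s'] sgD(5)[OF s] conj_finv[OF g(2), of a] by (simp add: Q_def)
  qed
  obtain f :: "_ \<Rightarrow> ('a list \<Rightarrow> 'a list) set" where
    f: "finite (f ` H)" "\<And>a b. a \<in> H \<Longrightarrow> b \<in> H \<Longrightarrow> f a = f b \<Longrightarrow> a \<circ> finv b \<in> conj_in H g"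
    by (rule index_finiteE[OF idx(1) s sgD(2)[OF H]]) blast
  have "index_finite (conj_in H g') Q"
  proof (rule index_finiteI[OF sQ sgD(2)[OF s'], of "\<lambda>h. f (g' \<circ> h \<circ> finv g')"])
    show "finite ((\<lambda>h. f (g' \<circ> h \<circ> finv g')) ` conj_in H g')"
      by (rule finite_subset[OF _ f(1)]) (auto simp: conj_in_def)
    fix a b assume ab: "a \<in> conj_in H g'" "b \<in> conj_in H g'" "f (g' \<circ> a \<circ> finv g') = f (g' \<circ> b \<circ> finv g')"
    then have "(g' \<circ> a \<circ> finv g') \<circ> finv (g' \<circ> b \<circ> finv g') \<in> conj_in H g"
      by (intro f(2)) (auto simp: conj_in_def)
    then have "g' \<circ> (a \<circ> finv b) \<circ> finv g' \<in> conj_in H g"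
      using conj_comp[OF g(2), of a "finv b"] conj_finv[OF g(2), of b] sgD(3)[OF s' ab(2)] by simp
    then show "a \<circ> finv b \<in> Q" using sgD(4)[OF s' ab(1) sgD(5)[OF s' ab(2)]] by (simp add: Q_def)
  qed
  then have "index_finite H Q"
    by (rule index_finite_trans[OF idx(2) _ H s' sQ]) (auto simp: Q_def conj_in_def)
  moreover have "Q \<subseteq> conj_in H (g \<circ> g')"
    using g by (auto simp: Q_def conj_in_def finv_comp_distrib comp_assoc)
  ultimately show ?thesis
    using index_finite_mono_right[OF _ sQ sg_conj_in[OF H]] g sgD(2)[OF H] by auto
qed

lemma sg_commensurator:
  assumes G: "sg G" and H: "sg H" shows "sg (commensurator G H)"
proof (rule sgI)
  show "commensurator G H \<subseteq> Aut" using sgD(2)[OF G] by (auto simp: commensurator_def)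
  have "conj_in H id = H" by (simp add: conj_in_def)
  then show "id \<in> commensurator G H"
    using sgD(1)[OF G] index_finite_refl[OF H] by (simp add: commensurator_def)
  show "a \<circ> b \<in> commensurator G H" if "a \<in> commensurator G H" "b \<in> commensurator G H" for a b
    using that sgD(3,4)[OF G] conj_in_comp[OF H, of a b] conj_in_comp[OF H, of "finv b" "finv a"]
    by (simp add: commensurator_def finv_comp_distrib)
  show "finv a \<in> commensurator G H" if "a \<in> commensurator G H" for a
    using that sgD(3,5)[OF G] by (simp add: commensurator_def)
qed

lemma finite_index_overgroup_commensurates:
  assumes H: "sg H" "H \<subseteq> H'" and H': "sg H'" "H' \<subseteq> G" and idx: "index_finite H' H"
  shows "H' \<subseteq> commensurator G H"
proof -
  obtain f :: "_ \<Rightarrow> ('a list \<Rightarrow> 'a list) set" where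
    f: "finite (f ` H')" "\<And>a b. a \<in> H' \<Longrightarrow> b \<in> H' \<Longrightarrow> f a = f b \<Longrightarrow> a \<circ> finv b \<in> H"
    by (rule index_finiteE[OF idx H(1) sgD(2)[OF H'(1)]]) blast
  have "index_finite H (conj_in H g)" if g: "g \<in> H'" for g
  proof (rule index_finiteI[OF sg_conj_in[OF H(1) sgD(3)[OF H'(1) g]] sgD(2)[OF H(1)], of "\<lambda>h. f (g \<circ> h)"])
    show "finite ((\<lambda>h. f (g \<circ> h)) ` H)"
      by (rule finite_subset[OF _ f(1)]) (use g H(2) sgD(4)[OF H'(1)] in auto)
    fix a b assume ab: "a \<in> H" "b \<in> H" "f (g \<circ> a) = f (g \<circ> b)"
    have ab': "a \<in> H'" "b \<in> H'" using ab H(2) by auto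
    have "(g \<circ> a) \<circ> finv (g \<circ> b) \<in> H"
      by (rule f(2)[OF sgD(4)[OF H'(1) g ab'(1)] sgD(4)[OF H'(1) g ab'(2)] ab(3)])
    moreover have "(g \<circ> a) \<circ> finv (g \<circ> b) = g \<circ> (a \<circ> finv b) \<circ> finv g"
      using g ab' sgD(3)[OF H'(1)] by (simp add: finv_comp_distrib comp_assoc)
    ultimately show "a \<circ> finv b \<in> conj_in H g"
      using ab sgD(4,5)[OF H(1)] by (simp add: conj_in_def)
  qed
  then show ?thesis using H'(2) sgD(5)[OF H'(1)] by (auto simp: commensurator_def)
qed

context branch_group
begin

lemma psi_sub_G: "M \<subseteq> G \<Longrightarrow> psi y M \<subseteq> G"
  using G_sect by (auto simp: psi_def)

lemma coord_sub_G: "M \<subseteq> G \<Longrightarrow> coord M ys i \<subseteq> G"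
  unfolding coord_def using psi_sub_G head_triv_sub by (metis order_trans)

lemma infra_directD:
  assumes "infra_direct G H Y" "y \<in> Y" shows "index_finite G (psi y (st H Y))"
  using assms by (simp add: infra_direct_def)

lemma sg_psi_st: "sg H \<Longrightarrow> y \<in> Y \<Longrightarrow> sg (psi y (st H Y))"
  by (rule sg_psi[OF sg_st]) (auto simp: st_def)

lemma st_sub: "H \<subseteq> G \<Longrightarrow> st H Y \<subseteq> G"
  by (auto simp: st_def)

lemma infra_direct_mono:
  assumes H: "sg H" "H \<subseteq> H'" and H': "sg H'" "H' \<subseteq> G" and inf: "infra_direct G H Y"
  shows "infra_direct G H' Y"
  unfolding infra_direct_def
proof (intro ballI conjI)
  fix y assume y: "y \<in> Y"
  show "psi y (st H' Y) \<subseteq> G" by (rule psi_sub_G[OF st_sub[OF H'(2)]])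
  show "index_finite G (psi y (st H' Y))"
    by (rule index_finite_mono_right[OF infra_directD[OF inf y] sg_psi_st[OF H(1) y] sg_psi_st[OF H'(1) y] _ G_Aut])
      (use H(2) in \<open>auto intro!: psi_mono simp: st_def\<close>)
qed

text \<open>By \<open>index_finite_of_coords\<close> it suffices to compare coordinates. A
  coordinate element of the commensurator commutes, modulo the coordinate of \<open>H\<close>, with
  a finite index subgroup of \<open>G\<close>; hence it lies in the group \<open>Rist\<close> of
  that coordinate.\<close>

lemma index_finite_commensurator:
  assumes H: "sg H" "H \<subseteq> G" and Y: "spanning_leaf_set Y" and inf: "infra_direct G H Y"
  shows "index_finite (commensurator G H) H"
proof -
  let ?C = "commensurator G H"
  have finY: "finite Y" using Y by (simp add: spanning_leaf_set_def leaf_set_def)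
  then obtain ys where ys: "set ys = Y" using finite_list by blast
  define M where "M = st H Y"
  define M' where "M' = st ?C Y"
  note sC = sg_commensurator[OF sgG H(1)]
  have sM: "sg M" "sg M'" using sg_st[OF H(1)] sg_st[OF sC] by (auto simp: M_def M'_def)
  have HC: "H \<subseteq> ?C"
    by (rule finite_index_overgroup_commensurates[OF H(1) subset_refl H index_finite_refl[OF H(1)]])
  have MM': "M \<subseteq> M'" using HC by (auto simp: M_def M'_def st_def)
  have fx: "fixes_pointwise M (set ys)" "fixes_pointwise M' (set ys)"
    unfolding ys M_def M'_def by (rule fixes_pointwise_st)+
  have MG: "M \<subseteq> G" using H(2) by (auto simp: M_def st_def)
  have M'G: "M' \<subseteq> G" by (auto simp: M'_def st_def commensurator_def)
  have "index_finite M' M"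
  proof (rule index_finite_of_coords[OF sM(1) MM' sM(2) fx(2)])
    show "spanning_leaf_set (set ys)" using Y ys by simp
    fix i assume i: "i < length ys"
    let ?y = "ys ! i"
    have y: "?y \<in> Y" using i ys by auto
    have idx: "index_finite G (psi ?y M)" using infra_directD[OF inf y] by (simp add: M_def)
    have spsi: "sg (psi ?y M)" using sg_psi_st[OF H(1) y] by (simp add: M_def)
    have "coord M' ys i \<subseteq> Rist (coord M ys i)"
    proof
      fix c assume "c \<in> coord M' ys i"
      then obtain g where g: "g \<in> head_triv M' ys i" "c = sect g ?y" by (auto simp: coord_def psi_def)
      have gM: "g \<in> M'" using g head_triv_sub by blast
      have gA: "g \<in> Aut" using sgD(3)[OF sM(2) gM] .
      have gidx: "index_finite H (conj_in H g)" using gM by (simp add: M'_def st_def commensurator_def)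
      \<comment> \<open>\<open>Q\<close> consists of the elements of \<open>M\<close> that
        \<open>g\<close> conjugates into \<open>H\<close>. It has finite index in \<open>M\<close>,
        so its section at \<open>?y\<close> has finite index in \<open>G\<close>.\<close>
      define Q where "Q = st (conj_in H g) Y"
      have sQ: "sg Q" unfolding Q_def by (rule sg_st[OF sg_conj_in[OF H(1) gA]])
      have QM: "Q \<subseteq> M" by (auto simp: Q_def M_def st_def conj_in_def)
      have fxQ: "q ?y = ?y" if "q \<in> M" for q using fixes_pointwise_nth[OF fx(1) that i] .
      have "index_finite (H \<inter> M) (conj_in H g \<inter> M)"
        by (rule index_finite_Int[OF gidx sg_conj_in[OF H(1) gA] H(1) sM(1)])
      moreover have "H \<inter> M = M" "conj_in H g \<inter> M = Q"
        by (auto simp: Q_def M_def st_def conj_in_def)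
      ultimately have "index_finite M Q" by simp
      then have "index_finite (psi ?y M) (psi ?y Q)"
        by (rule index_finite_psi[OF _ sM(1) sQ QM]) (rule fxQ)
      moreover have sF: "sg (psi ?y Q)" using sg_psi[OF sQ] fxQ QM by blast
      ultimately have idxF: "index_finite G (psi ?y Q)"
        using index_finite_trans[OF idx _ sgG spsi sF psi_mono[OF QM] psi_sub_G[OF MG]] by blast
      show "c \<in> Rist (coord M ys i)"
      proof (rule commuting_mod_in_Rist[OF sF idxF])
        show "c \<in> G" using g G_sect gM M'G by auto
        fix f assume "f \<in> psi ?y Q"
        then obtain q where q: "q \<in> Q" "f = sect q ?y" by (auto simp: psi_def)
        have qM: "q \<in> M" using q QM by auto
        have qA: "q \<in> Aut" using sgD(3)[OF sM(1) qM] .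
        \<comment> \<open>The commutator of \<open>g\<close> and \<open>q\<close> lies in
          \<open>H\<close> because \<open>?k\<close> and \<open>q\<close> both do, and its sections
          before position \<open>i\<close> vanish because those of \<open>g\<close> do.\<close>
        let ?k = "g \<circ> q \<circ> finv g"
        have sec: "sect (?k \<circ> finv q) (ys ! j)
            = sect g (ys ! j) \<circ> sect q (ys ! j) \<circ> finv (sect g (ys ! j)) \<circ> finv (sect q (ys ! j))"
          if "j \<le> i" for j
        proof -
          have j: "j < length ys" using that i by simp
          have fix_j: "g (ys ! j) = ys ! j" "q (ys ! j) = ys ! j"
            using fixes_pointwise_nth[OF fx(2) gM j] fixes_pointwise_nth[OF fx(1) qM j] by auto
          then have "finv q (ys ! j) = ys ! j" using Aut_finv_left[OF qA, of "ys ! j"] by simp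
          then show ?thesis
            using sect_comp[of ?k "finv q" "ys ! j"] sect_conj_fixed[OF gA qA fix_j]
              sect_finv_fixed[OF qA fix_j(2)] gA qA by simp
        qed
        have "q \<in> M'" using qM MM' by blast
        then have "?k \<in> M'" by (intro sgD(4,5)[OF sM(2)] gM)
        moreover have "?k \<in> H" using q by (simp add: Q_def st_def conj_in_def)
        ultimately have "?k \<in> M" by (simp add: M'_def M_def st_def)
        then have "?k \<circ> finv q \<in> M" by (rule sgD(4)[OF sM(1) _ sgD(5)[OF sM(1) qM]])
        moreover have "sect (?k \<circ> finv q) (ys ! j) = id" if "j < i" for j
          using sec[of j] that g(1) qA by (simp add: head_triv_def finv_unique)
        ultimately have "?k \<circ> finv q \<in> head_triv M ys i" by (simp add: head_triv_def)
        then show "c \<circ> f \<circ> finv c \<circ> finv f \<in> coord M ys i"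
          unfolding coord_def psi_def using sec[of i] g(2) q(2)
          by (intro image_eqI[of _ _ "?k \<circ> finv q"]) auto
      qed
    qed
    moreover have "index_finite (Rist (coord M ys i)) (coord M ys i)"
      by (rule index_finite_Rist[OF spsi psi_sub_G[OF MG] idx sg_coord[OF sM(1) fx(1) i]
            coord_sub_G[OF MG] normalized_coord[OF sM(1) fx(1) i]])
    ultimately show "index_finite (coord M' ys i) (coord M ys i)" using index_finite_mono_left by blast
  qed
  moreover have "index_finite ?C M'" unfolding M'_def by (rule index_finite_st[OF sC finY])
  ultimately have "index_finite ?C M"
    using index_finite_trans[OF _ _ sC sM(2) sM(1) MM'] by (auto simp: M'_def st_def)
  then show ?thesis
    by (rule index_finite_mono_right[OF _ sM(1) H(1) _ sgD(2)[OF sC]]) (auto simp: M_def st_def)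
qed

text \<open>Every such overgroup lies in the commensurator and is a union of cosets of
  \<open>H\<close>, of which the commensurator contains only finitely many.\<close>

lemma finite_finite_index_overgroups:
  assumes H: "sg H" "H \<subseteq> G" and Y: "spanning_leaf_set Y" and inf: "infra_direct G H Y"
  shows "finite {H'. sg H' \<and> H \<subseteq> H' \<and> H' \<subseteq> G \<and> index_finite H' H}"
proof (rule finite_subset)
  let ?q = "\<lambda>k. H #>\<^bsub>AutX\<^esub> k"
  show "finite (Union ` Pow (?q ` commensurator G H))"
    using index_finite_commensurator[OF assms] by (simp add: index_finite_def)
  show "{H'. sg H' \<and> H \<subseteq> H' \<and> H' \<subseteq> G \<and> index_finite H' H} \<subseteq> Union ` Pow (?q ` commensurator G H)"
  proof
    fix H' assume "H' \<in> {H'. sg H' \<and> H \<subseteq> H' \<and> H' \<subseteq> G \<and> index_finite H' H}"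
    then have H': "sg H'" "H \<subseteq> H'" "H' \<subseteq> G" "index_finite H' H" by auto
    have "H' = \<Union> (?q ` H')"
    proof
      show "H' \<subseteq> \<Union> (?q ` H')"
        using sgD(1)[OF H(1)] unfolding r_coset_def by fastforce
      show "\<Union> (?q ` H') \<subseteq> H'"
        using H'(2) sgD(4)[OF H'(1)] by (auto simp: r_coset_def)
    qed
    moreover have "?q ` H' \<in> Pow (?q ` commensurator G H)"
      using finite_index_overgroup_commensurates[OF H(1) H'(2,1,3,4)] by (intro PowI image_mono)
    ultimately show "H' \<in> Union ` Pow (?q ` commensurator G H)" by (rule image_eqI)
  qed
qed

section \<open>A bounded rank on overgroups, detecting infinite index\<close>

definition orbit_rank :: "('a list \<Rightarrow> 'a list) set \<Rightarrow> 'a list list \<Rightarrow> ('a list \<Rightarrow> 'a list) set \<Rightarrow> nat" where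
  "orbit_rank M0 ys M = (\<Sum>i<length ys. max_moved_orbits (psi (ys ! i) M0) (coord M ys i))"

text \<open>The base group \<open>M0\<close> stays fixed while \<open>M\<close> varies: its
  projections normalize the coordinates of every overgroup, so all orbit counts refer to the same
  acting groups. Equality of the two sums forces equality of each summand by monotonicity, which
  gives finite index in each coordinate.\<close>

lemma orbit_rank:
  assumes M0: "sg M0" "M0 \<subseteq> G" "fixes_pointwise M0 (set ys)"
    and idx: "\<And>i. i < length ys \<Longrightarrow> index_finite G (psi (ys ! i) M0)"
  shows orbit_rank_bounded: "\<exists>B. \<forall>M. orbit_rank M0 ys M \<le> B"
    and orbit_rank_mono: "M \<subseteq> M' \<Longrightarrow> orbit_rank M0 ys M \<le> orbit_rank M0 ys M'"
    and index_finite_of_orbit_rank: "\<lbrakk>spanning_leaf_set (set ys); sg M; M0 \<subseteq> M; M \<subseteq> M'; sg M'; M' \<subseteq> G;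
      fixes_pointwise M' (set ys); orbit_rank M0 ys M' \<le> orbit_rank M0 ys M\<rbrakk> \<Longrightarrow> index_finite M' M"
proof -
  let ?F = "\<lambda>i. psi (ys ! i) M0"
  have F: "sg (?F i)" "?F i \<subseteq> G" "index_finite G (?F i)" if "i < length ys" for i
    using sg_psi[OF M0(1)] fixes_pointwise_nth[OF M0(3) _ that] psi_sub_G[OF M0(2)] idx[OF that] by blast+
  have "\<forall>i\<in>{..<length ys}. \<exists>B. \<forall>N. max_moved_orbits (?F i) N \<le> B"
    using max_moved_orbits_bounded[OF F] by auto
  from bchoice[OF this] obtain B where "\<forall>i\<in>{..<length ys}. \<forall>N. max_moved_orbits (?F i) N \<le> B i" by blast
  then have "orbit_rank M0 ys M \<le> (\<Sum>i<length ys. B i)" for M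
    unfolding orbit_rank_def by (intro sum_mono) blast
  then show "\<exists>B. \<forall>M. orbit_rank M0 ys M \<le> B" by blast
  have le: "max_moved_orbits (?F i) (coord M ys i) \<le> max_moved_orbits (?F i) (coord M' ys i)"
    if "M \<subseteq> M'" "i \<in> {..<length ys}" for M M' i
    using max_moved_orbits_mono[OF F coord_mono[OF that(1)]] that(2) by simp
  then show "orbit_rank M0 ys M \<le> orbit_rank M0 ys M'" if "M \<subseteq> M'"
    unfolding orbit_rank_def using that by (intro sum_mono) blast
  assume span: "spanning_leaf_set (set ys)" and M: "sg M" "M0 \<subseteq> M" "M \<subseteq> M'"
    and M': "sg M'" "M' \<subseteq> G" "fixes_pointwise M' (set ys)"
    and rank: "orbit_rank M0 ys M' \<le> orbit_rank M0 ys M"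
  have fM: "fixes_pointwise M (set ys)" by (rule fixes_pointwise_mono[OF M'(3) M(3)])
  have "max_moved_orbits (?F i) (coord M ys i) = max_moved_orbits (?F i) (coord M' ys i)"
    if "i \<in> {..<length ys}" for i
  proof (rule sum_mono_inv[OF _ le that])
    show "(\<Sum>i<length ys. max_moved_orbits (?F i) (coord M ys i)) = (\<Sum>i<length ys. max_moved_orbits (?F i) (coord M' ys i))"
      using rank sum_mono[of "{..<length ys}" "\<lambda>i. max_moved_orbits (?F i) (coord M ys i)", OF le[OF M(3)]]
      unfolding orbit_rank_def by (rule order_antisym[rotated])
  qed (use M in auto)
  then have eq: "max_moved_orbits (?F i) (coord M' ys i) \<le> max_moved_orbits (?F i) (coord M ys i)"
    if "i < length ys" for i using that by simp
  have norm: "normalized (?F i) (coord M1 ys i)"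
    if "sg M1" "fixes_pointwise M1 (set ys)" "M0 \<subseteq> M1" "i < length ys" for M1 i
    using normalized_coord[OF that(1,2,4)] psi_mono[OF that(3)] unfolding normalized_def by blast
  show "index_finite M' M"
  proof (rule index_finite_of_coords[OF M(1,3) M'(1,3) span])
    fix i assume i: "i < length ys"
    show "index_finite (coord M' ys i) (coord M ys i)"
    proof (rule index_finite_of_max_moved_orbits[OF F[OF i]])
      show "normalized (?F i) (coord M ys i)" "normalized (?F i) (coord M' ys i)"
        using norm[OF M(1) fM M(2) i] norm[OF M'(1,3) _ i] M(2,3) by auto
    qed (use sg_coord[OF M(1) fM i] sg_coord[OF M'(1,3) i] coord_sub_G[OF M'(2)] coord_mono[OF M(3)] eq[OF i] in auto)
  qed
qed

text \<open>\<open>M0\<close> captures all projections of \<open>M\<close>, and among the finitely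
  generated groups between \<open>M0\<close> and \<open>M\<close> one of maximal rank,
  \<open>M1\<close>, is chosen. Adjoining any element of \<open>M\<close> to \<open>M1\<close>
  leaves the rank unchanged and thus yields a finite index overgroup, so \<open>M\<close>
  commensurates \<open>M1\<close> and contains it with finite index.\<close>

lemma infra_direct_fin_gen:
  assumes G: "fin_gen G" and L: "sg L" "L \<subseteq> G" and Y: "spanning_leaf_set Y" and inf: "infra_direct G L Y"
  shows "fin_gen L"
proof -
  have finY: "finite Y" using Y by (simp add: spanning_leaf_set_def leaf_set_def)
  then obtain ys where ys: "set ys = Y" using finite_list by blast
  define M where "M = st L Y"
  have sM: "sg M" unfolding M_def by (rule sg_st[OF L(1)])
  have MG: "M \<subseteq> G" using L(2) by (auto simp: M_def st_def)
  have fx: "fixes_pointwise M Y" unfolding M_def by (rule fixes_pointwise_st)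
  have idx: "index_finite G (psi y M)" if "y \<in> Y" for y using infra_directD[OF inf that] by (simp add: M_def)
  have spsi: "sg (psi y M)" if "y \<in> Y" for y using sg_psi_st[OF L(1) that] by (simp add: M_def)
  obtain M0 where M0: "fin_gen M0" "M0 \<subseteq> M" "\<And>y. y \<in> Y \<Longrightarrow> psi y M0 = psi y M"
  proof (rule fin_gen_lift[OF sM _ finY])
    show "fin_gen (psi y M)" if "y \<in> Y" for y
      by (rule fin_gen_finite_index[OF G spsi[OF that] psi_sub_G[OF MG] idx[OF that]])
  qed (use fx in \<open>auto simp: fixes_pointwise_def\<close>)
  have M0': "sg M0" "M0 \<subseteq> G" "fixes_pointwise M0 (set ys)"
    using fin_gen_sg[OF M0(1)] M0(2) MG fixes_pointwise_mono[OF fx M0(2)] ys by auto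
  have idx0: "index_finite G (psi (ys ! i) M0)" if "i < length ys" for i
    using idx M0(3) ys that by auto
  let ?P = "\<lambda>M1. fin_gen M1 \<and> M0 \<subseteq> M1 \<and> M1 \<subseteq> M"
  obtain B where "\<forall>M1. orbit_rank M0 ys M1 \<le> B" using orbit_rank_bounded[OF M0' idx0] by blast
  then have "\<forall>M1. ?P M1 \<longrightarrow> orbit_rank M0 ys M1 < Suc B" by (simp add: le_imp_less_Suc)
  then obtain M1 where M1: "?P M1" "\<And>M2. ?P M2 \<Longrightarrow> orbit_rank M0 ys M2 \<le> orbit_rank M0 ys M1"
    using ex_has_greatest_nat[of ?P M0 "orbit_rank M0 ys" "Suc B"] M0(1,2) by blast
  have sM1: "sg M1" using fin_gen_sg M1(1) by blast
  have M1G: "M1 \<subseteq> G" using M1(1) MG by blast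
  have stM1: "st M1 Y = M1" using M1(1) fx by (auto simp: st_def fixes_pointwise_def)
  have inf1: "infra_direct G M1 Y"
    unfolding infra_direct_def stM1
  proof (intro ballI conjI)
    fix y assume y: "y \<in> Y"
    show "psi y M1 \<subseteq> G" by (rule psi_sub_G[OF M1G])
    have "psi y M1 = psi y M" using M0(3)[OF y] psi_mono M1(1) by (metis subset_antisym)
    then show "index_finite G (psi y M1)" using idx[OF y] by simp
  qed
  have "M \<subseteq> commensurator G M1"
  proof
    fix g assume g: "g \<in> M"
    obtain S where S: "finite S" "S \<subseteq> Aut" "M1 = generate AutX S" using M1(1) by (auto simp: fin_gen_def)
    let ?M2 = "generate AutX (insert g S)"
    have sub: "insert g S \<subseteq> M" using g M1(1) S generate_superset[of S] by auto
    then have A: "insert g S \<subseteq> Aut" using sgD(2)[OF sM] by blast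
    have fg: "fin_gen ?M2" unfolding fin_gen_def using S(1) A by blast
    have sM2: "sg ?M2" by (rule fin_gen_sg[OF fg])
    have M2M: "?M2 \<subseteq> M" by (rule generate_least[OF sM sub])
    have M12: "M1 \<subseteq> ?M2" unfolding S(3)
      by (rule generate_least[OF sM2]) (use generate_superset[of "insert g S"] in auto)
    have "index_finite ?M2 M1"
    proof (rule index_finite_of_orbit_rank[OF M0' idx0 _ sM1 _ M12 sM2])
      show "orbit_rank M0 ys ?M2 \<le> orbit_rank M0 ys M1" using M1 fg M12 M2M by blast
      show "fixes_pointwise ?M2 (set ys)" unfolding ys by (rule fixes_pointwise_mono[OF fx M2M])
    qed (use Y ys M1(1) M2M MG in auto)
    then have "?M2 \<subseteq> commensurator G M1"
      by (rule finite_index_overgroup_commensurates[OF sM1 M12 sM2 subset_trans[OF M2M MG]])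
    moreover have "g \<in> ?M2" using generate_superset[of "insert g S"] by auto
    ultimately show "g \<in> commensurator G M1" by blast
  qed
  then have "index_finite M M1"
    using index_finite_commensurator[OF sM1 M1G Y inf1] index_finite_mono_left by blast
  then have "fin_gen M" using fin_gen_overgroup[OF _ sM] M1(1) by blast
  then show ?thesis
    by (rule fin_gen_overgroup[OF _ L(1)]) (use index_finite_st[OF L(1) finY] in \<open>auto simp: M_def st_def\<close>)
qed

end

section \<open>Subgroups with a finite section\<close>

lemma psi_append: "psi (u @ w) H = (\<lambda>s. sect s w) ` psi u H"
  by (simp add: psi_def sect_append image_image)

lemma sg_rigid:
  assumes K: "sg K" shows "sg (rigid K Y)"
proof (rule sgI)
  show "rigid K Y \<subseteq> Aut" by (auto simp: rigid_def)
  show "id \<in> rigid K Y" using sgD(1)[OF K] by (simp add: rigid_def)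
  show "a \<circ> b \<in> rigid K Y" if "a \<in> rigid K Y" "b \<in> rigid K Y" for a b
    using that sgD(4)[OF K] by (simp add: rigid_def sect_comp)
  show "finv a \<in> rigid K Y" if a: "a \<in> rigid K Y" for a
  proof -
    have aA: "a \<in> Aut" using a by (simp add: rigid_def)
    have inv: "finv a w = w" if "a w = w" for w using Aut_finv_left[OF aA, of w] that by simp
    have "sect (finv a) y \<in> K" if "y \<in> Y" for y
    proof -
      have "a y = y" "sect a y \<in> K" using a that by (auto simp: rigid_def)
      then show ?thesis using sect_finv_fixed[OF aA] sgD(5)[OF K] by metis
    qed
    then show ?thesis using a inv aA by (simp add: rigid_def)
  qed
qed

lemma st_level_mono:
  assumes G: "G \<subseteq> Aut" and nm: "n \<le> m" shows "st G (level m) \<subseteq> st G (level n)"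
proof
  fix g assume g: "g \<in> st G (level m)"
  then have gA: "g \<in> Aut" using G by (auto simp: st_def)
  have "g x = x" if "x \<in> level n" for x
  proof (rule Aut_fixes_prefix[OF gA])
    have "x @ replicate (m - n) undefined \<in> level m" using that nm by (simp add: level_def)
    then show "g (x @ replicate (m - n) undefined) = x @ replicate (m - n) undefined"
      using g by (simp add: st_def)
  qed
  then show "g \<in> st G (level n)" using g by (simp add: st_def)
qed

context branch_group
begin

text \<open>By the pigeonhole principle infinitely many grafts at \<open>w\<close> lie in one coset
  of \<open>F\<close>; their quotients by one of them are grafts in \<open>F\<close> with pairwise
  distinct sections at \<open>w\<close>.\<close>

lemma infinite_psi:
  assumes A: "sg A" "sg F" "index_finite A F" and graft: "\<And>k. k \<in> K \<Longrightarrow> graft w k \<in> A"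
  shows "infinite (psi w F)"
proof
  assume fin: "finite (psi w F)"
  obtain f :: "_ \<Rightarrow> ('a list \<Rightarrow> 'a list) set" where
    f: "finite (f ` A)" "\<And>a b. a \<in> A \<Longrightarrow> b \<in> A \<Longrightarrow> f a = f b \<Longrightarrow> a \<circ> finv b \<in> F"
    by (rule index_finiteE[OF A(3,2) sgD(2)[OF A(1)]]) blast
  have "finite ((\<lambda>k. f (graft w k)) ` K)"
    by (rule finite_subset[OF _ f(1)]) (use graft in auto)
  then obtain l where l: "l \<in> K" "infinite {k \<in> K. f (graft w k) = f (graft w l)}"
    using pigeonhole_infinite[OF K_infinite] by blast
  have lA: "l \<in> Aut" using sgD(3)[OF sgK l(1)] .
  let ?S = "{k \<in> K. f (graft w k) = f (graft w l)}"
  have "(\<lambda>k. k \<circ> finv l) ` ?S \<subseteq> psi w F"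
  proof
    fix x assume "x \<in> (\<lambda>k. k \<circ> finv l) ` ?S"
    then obtain k where k: "k \<in> K" "f (graft w k) = f (graft w l)" "x = k \<circ> finv l" by auto
    have "graft w k \<circ> finv (graft w l) \<in> F" by (rule f(2)[OF graft[OF k(1)] graft[OF l(1)] k(2)])
    then have "graft w x \<in> F" using k lA by (simp add: graft_comp graft_finv)
    then show "x \<in> psi w F" unfolding psi_def by (intro image_eqI[of _ _ "graft w x"]) auto
  qed
  moreover have "inj_on (\<lambda>k. k \<circ> finv l) ?S"
  proof (rule inj_onI)
    fix a b assume "a \<circ> finv l = b \<circ> finv l"
    then have "a \<circ> finv l \<circ> l = b \<circ> finv l \<circ> l" by simp
    then show "a = b" using lA by (simp add: comp_assoc)
  qed
  ultimately show False using fin l(2) by (meson finite_imageD finite_subset)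
qed

lemma infinite_psi_G: "sg F \<Longrightarrow> index_finite G F \<Longrightarrow> infinite (psi w F)"
  using infinite_psi[OF sgG] K_graft K_sub by blast

text \<open>Extend \<open>u\<close> to a word through some leaf \<open>y\<close>. An infra-direct
  product has infinitely many sections there, by finite index at \<open>y\<close>, whereas a finite
  set of sections at \<open>u\<close> stays finite further down.\<close>

lemma finite_psi_not_infra_direct:
  assumes H: "sg H" "finite (psi u H)" and Y: "spanning_leaf_set Y"
  shows "\<not> infra_direct G H Y"
proof
  assume inf: "infra_direct G H Y"
  obtain z y where y: "y \<in> Y" "prefix y (u @ z)" using spanning_extend[OF Y] .
  then obtain t where t: "u @ z = y @ t" by (auto simp: prefix_def)
  have "infinite (psi t (psi y (st H Y)))"
    by (rule infinite_psi_G[OF sg_psi_st[OF H(1) y(1)] infra_directD[OF inf y(1)]])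
  moreover have "psi t (psi y (st H Y)) = psi (u @ z) (st H Y)" unfolding t psi_append by (simp add: psi_def)
  moreover have "psi (u @ z) (st H Y) \<subseteq> psi (u @ z) H" by (rule psi_mono) (auto simp: st_def)
  moreover have "finite (psi (u @ z) H)" using H(2) by (simp add: psi_append)
  ultimately show False using finite_subset by auto
qed

text \<open>Over a single letter the tree is a ray, whose only automorphism is the identity.\<close>

lemma card_alphabet: "card (UNIV :: 'a set) \<ge> 2"
proof (rule ccontr)
  assume "\<not> card (UNIV :: 'a set) \<ge> 2"
  moreover have "card (UNIV :: 'a set) > 0" by (simp add: card_gt_0_iff)
  ultimately have "card (UNIV :: 'a set) = 1" by linarith
  then obtain c :: 'a where c: "UNIV = {c}" by (auto simp: card_1_singleton_iff)
  have eq: "x = y" if "length x = length y" for x y :: "'a list"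
  proof (rule nth_equalityI[OF that])
    show "x ! i = y ! i" for i using c by (metis UNIV_I singletonD)
  qed
  have "G \<subseteq> {id}"
  proof
    fix g assume "g \<in> G"
    then have "g w = w" for w using G_Aut by (intro eq) auto
    then show "g \<in> {id}" by (simp add: fun_eq_iff)
  qed
  then show False using G_infinite finite_subset by blast
qed

text \<open>\<open>R\<close> consists of independent copies of \<open>K\<close> along the
  \<open>L\<close>-orbit of a deep vertex \<open>v\<close> below \<open>y\<close>. As
  \<open>L\<close> normalizes \<open>R\<close>, the product \<open>L R\<close> is a group. The index
  is infinite because grafts of \<open>K\<close> at \<open>v\<close> are added while
  \<open>L\<close> has finitely many sections there, and the sections at a vertex below
  \<open>y\<close> outside the orbit remain those of \<open>L\<close>.\<close>

lemma enlarge_finite_psi: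
  assumes L: "sg L" "L \<subseteq> G" and fin: "finite (psi y L)"
  obtains L' y' where "sg L'" "L \<subseteq> L'" "L' \<subseteq> G" "L' \<subseteq> L <#>\<^bsub>AutX\<^esub> st G (level n)"
    "\<not> index_finite L' L" "finite (psi y' L')"
proof -
  \<comment> \<open>Depth at least \<open>n\<close> places \<open>R\<close> in the stabilizer of
    level \<open>n\<close>; depth at least the number of sections at \<open>y\<close> leaves more
    words of length \<open>k\<close> than an orbit can reach.\<close>
  define k where "k = max n (card (psi y L))"
  define m where "m = length y + k"
  define v where "v = y @ replicate k undefined"
  define O' where "O' = orb L v"
  have O_level: "O' \<subseteq> level m"
    using sgD(3)[OF L(1)] by (auto simp: O'_def orb_def level_def v_def m_def)
  have vO: "v \<in> O'" unfolding O'_def orb_def using sgD(1)[OF L(1)] by (intro image_eqI[of _ _ id]) auto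
  have O_inv: "l o' \<in> O'" if l: "l \<in> L" and o: "o' \<in> O'" for l o'
  proof -
    obtain h where h: "h \<in> L" "o' = h v" using o by (auto simp: O'_def orb_def)
    then have "l o' = (l \<circ> h) v" by simp
    then show ?thesis unfolding O'_def orb_def using sgD(4)[OF L(1) l h(1)] by (rule image_eqI)
  qed
  \<comment> \<open>The orbit meets the subtree at \<open>y\<close> only in images of one fixed word
    under sections of \<open>L\<close> at \<open>y\<close>, hence in at most
    \<open>card (psi y L)\<close> vertices, fewer than the words of length \<open>k\<close> over at
    least two letters.\<close>
  have "\<exists>w. length w = k \<and> y @ w \<notin> O'"
  proof (rule ccontr)
    assume "\<nexists>w. length w = k \<and> y @ w \<notin> O'"
    then have all: "y @ w \<in> O'" if "length w = k" for w using that by blast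
    have "{w. length w = k} \<subseteq> (\<lambda>s. s (replicate k undefined)) ` psi y L"
    proof
      fix w :: "'a list" assume "w \<in> {w. length w = k}"
      then obtain g where g: "g \<in> L" "y @ w = g v" using all[of w] by (auto simp: O'_def orb_def)
      have gA: "g \<in> Aut" using sgD(3)[OF L(1) g(1)] .
      have "y @ w = g y @ sect g y (replicate k undefined)" using g(2) Aut_append[OF gA] by (simp add: v_def)
      then have "w = sect g y (replicate k undefined)" using gA by (simp add: append_eq_append_conv)
      then show "w \<in> (\<lambda>s. s (replicate k undefined)) ` psi y L" using g(1) by (auto simp: psi_def)
    qed
    then have "card {w :: 'a list. length w = k} \<le> card (psi y L)"
      using fin by (meson card_image_le card_mono finite_imageI order_trans)
    moreover have "card {w :: 'a list. length w = k} = card (UNIV :: 'a set) ^ k"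
      using card_lists_length_eq[of "UNIV :: 'a set" k] by simp
    moreover have "k < card (UNIV :: 'a set) ^ k" using card_alphabet by (intro power_gt_expt) simp
    moreover have "card (psi y L) \<le> k" by (simp add: k_def)
    ultimately show False by linarith
  qed
  then obtain w where w: "length w = k" "y @ w \<notin> O'" by blast
  define R where "R = rigid K O'"
  have sR: "sg R" unfolding R_def by (rule sg_rigid[OF sgK])
  have "rigid K O' \<subseteq> rigid K (level m)"
  proof
    fix g assume g: "g \<in> rigid K O'"
    have gA: "g \<in> Aut" using g by (simp add: rigid_def)
    have "g u = u \<and> sect g u \<in> K" if u: "u \<in> level m" for u
    proof (cases "u \<in> O'")
      case True then show ?thesis using g by (auto simp: rigid_def)
    next
      case False
      have "\<not> prefix x (u @ z)" if "x \<in> O'" for x z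
        using prefix_same_length[of x "u @ z" u] that False u O_level by (auto simp: level_def)
      then have fx: "g (u @ z) = u @ z" for z using g by (auto simp: rigid_def)
      have "g u = u" using fx[of "[]"] by simp
      moreover have "sect g u = id" using fx by (simp add: sect_def fun_eq_iff)
      ultimately show ?thesis using sgD(1)[OF sgK] by simp
    qed
    moreover have "g u = u" if "\<forall>x\<in>level m. \<not> prefix x u" for u
      using g that O_level unfolding rigid_def by blast
    ultimately show "g \<in> rigid K (level m)" using gA by (simp add: rigid_def)
  qed
  then have R_sub: "R \<subseteq> rigid K (level m)" by (simp add: R_def)
  then have RG: "R \<subseteq> G" using K_rigid by blast
  have R_st: "R \<subseteq> st G (level n)"
  proof -
    have "R \<subseteq> st G (level m)" using R_sub RG by (auto simp: st_def rigid_def)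
    moreover have "n \<le> m" by (simp add: m_def k_def)
    ultimately show ?thesis using st_level_mono[OF G_Aut] by blast
  qed
  have norm: "l \<circ> r \<circ> finv l \<in> R" if l: "l \<in> L" and r: "r \<in> R" for l r
  proof -
    have lA: "l \<in> Aut" and rA: "r \<in> Aut" using sgD(3)[OF L(1) l] sgD(3)[OF sR r] .
    have out: "r x = x" if "\<forall>o'\<in>O'. \<not> prefix o' x" for x using r that by (auto simp: R_def rigid_def)
    have "(l \<circ> r \<circ> finv l) x = x" if x: "\<forall>o'\<in>O'. \<not> prefix o' x" for x
    proof -
      have "\<not> prefix o' (finv l x)" if o: "o' \<in> O'" for o'
        using x O_inv[OF l o] Aut_prefix[OF lA, of o' "finv l x"] lA by auto
      then show ?thesis using out[of "finv l x"] lA by simp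
    qed
    moreover have "(l \<circ> r \<circ> finv l) o' = o' \<and> sect (l \<circ> r \<circ> finv l) o' \<in> K" if o: "o' \<in> O'" for o'
    proof -
      let ?p = "finv l o'"
      have p: "?p \<in> O'" using O_inv[OF sgD(5)[OF L(1) l] o] .
      then have rp: "r ?p = ?p" "sect r ?p \<in> K" using r by (auto simp: R_def rigid_def)
      have "sect (l \<circ> r \<circ> finv l) o' = sect l ?p \<circ> sect r ?p \<circ> finv (sect l ?p)"
        using lA rA rp by (simp add: sect_comp sect_finv)
      moreover have "sect l ?p \<in> G" using l L(2) G_sect by blast
      ultimately have "sect (l \<circ> r \<circ> finv l) o' \<in> K" using K_normal rp(2) by (simp add: normalized_def)
      then show ?thesis using rp lA by simp
    qed
    ultimately show ?thesis unfolding R_def rigid_def using lA rA by simp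
  qed
  define L' where "L' = {l \<circ> r |l r. l \<in> L \<and> r \<in> R}"
  have LI: "l \<circ> r \<in> L'" if "l \<in> L" "r \<in> R" for l r using that by (auto simp: L'_def)
  have sL': "sg L'"
  proof (rule sgI)
    show "L' \<subseteq> Aut" using sgD(3)[OF L(1)] sgD(3)[OF sR] by (auto simp: L'_def)
    show "id \<in> L'" using LI[OF sgD(1)[OF L(1)] sgD(1)[OF sR]] by simp
  next
    fix a b assume "a \<in> L'" "b \<in> L'"
    then obtain l r l' r' where ab: "a = l \<circ> r" "b = l' \<circ> r'" "l \<in> L" "l' \<in> L" "r \<in> R" "r' \<in> R"
      by (auto simp: L'_def)
    have A: "l' \<in> Aut" using sgD(3)[OF L(1)] ab by auto
    have "finv l' \<circ> r \<circ> finv (finv l') \<in> R" using norm sgD(5)[OF L(1)] ab by blast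
    then have "finv l' \<circ> r \<circ> l' \<in> R" using A by simp
    then have "(finv l' \<circ> r \<circ> l') \<circ> r' \<in> R" by (rule sgD(4)[OF sR _ ab(6)])
    then have "(l \<circ> l') \<circ> ((finv l' \<circ> r \<circ> l') \<circ> r') \<in> L'"
      by (rule LI[OF sgD(4)[OF L(1) ab(3,4)]])
    moreover have "(l \<circ> l') \<circ> ((finv l' \<circ> r \<circ> l') \<circ> r') = a \<circ> b" using A ab by (simp add: fun_eq_iff)
    ultimately show "a \<circ> b \<in> L'" by simp
  next
    fix a assume "a \<in> L'"
    then obtain l r where a: "a = l \<circ> r" "l \<in> L" "r \<in> R" by (auto simp: L'_def)
    have A: "l \<in> Aut" "r \<in> Aut" using sgD(3)[OF L(1)] sgD(3)[OF sR] a by auto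
    have "finv l \<circ> (l \<circ> finv r \<circ> finv l) \<in> L'"
      by (rule LI[OF sgD(5)[OF L(1) a(2)] norm[OF a(2) sgD(5)[OF sR a(3)]]])
    moreover have "finv l \<circ> (l \<circ> finv r \<circ> finv l) = finv a"
      unfolding a(1) using A by (simp add: finv_comp_distrib comp_assoc[symmetric])
    ultimately show "finv a \<in> L'" by simp
  qed
  have LL': "L \<subseteq> L'" using LI[OF _ sgD(1)[OF sR]] by auto
  have RL': "R \<subseteq> L'" using LI[OF sgD(1)[OF L(1)]] by auto
  have psi_ext: "finite (psi (y @ z) L)" for z using fin by (simp add: psi_append)
  show ?thesis
  proof (rule that[OF sL' LL'])
    show "L' \<subseteq> G" using L(2) RG sgD(4)[OF sgG] by (auto simp: L'_def)
    show "L' \<subseteq> L <#>\<^bsub>AutX\<^esub> st G (level n)" using R_st by (auto simp: L'_def set_mult_def)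
    show "\<not> index_finite L' L"
    proof
      assume "index_finite L' L"
      moreover have "graft v c \<in> L'" if c: "c \<in> K" for c
      proof -
        have cA: "c \<in> Aut" using sgD(3)[OF sgK c] .
        note gr = graft_Aut[OF cA, of v] supported_graft[of v c]
        have "graft v c o' = o' \<and> sect (graft v c) o' \<in> K" if "o' \<in> O'" for o'
        proof (cases "o' = v")
          case True then show ?thesis using supported_fixes[OF gr] c by simp
        next
          case False
          have "length o' = length v" using that vO O_level by (auto simp: level_def)
          then show ?thesis using supported_off_sect[OF gr _ False] sgD(1)[OF sgK] by simp
        qed
        moreover have "graft v c x = x" if "\<forall>o'\<in>O'. \<not> prefix o' x" for x
          using that vO by (simp add: graft_def)
        ultimately have "graft v c \<in> R" using gr by (simp add: R_def rigid_def)
        then show ?thesis using RL' by blast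
      qed
      ultimately have "infinite (psi v L)" using infinite_psi[OF sL' L(1)] by blast
      then show False using psi_ext by (simp add: v_def)
    qed
    have "psi (y @ w) L' \<subseteq> psi (y @ w) L"
    proof
      fix s assume "s \<in> psi (y @ w) L'"
      then obtain l r where s: "s = sect (l \<circ> r) (y @ w)" "l \<in> L" "r \<in> R" by (auto simp: psi_def L'_def)
      have A: "l \<in> Aut" "r \<in> Aut" using sgD(3)[OF L(1)] sgD(3)[OF sR] s by auto
      have "\<not> prefix o' ((y @ w) @ z)" if "o' \<in> O'" for o' z
      proof
        assume "prefix o' ((y @ w) @ z)"
        moreover have "length o' = length (y @ w)" using that O_level w(1) by (auto simp: level_def m_def)
        ultimately have "o' = y @ w" by (intro prefix_same_length[of _ "(y @ w) @ z"]) auto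
        then show False using that w(2) by simp
      qed
      then have fx: "r ((y @ w) @ z) = (y @ w) @ z" for z using s(3) unfolding R_def rigid_def by blast
      have "r (y @ w) = y @ w" using fx[of "[]"] by simp
      moreover have "sect r (y @ w) = id"
        using fx sect_id_iff[OF A(2) \<open>r (y @ w) = y @ w\<close>] by blast
      ultimately have "s = sect l (y @ w)" using s(1) A by (simp add: sect_comp)
      then show "s \<in> psi (y @ w) L" using s(2) by (auto simp: psi_def)
    qed
    then show "finite (psi (y @ w) L')" using psi_ext finite_subset by blast
  qed
qed

text \<open>Passing to the stabilizer of \<open>ys\<close> changes a subgroup only by finite index,
  so an inclusion of infinite index must be visible in the rank of the stabilizers.\<close>

lemma orbit_rank_less:
  assumes L: "sg L" "L \<subseteq> H" and H: "sg H" "H \<subseteq> H'" and H': "sg H'" "H' \<subseteq> G"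
    and Y: "spanning_leaf_set (set ys)" and inf: "infra_direct G L (set ys)"
    and idx: "\<not> index_finite H' H"
  shows "orbit_rank (st L (set ys)) ys (st H (set ys)) < orbit_rank (st L (set ys)) ys (st H' (set ys))"
proof (rule ccontr)
  let ?st = "\<lambda>H. st H (set ys)"
  assume neg: "\<not> orbit_rank (?st L) ys (?st H) < orbit_rank (?st L) ys (?st H')"
  have mono: "?st L \<subseteq> ?st H" "?st H \<subseteq> ?st H'" using L(2) H(2) by (auto simp: st_def)
  have "index_finite (?st H') (?st H)"
  proof (rule index_finite_of_orbit_rank[OF sg_st[OF L(1)] _ fixes_pointwise_st _ Y sg_st[OF H(1)] mono sg_st[OF H'(1)]])
    show "?st L \<subseteq> G" "?st H' \<subseteq> G" using L(2) H(2) H'(2) by (auto simp: st_def)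
    show "index_finite G (psi (ys ! i) (?st L))" if "i < length ys" for i
      using infra_directD[OF inf] that by simp
  qed (use neg fixes_pointwise_st in auto)
  then have "index_finite H' (?st H)"
    using index_finite_trans[OF index_finite_st[OF H'(1)] _ H'(1) sg_st[OF H'(1)] sg_st[OF H(1)] mono(2)]
    by (auto simp: st_def)
  then have "index_finite H' H"
    by (rule index_finite_mono_right[OF _ sg_st[OF H(1)] H(1) _ sgD(2)[OF H'(1)]]) (auto simp: st_def)
  then show False using idx by simp
qed

end

section \<open>The space of subgroups\<close>

lemma subgrpD: "subgrp H G \<Longrightarrow> sg H" "subgrp H G \<Longrightarrow> H \<subseteq> G"
  by (simp_all add: subgrp_def)

lemma sub_emb_inject:
  assumes "subgrp H G" "subgrp L G" "sub_emb G H = sub_emb G L" shows "H = L"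
proof -
  have "g \<in> H \<longleftrightarrow> g \<in> L" if "g \<in> G" for g
    using fun_cong[OF assms(3), of g] that by (simp add: sub_emb_def)
  then show ?thesis using subgrpD(2)[OF assms(1)] subgrpD(2)[OF assms(2)] by blast
qed

lemma topspace_SubTop: "topspace (SubTop G) = sub_emb G ` {H. subgrp H G}"
  by (auto simp: SubTop_def sub_emb_def)

text \<open>The subgroups with the same trace as \<open>L\<close> on a finite subset of
  \<open>G\<close> form a neighbourhood basis of \<open>L\<close>.\<close>

lemma SubTop_derived_iff:
  assumes L: "subgrp L G"
  shows "sub_emb G L \<in> SubTop G derived_set_of A \<longleftrightarrow>
    (\<forall>F. finite F \<and> F \<subseteq> G \<longrightarrow> (\<exists>H. subgrp H G \<and> sub_emb G H \<in> A \<and> H \<noteq> L \<and> H \<inter> F = L \<inter> F))"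
    (is "?lhs \<longleftrightarrow> ?rhs")
proof
  let ?X = "product_topology (\<lambda>_. discrete_topology (UNIV :: bool set)) G"
  {
    assume lhs: ?lhs
    show ?rhs
    proof (intro allI impI)
      fix F assume F: "finite F \<and> F \<subseteq> G"
      define U where "U g = (if g \<in> F then {g \<in> L} else UNIV)" for g
      have "{g \<in> G. U g \<noteq> UNIV} \<subseteq> F" by (auto simp: U_def)
      then have "finite {g \<in> G. U g \<noteq> UNIV}" using F finite_subset by blast
      then have "openin ?X (PiE G U)" by (simp add: openin_PiE_gen)
      then have "openin (SubTop G) (PiE G U \<inter> sub_emb G ` {H. subgrp H G})"
        unfolding SubTop_def by (rule openin_subtopology_Int)
      moreover have "sub_emb G L \<in> PiE G U \<inter> sub_emb G ` {H. subgrp H G}"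
        using L by (auto simp: sub_emb_def U_def)
      ultimately obtain x where x: "x \<noteq> sub_emb G L" "x \<in> A" "x \<in> PiE G U \<inter> sub_emb G ` {H. subgrp H G}"
        using lhs[unfolded in_derived_set_of, THEN conjunct2, rule_format] by metis
      then obtain H where H: "subgrp H G" "x = sub_emb G H" by auto
      have "g \<in> H \<longleftrightarrow> g \<in> L" if g: "g \<in> F" for g
      proof -
        have gG: "g \<in> G" using g F by auto
        then have "x g \<in> U g" using x(3) by (auto simp: PiE_iff)
        then show ?thesis using H(2) g gG by (simp add: U_def sub_emb_def)
      qed
      then show "\<exists>H. subgrp H G \<and> sub_emb G H \<in> A \<and> H \<noteq> L \<and> H \<inter> F = L \<inter> F" using H x by blast
    qed
  next
    assume rhs: ?rhs
    show ?lhs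
      unfolding in_derived_set_of
    proof (intro conjI allI impI)
      show "sub_emb G L \<in> topspace (SubTop G)" using L by (auto simp: topspace_SubTop)
      fix T assume T: "sub_emb G L \<in> T \<and> openin (SubTop G) T"
      then obtain T' where T': "openin ?X T'" "T = T' \<inter> sub_emb G ` {H. subgrp H G}"
        unfolding SubTop_def openin_subtopology by blast
      have "\<exists>U. finite {i \<in> G. U i \<noteq> UNIV} \<and> sub_emb G L \<in> PiE G U \<and> PiE G U \<subseteq> T'"
        using T'(1) T T'(2) unfolding openin_product_topology_alt by fastforce
      then obtain U where U: "finite {i \<in> G. U i \<noteq> UNIV}" "sub_emb G L \<in> PiE G U" "PiE G U \<subseteq> T'" by blast
      define F where "F = {i \<in> G. U i \<noteq> UNIV}"
      have "finite F \<and> F \<subseteq> G" using U(1) by (auto simp: F_def)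
      then obtain H where H: "subgrp H G" "sub_emb G H \<in> A" "H \<noteq> L" "H \<inter> F = L \<inter> F"
        using rhs by metis
      have "sub_emb G H g \<in> U g" if g: "g \<in> G" for g
      proof (cases "U g = UNIV")
        case False
        then have "g \<in> F" using g by (simp add: F_def)
        then have "g \<in> H \<longleftrightarrow> g \<in> L" using H(4) by blast
        moreover have "sub_emb G L g \<in> U g" using U(2) g by (auto simp: PiE_iff)
        ultimately show ?thesis using g by (simp add: sub_emb_def)
      qed simp
      then have "sub_emb G H \<in> PiE G U" by (simp add: PiE_iff sub_emb_def)
      then have "sub_emb G H \<in> T" using U(3) T'(2) H(1) by blast
      moreover have "sub_emb G H \<noteq> sub_emb G L" using sub_emb_inject[OF H(1) L] H(3) by blast
      ultimately show "\<exists>y. y \<noteq> sub_emb G L \<and> y \<in> A \<and> y \<in> T" using H(2) by blast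
    qed
  }
qed

text \<open>A set whose points all accumulate at the set itself survives each derivative step and
  each intersection.\<close>

lemma dense_in_itself_perfect_kernel:
  assumes "P \<subseteq> topspace T" "P \<subseteq> T derived_set_of P" shows "P \<subseteq> perfect_kernel T"
proof -
  have "P \<subseteq> A" if "A \<in> cb_iter T" for A
    using that
  proof induction
    case base then show ?case by (rule assms(1))
  next
    case (step A)
    then have "T derived_set_of P \<subseteq> T derived_set_of A" by (intro derived_set_of_mono)
    then show ?case using step assms(2) by (auto simp: cb_deriv_def)
  next
    case (lim S) then show ?case by blast
  qed
  then show ?thesis by (auto simp: perfect_kernel_def)
qed

lemma cb_fin_Suc: "cb_fin T (Suc n) = cb_deriv T (cb_fin T n)"
  by (simp add: cb_fin_def)

lemma cb_fin_in_cb_iter: "cb_fin T n \<in> cb_iter T"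
  by (induction n) (auto simp: cb_fin_Suc cb_iter.step, simp add: cb_fin_def cb_iter.base)

lemma cb_rank_finiteI:
  assumes "x \<in> topspace T" "x \<notin> cb_fin T n" shows "cb_rank_finite T x"
proof -
  have "x \<in> cb_fin T 0" using assms(1) by (simp add: cb_fin_def)
  then show ?thesis unfolding cb_rank_finite_def using assms(2) by (induction n) auto
qed

lemma cb_rank_finite_perfect_kernel: "cb_rank_finite T x \<Longrightarrow> x \<notin> perfect_kernel T"
  using cb_fin_in_cb_iter by (auto simp: cb_rank_finite_def perfect_kernel_def)

section \<open>Finite Cantor--Bendixson rank and finite depth of infra-direct subgroups\<close>

context branch_group
begin

text \<open>Induction on \<open>k\<close>, a bound for the distance from the rank of
  \<open>H\<close> to the maximum \<open>B\<close>. If \<open>H\<close> survived one more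
  derivative, nearby surviving subgroups would include an overgroup of strictly larger rank; at
  distance \<open>0\<close> there is none.\<close>

lemma infra_direct_not_cb_fin:
  assumes G: "fin_gen G" and L: "subgrp L G" and Y: "spanning_leaf_set (set ys)"
    and inf: "infra_direct G L (set ys)"
    and B: "\<And>M. orbit_rank (st L (set ys)) ys M \<le> B"
  shows "\<lbrakk>subgrp H G; L \<subseteq> H; B \<le> orbit_rank (st L (set ys)) ys (st H (set ys)) + k\<rbrakk> \<Longrightarrow>
    sub_emb G H \<notin> cb_fin (SubTop G) (Suc k)"
proof (induction k arbitrary: H)
  let ?rk = "\<lambda>H. orbit_rank (st L (set ys)) ys (st H (set ys))"
  have step: "\<exists>H'. subgrp H' G \<and> L \<subseteq> H' \<and> sub_emb G H' \<in> cb_fin (SubTop G) k \<and> ?rk H < ?rk H'"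
    if H: "subgrp H G" and LH: "L \<subseteq> H" and mem: "sub_emb G H \<in> cb_fin (SubTop G) (Suc k)" for H k
  proof -
    note sH = subgrpD[OF H]
    have infH: "infra_direct G H (set ys)"
      by (rule infra_direct_mono[OF subgrpD(1)[OF L] LH sH inf])
    obtain S where S: "finite S" "S \<subseteq> Aut" "H = generate AutX S"
      using infra_direct_fin_gen[OF G sH Y infH] by (auto simp: fin_gen_def)
    let ?O = "{H'. sg H' \<and> H \<subseteq> H' \<and> H' \<subseteq> G \<and> index_finite H' H} - {H}"
    have finO: "finite ?O" using finite_finite_index_overgroups[OF sH Y infH] by simp
    have "\<forall>H'\<in>?O. \<exists>x. x \<in> H' \<and> x \<notin> H" by blast
    from bchoice[OF this] obtain x where x: "\<And>H'. H' \<in> ?O \<Longrightarrow> x H' \<in> H' \<and> x H' \<notin> H" by blast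
    define F where "F = S \<union> x ` ?O"
    have SH: "S \<subseteq> H" using S(3) generate_superset by blast
    have xG: "x ` ?O \<subseteq> G"
    proof (rule image_subsetI)
      fix H' assume H': "H' \<in> ?O"
      then have "H' \<subseteq> G" by simp
      then show "x H' \<in> G" using x[OF H'] by blast
    qed
    have F: "finite F \<and> F \<subseteq> G"
      unfolding F_def using finite_UnI[OF S(1) finite_imageI[OF finO]] subset_trans[OF SH sH(2)] xG by simp
    have "sub_emb G H \<in> SubTop G derived_set_of cb_fin (SubTop G) k"
      using mem by (simp add: cb_fin_Suc cb_deriv_def)
    then obtain H' where H': "subgrp H' G" "sub_emb G H' \<in> cb_fin (SubTop G) k" "H' \<noteq> H" "H' \<inter> F = H \<inter> F"
      unfolding SubTop_derived_iff[OF H] using F by metis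
    note sH' = subgrpD[OF H'(1)]
    have "S \<subseteq> F" by (simp add: F_def)
    then have "S \<subseteq> H'" using H'(4) SH by blast
    then have HH': "H \<subseteq> H'" using S(3) generate_least[OF sH'(1)] by blast
    have "\<not> index_finite H' H"
    proof
      assume "index_finite H' H"
      then have O: "H' \<in> ?O" using sH' HH' H'(3) by simp
      then have "x H' \<in> F" by (simp add: F_def)
      then show False using x[OF O] H'(4) by blast
    qed
    then have "?rk H < ?rk H'"
      by (rule orbit_rank_less[OF subgrpD(1)[OF L] LH sH(1) HH' sH' Y inf])
    then show ?thesis using H' LH HH' by blast
  qed
  {
    case 0
    show ?case
    proof
      assume "sub_emb G H \<in> cb_fin (SubTop G) (Suc 0)"
      then obtain H' where "?rk H < ?rk H'" using step[OF 0(1,2)] by blast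
      then show False using 0(3) B[of "st H' (set ys)"] by simp
    qed
  next
    case (Suc k)
    show ?case
    proof
      assume "sub_emb G H \<in> cb_fin (SubTop G) (Suc (Suc k))"
      then obtain H' where H': "subgrp H' G" "L \<subseteq> H'" "sub_emb G H' \<in> cb_fin (SubTop G) (Suc k)" "?rk H < ?rk H'"
        using step[OF Suc.prems(1,2)] by blast
      have "B \<le> ?rk H' + k" using H'(4) Suc.prems(3) by simp
      then show False using Suc.IH[OF H'(1,2)] H'(3) by blast
    qed
  }
qed

lemma infra_direct_orbit_rank_bound:
  assumes L: "subgrp L G" and Y: "spanning_leaf_set Y" and inf: "infra_direct G L Y"
  obtains ys B where "set ys = Y" "\<And>M. orbit_rank (st L Y) ys M \<le> B"
proof -
  have "finite Y" using Y by (simp add: spanning_leaf_set_def leaf_set_def)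
  then obtain ys where ys: "set ys = Y" using finite_list by blast
  have "\<exists>B. \<forall>M. orbit_rank (st L Y) ys M \<le> B"
  proof (rule orbit_rank_bounded[OF sg_st[OF subgrpD(1)[OF L]]])
    show "st L Y \<subseteq> G" using subgrpD(2)[OF L] by (auto simp: st_def)
    show "fixes_pointwise (st L Y) (set ys)" unfolding ys by (rule fixes_pointwise_st)
    show "index_finite G (psi (ys ! i) (st L Y))" if "i < length ys" for i
      using infra_directD[OF inf] ys that by auto
  qed
  then show ?thesis using that ys by blast
qed

lemma infra_direct_cb_rank_finite:
  assumes G: "fin_gen G" and L: "subgrp L G" and Y: "spanning_leaf_set Y" and inf: "infra_direct G L Y"
  shows "cb_rank_finite (SubTop G) (sub_emb G L)"
proof -
  obtain ys B where ys: "set ys = Y" and B: "\<And>M. orbit_rank (st L Y) ys M \<le> B"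
    using infra_direct_orbit_rank_bound[OF L Y inf] by blast
  have "sub_emb G L \<notin> cb_fin (SubTop G) (Suc B)"
    by (rule infra_direct_not_cb_fin[OF G L _ _ _ L subset_refl, of ys B]) (use Y inf B ys in auto)
  moreover have "sub_emb G L \<in> topspace (SubTop G)" using L by (auto simp: topspace_SubTop)
  ultimately show ?thesis by (intro cb_rank_finiteI)
qed

text \<open>The rank drops strictly at every step of a chain from \<open>G\<close> to
  \<open>L\<close>, so the length of the chain is at most the bound on the rank.\<close>

lemma infra_direct_depth_finite:
  assumes L: "subgrp L G" and Y: "spanning_leaf_set Y" and inf: "infra_direct G L Y"
  shows "depth_finite G L"
proof -
  obtain ys B where ys: "set ys = Y" and B: "\<And>M. orbit_rank (st L Y) ys M \<le> B"
    using infra_direct_orbit_rank_bound[OF L Y inf] by blast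
  let ?rk = "\<lambda>H. orbit_rank (st L Y) ys (st H Y)"
  have "n \<le> B" if H: "H 0 = G" "H n = L"
    and chain: "\<And>i. i < n \<Longrightarrow> subgrp (H (Suc i)) (H i) \<and> \<not> index_finite (H i) (H (Suc i))" for n H
  proof -
    have LH: "L \<subseteq> H i" if "i \<le> n" for i
      using that
    proof (induction i rule: inc_induct)
      case (step i)
      then show ?case using chain[of i] subgrpD(2)[of "H (Suc i)" "H i"] by blast
    qed (simp add: H)
    have HG: "sg (H i) \<and> H i \<subseteq> G" if "i \<le> n" for i
      using that
    proof (induction i)
      case (Suc i)
      then show ?case using chain[of i] by (auto simp: subgrp_def)
    qed (use H sgG in simp)
    have "?rk (H i) + i \<le> ?rk (H 0)" if "i \<le> n" for i
      using that
    proof (induction i)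
      case (Suc i)
      have i: "i < n" "i \<le> n" using Suc.prems by auto
      have "?rk (H (Suc i)) < ?rk (H i)"
        using orbit_rank_less[OF subgrpD(1)[OF L] LH[OF Suc.prems] _ _ _ _ , of "H i" ys]
          HG[OF Suc.prems] HG[OF i(2)] chain[OF i(1)] Y inf ys subgrpD(2)[of "H (Suc i)" "H i"] by blast
      then show ?case using Suc.IH i by simp
    qed simp
    from this[of n] B[of "st (H 0) Y"] show "n \<le> B" by simp
  qed
  then show ?thesis unfolding depth_finite_def by blast
qed

section \<open>Infinite depth and accumulation for subgroups with a finite section\<close>

lemma finite_psi_chain:
  assumes "sg L" "L \<subseteq> G" "finite (psi y L)"
  shows "\<exists>H. H 0 = G \<and> H (Suc n) = L \<and>
    (\<forall>i<Suc n. subgrp (H (Suc i)) (H i) \<and> \<not> index_finite (H i) (H (Suc i)))"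
  using assms
proof (induction n arbitrary: L y)
  case 0
  have "\<not> index_finite G L" using infinite_psi_G[OF 0(1)] 0(3) by blast
  then have "subgrp L G \<and> \<not> index_finite G L" using 0 by (simp add: subgrp_def)
  then show ?case by (intro exI[of _ "\<lambda>i. if i = 0 then G else L"]) simp
next
  case (Suc n)
  \<comment> \<open>The enlargement again has a finite section, so a chain from \<open>G\<close> to
    it exists by induction, and \<open>L\<close> is appended as the last term.\<close>
  obtain L' y' where L': "sg L'" "L \<subseteq> L'" "L' \<subseteq> G" "\<not> index_finite L' L" "finite (psi y' L')"
    by (rule enlarge_finite_psi[OF Suc.prems, of 0])
  obtain H where H: "H 0 = G" "H (Suc n) = L'"
    "\<And>i. i < Suc n \<Longrightarrow> subgrp (H (Suc i)) (H i) \<and> \<not> index_finite (H i) (H (Suc i))"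
    using Suc.IH[OF L'(1,3,5)] by blast
  let ?H = "\<lambda>i. if i \<le> Suc n then H i else L"
  have "subgrp (?H (Suc i)) (?H i) \<and> \<not> index_finite (?H i) (?H (Suc i))" if i: "i < Suc (Suc n)" for i
  proof (cases "i = Suc n")
    case True
    then show ?thesis using H(2) L' Suc.prems(1) by (simp add: subgrp_def)
  next
    case False
    then have "i < Suc n" using i by simp
    then show ?thesis using H(3) by simp
  qed
  then show ?case using H(1) by (intro exI[of _ ?H]) simp
qed

lemma fin_gen_depth_finite_infra_direct:
  assumes GN: "GN_alternative G" and L: "subgrp L G" "fin_gen L" and depth: "depth_finite G L"
  shows "\<exists>Y. spanning_leaf_set Y \<and> infra_direct G L Y"
proof (rule ccontr)
  assume "\<nexists>Y. spanning_leaf_set Y \<and> infra_direct G L Y"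
  then obtain y where y: "finite (psi y L)" using GN L unfolding GN_alternative_def by blast
  obtain N where N: "\<And>n H. \<lbrakk>H 0 = G; H n = L;
      \<forall>i<n. subgrp (H (Suc i)) (H i) \<and> \<not> index_finite (H i) (H (Suc i))\<rbrakk> \<Longrightarrow> n \<le> N"
    using depth unfolding depth_finite_def by blast
  obtain H where "H 0 = G" "H (Suc N) = L"
    "\<forall>i<Suc N. subgrp (H (Suc i)) (H i) \<and> \<not> index_finite (H i) (H (Suc i))"
    using finite_psi_chain[OF subgrpD[OF L(1)] y] by blast
  then have "Suc N \<le> N" by (rule N)
  then show False by simp
qed

text \<open>The subgroups that are not infra-direct form a set without isolated points: a finitely generated
  one is approximated from above by enlargements, the others from below by their finitely generated subgroups.\<close>

lemma not_infra_direct_perfect_kernel: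
  assumes wa: "well_approximated G" and GN: "GN_alternative G" and L: "subgrp L G"
    and bad: "\<nexists>Y. spanning_leaf_set Y \<and> infra_direct G L Y"
  shows "sub_emb G L \<in> perfect_kernel (SubTop G)"
proof -
  define P where "P = {H. subgrp H G \<and> (\<nexists>Y. spanning_leaf_set Y \<and> infra_direct G H Y)}"
  have PI: "H \<in> P" if "subgrp H G" "\<And>Y. spanning_leaf_set Y \<Longrightarrow> \<not> infra_direct G H Y" for H
    using that by (auto simp: P_def)
  have approx: "\<exists>H\<in>P. H \<noteq> M \<and> H \<inter> F = M \<inter> F" if M: "M \<in> P" and F: "finite F" "F \<subseteq> G" for M F
  proof -
    have MG: "subgrp M G" and Mbad: "\<And>Y. spanning_leaf_set Y \<Longrightarrow> \<not> infra_direct G M Y"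
      using M by (auto simp: P_def)
    note sM = subgrpD[OF MG]
    show ?thesis
    proof (cases "fin_gen M")
      case False
      \<comment> \<open>This subgroup has the trace of \<open>M\<close> on \<open>F\<close> and
        differs from \<open>M\<close> by being finitely generated. It is not infra-direct either,
        since infra-directness passes to overgroups.\<close>
      let ?H = "generate AutX (F \<inter> M)"
      have A: "F \<inter> M \<subseteq> Aut" using sgD(2)[OF sM(1)] by blast
      have sH: "sg ?H" by (rule sg_generate[OF A])
      have HM: "?H \<subseteq> M" by (rule generate_least[OF sM(1)]) auto
      have "fin_gen ?H" unfolding fin_gen_def using F(1) A by blast
      then have "?H \<noteq> M" using False by metis
      moreover have "?H \<inter> F = M \<inter> F" using HM generate_superset[of "F \<inter> M"] by blast
      moreover have "?H \<in> P"
      proof (rule PI)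
        show "subgrp ?H G" using sH HM sM(2) by (simp add: subgrp_def)
        show "\<not> infra_direct G ?H Y" if Y: "spanning_leaf_set Y" for Y
          using infra_direct_mono[OF sH HM sM] Mbad[OF Y] by blast
      qed
      ultimately show ?thesis by blast
    next
      case True
      then obtain y where y: "finite (psi y M)"
        using GN MG Mbad unfolding GN_alternative_def by blast
      have cap: "(\<Inter>n. M <#>\<^bsub>AutX\<^esub> st G (level n)) = M"
        using wa MG True unfolding well_approximated_def by blast
      have "\<forall>f\<in>F - M. \<exists>n. f \<notin> M <#>\<^bsub>AutX\<^esub> st G (level n)" using cap by blast
      from bchoice[OF this] obtain d where d: "\<And>f. f \<in> F - M \<Longrightarrow> f \<notin> M <#>\<^bsub>AutX\<^esub> st G (level (d f))"
        by blast
      \<comment> \<open>At this level all elements of \<open>F\<close> outside \<open>M\<close> are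
        already excluded from the product of \<open>M\<close> with the level stabilizer; the
        inserted \<open>0\<close> covers the case that \<open>F\<close> lies in
        \<open>M\<close>.\<close>
      define n where "n = Max (insert 0 (d ` (F - M)))"
      have dn: "d f \<le> n" if "f \<in> F - M" for f
        unfolding n_def by (rule Max_ge) (use F(1) that in auto)
      obtain L' y' where L': "sg L'" "M \<subseteq> L'" "L' \<subseteq> G" "L' \<subseteq> M <#>\<^bsub>AutX\<^esub> st G (level n)"
        "\<not> index_finite L' M" "finite (psi y' L')"
        by (rule enlarge_finite_psi[OF sM y, of n])
      have "L' \<inter> F \<subseteq> M"
      proof (rule ccontr)
        assume "\<not> L' \<inter> F \<subseteq> M"
        then obtain f where f: "f \<in> L'" "f \<in> F - M" by blast
        have "f \<in> M <#>\<^bsub>AutX\<^esub> st G (level n)" using f(1) L'(4) by blast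
        moreover have "st G (level n) \<subseteq> st G (level (d f))" by (rule st_level_mono[OF G_Aut dn[OF f(2)]])
        ultimately have "f \<in> M <#>\<^bsub>AutX\<^esub> st G (level (d f))" by (auto simp: set_mult_def)
        then show False using d[OF f(2)] by blast
      qed
      then have "L' \<inter> F = M \<inter> F" using L'(2) by blast
      moreover have "L' \<noteq> M" using L'(5) index_finite_refl[OF sM(1)] by blast
      moreover have "L' \<in> P"
        by (rule PI) (use L'(1,3) finite_psi_not_infra_direct[OF L'(1,6)] in \<open>auto simp: subgrp_def\<close>)
      ultimately show ?thesis by blast
    qed
  qed
  have "sub_emb G ` P \<subseteq> perfect_kernel (SubTop G)"
  proof (rule dense_in_itself_perfect_kernel)
    show "sub_emb G ` P \<subseteq> topspace (SubTop G)" by (auto simp: topspace_SubTop P_def)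
    show "sub_emb G ` P \<subseteq> SubTop G derived_set_of (sub_emb G ` P)"
    proof (rule image_subsetI)
      fix M assume M: "M \<in> P"
      then have MG: "subgrp M G" by (simp add: P_def)
      have PG: "subgrp H G" if "H \<in> P" for H using that by (simp add: P_def)
      show "sub_emb G M \<in> SubTop G derived_set_of (sub_emb G ` P)"
        unfolding SubTop_derived_iff[OF MG]
      proof (intro allI impI)
        fix F assume "finite F \<and> F \<subseteq> G"
        then obtain H where "H \<in> P" "H \<noteq> M" "H \<inter> F = M \<inter> F" using approx[OF M] by metis
        then show "\<exists>H. subgrp H G \<and> sub_emb G H \<in> sub_emb G ` P \<and> H \<noteq> M \<and> H \<inter> F = M \<inter> F"
          using PG by (intro exI[of _ H]) simp
      qed
    qed
  qed
  moreover have "L \<in> P" using L bad by (simp add: P_def)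
  ultimately show ?thesis by blast
qed

end

section \<open>From regular branch groups to the four equivalent conditions\<close>

lemma regular_branch_branch_group:
  assumes G: "sg G" and rb: "regular_branch G" and ji: "just_infinite G"
  obtains K where "branch_group G K"
proof -
  obtain K where K: "K \<lhd> (AutX\<lparr>carrier := G\<rparr>)" "index_finite G K" "\<forall>x. rigid K {x} \<subseteq> K"
    "\<forall>n. rigid K (level n) \<subseteq> G"
    using rb unfolding regular_branch_def by blast
  have K': "sg K" "K \<subseteq> G" "normalized G K"
    using K(1) unfolding normal_in_subgroup_iff[OF G] by (auto simp: normalized_def)
  have "branch_group G K"
  proof (rule branch_group.intro)
    show "sect g u \<in> G" if "g \<in> G" for g u using rb that by (simp add: regular_branch_def self_similar_def)
    show "level_transitive G" using rb by (simp add: regular_branch_def)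
    show "infinite G" using ji by (simp add: just_infinite_def)
    show "index_finite G N" if "sg N" "N \<subseteq> G" "normalized G N" "N \<noteq> {id}" for N
    proof -
      have "N \<lhd> (AutX\<lparr>carrier := G\<rparr>)" unfolding normal_in_subgroup_iff[OF G] using that by (simp add: normalized_def)
      then show ?thesis using ji that(4) by (simp add: just_infinite_def)
    qed
    show "graft u k \<in> K" if k: "k \<in> K" for u k
    proof -
      have kA: "k \<in> Aut" using sgD(3)[OF K'(1) k] .
      have "graft u k \<in> rigid K {u}"
        using k kA supported_graft[of u k] supported_fixes[OF graft_Aut[OF kA] supported_graft]
        by (simp add: rigid_def supported_def)
      then show ?thesis using K(3) by blast
    qed
    show "rigid K (level n) \<subseteq> G" for n using K(4) by blast
  qed (use G K K' in auto)
  then show ?thesis by (rule that)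
qed

theorem theorem5p2:
  fixes G L :: "('a::finite list \<Rightarrow> 'a list) set"
  assumes "subgroup G AutX"
    and "fin_gen G"
    and "regular_branch G"
    and "just_infinite G"
    and "strongly_self_replicating G"
    and "well_approximated G"
    and "GN_alternative G"
    and "subgrp L G"
  shows "(sub_emb G L \<notin> perfect_kernel (SubTop G)
            \<longleftrightarrow> (\<exists>Y. spanning_leaf_set Y \<and> infra_direct G L Y))
       \<and> ((\<exists>Y. spanning_leaf_set Y \<and> infra_direct G L Y)
            \<longleftrightarrow> cb_rank_finite (SubTop G) (sub_emb G L))
       \<and> (cb_rank_finite (SubTop G) (sub_emb G L)
            \<longleftrightarrow> depth_finite G L \<and> fin_gen L)"
proof -
  obtain K where "branch_group G K" using regular_branch_branch_group[OF assms(1,3,4)] .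
  then interpret branch_group G K .
  let ?inf = "\<exists>Y. spanning_leaf_set Y \<and> infra_direct G L Y"
  \<comment> \<open>A cycle runs through lying outside the perfect kernel, infra-directness and
    finite rank; the condition on depth and finite generation is tied to infra-directness in both
    directions.\<close>
  have "?inf" if "sub_emb G L \<notin> perfect_kernel (SubTop G)"
    using not_infra_direct_perfect_kernel[OF assms(6,7,8)] that by blast
  moreover have "cb_rank_finite (SubTop G) (sub_emb G L)" if ?inf
    using infra_direct_cb_rank_finite[OF assms(2,8)] that by blast
  moreover have "sub_emb G L \<notin> perfect_kernel (SubTop G)" if "cb_rank_finite (SubTop G) (sub_emb G L)"
    using that by (rule cb_rank_finite_perfect_kernel)
  moreover have "depth_finite G L \<and> fin_gen L" if ?inf
    using infra_direct_depth_finite[OF assms(8)] infra_direct_fin_gen[OF assms(2) subgrpD[OF assms(8)]] that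
    by blast
  moreover have ?inf if "depth_finite G L \<and> fin_gen L"
    using fin_gen_depth_finite_infra_direct[OF assms(7,8)] that by blast
  ultimately show ?thesis by argo
qed

end
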